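(* Let $0<2\alpha<1$, let $D,X,\Gamma$ be as in the context, and let $\rho_1$ be a continuous function on $\overline\Gamma$, written in terms of the parameters. Let $$v_1(x,y,z)=\iint_\Gamma\rho_1(\theta,\vartheta)\,q_1(\xi,\eta,\zeta;x,y,z)\,d\Gamma .$$ For a point $N=(x(s,t),y(s,t),z(s,t))\in\Gamma$ let $n$ be the outer normal to $\Gamma$ at $N$, and let $B_n^\alpha[v_1]_i$ and $B_n^\alpha[v_1]_e$ denote the limits of $B_n^\alpha[v_1(x,y,z)]$ as the point $M=(x,y,z)\notin\Gamma$ tends to $N$ along the normal at $N$ from inside and from outside respectively. Then $$B_n^\alpha[v_1]_i=\frac12\rho_1(s,t)+\iint_\Gamma\rho_1(\theta,\vartheta)K_1(\theta,\vartheta;s,t)\,d\Gamma,$$ $$B_n^\alpha[v_1]_e=-\frac12\rho_1(s,t)+\iint_\Gamma\rho_1(\theta,\vartheta)K_1(\theta,\vartheta;s,t)\,d\Gamma,$$ where $$K_1(\theta,\vartheta;s,t)=B_n^\alpha\left[q_1\left(\xi(\theta,\vartheta),\eta(\theta,\vartheta),\zeta(\theta,\vartheta);x(s,t),y(s,t),z(s,t)\right)\right].$$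
   Context: Domain. $X$ is a simply connected open region of the plane $x=0$ (the $yOz$-plane), $\Gamma$ is a Lyapunov surface lying in $x>0$ (it has a normal at every point; there is $d>0$ such that lines parallel to the normal at $N\in\Gamma$ meet the part of $\Gamma$ inside the ball of radius $d$ about $N$ at most once; the angle between the normals at two points at distance $\rho$ is at most $A\rho^{\lambda}$ with constants $A>0$, $0<\lambda\le1$), and $D$ is the domain bounded by $X$ and $\Gamma$; $\gamma$ is the common boundary curve of $X$ and $\Gamma$. $\Gamma$ is parametrized by $x=x(s,t)$, $y=y(s,t)$, $z=z(s,t)$, $(s,t)\in\overline\Phi$, $\Phi=(s_1,s_2)\times(t_1,t_2)$, and $\gamma$ by $y=y(s,t_0)$, $z=z(s,t_0)$, where $t_0\in[t_1,t_2]$ is fixed with $x(s,t_0)=0$ for all $s\in[s_1,s_2]$. It is assumed that: 1) $x(s,t),y(s,t),z(s,t)$ have continuous first partial derivatives on $\overline\Phi$ with $x_s^2+y_s^2+z_s^2\ne0$ and $x_t^2+y_t^2+z_t^2\ne0$; 2) as points of $\Gamma$ approach $\gamma$, $\Gamma$ forms a right angle with the plane $x=0$. The variable (integration) point of $\Gamma$ is $(\xi,\eta,\zeta)=(\xi(\theta,\vartheta),\eta(\theta,\vartheta),\zeta(\theta,\vartheta))$ in the same parametrization, $(\theta,\vartheta)\in\overline\Phi$; $d\Gamma$ is the surface area element at this point. "Inside"/"outside" and "outer normal" are with respect to $D$. Fundamental solution of $u_{xx}+u_{yy}+u_{zz}+\frac{2\alpha}{x}u_x=0$: with $F$ the (analytically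 continued) Gauss hypergeometric function, $$q_1(x,y,z;\xi,\eta,\zeta)=\frac1{2\pi}r^{-2\alpha-1}F\left(\alpha+\tfrac12,\alpha;2\alpha;1-\tfrac{r_1^2}{r^2}\right),$$ $r^2=(x-\xi)^2+(y-\eta)^2+(z-\zeta)^2$, $r_1^2=(x+\xi)^2+(y-\eta)^2+(z-\zeta)^2$ (symmetric in the two points). Conormal derivative (acting in $(x,y,z)$): $B_n^\alpha=x^{2\alpha}\left(\cos(n,x)\partial_x+\cos(n,y)\partial_y+\cos(n,z)\partial_z\right)$; in $K_1(\theta,\vartheta;s,t)$ it is evaluated at $(x(s,t),y(s,t),z(s,t))$ with $n$ the normal there. *)

theory Defs
  imports "HOL-Analysis.Analysis"
begin

text \<open>
  Points of space are vectors \<^term>\<open>P :: real^3\<close> with coordinates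
  \<^term>\<open>P $ 1\<close>, \<^term>\<open>P $ 2\<close>, \<^term>\<open>P $ 3\<close> for $x$, $y$, $z$;
  points of the parameter plane are pairs of reals.
\<close>

section \<open>The fundamental solution\<close>

text \<open>
  The Gauss hypergeometric function, analytically continued from the unit disc to the complex
  plane cut along $[1,\infty)$.  By the identity theorem the continuation is unique on the cut
  plane; the value on the cut is unspecified.
\<close>

definition hyp2F1 :: "complex \<Rightarrow> complex \<Rightarrow> complex \<Rightarrow> complex \<Rightarrow> complex" where
  "hyp2F1 a b c = (SOME F.
     F holomorphic_on (- {z. Im z = 0 \<and> 1 \<le> Re z}) \<and>
     (\<forall>z\<in>ball 0 1.
        (\<lambda>n. pochhammer a n * pochhammer b n / (pochhammer c n * fact n) * z ^ n) sums F z))"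

definition dist_sq :: "real^3 \<Rightarrow> real^3 \<Rightarrow> real" where
  "dist_sq P Q = (P $ 1 - Q $ 1)\<^sup>2 + (P $ 2 - Q $ 2)\<^sup>2 + (P $ 3 - Q $ 3)\<^sup>2"

definition refl_dist_sq :: "real^3 \<Rightarrow> real^3 \<Rightarrow> real" where
  "refl_dist_sq P Q = (P $ 1 + Q $ 1)\<^sup>2 + (P $ 2 - Q $ 2)\<^sup>2 + (P $ 3 - Q $ 3)\<^sup>2"

text \<open>
  For points with nonnegative first coordinate the argument of the hypergeometric function below
  is real and at most $0$, hence off the cut, and the value is real.
\<close>

definition q1 :: "real \<Rightarrow> real^3 \<Rightarrow> real^3 \<Rightarrow> real" where
  "q1 \<alpha> P Q = 1 / (2 * pi) * sqrt (dist_sq P Q) powr (- 2 * \<alpha> - 1) *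
     Re (hyp2F1 (of_real (\<alpha> + 1/2)) (of_real \<alpha>) (of_real (2 * \<alpha>))
           (of_real (1 - refl_dist_sq P Q / dist_sq P Q)))"

section \<open>Conormal derivative\<close>

definition partial_deriv :: "3 \<Rightarrow> (real^3 \<Rightarrow> real) \<Rightarrow> real^3 \<Rightarrow> real" where
  "partial_deriv k u M = deriv (\<lambda>h. u (M + h *\<^sub>R axis k 1)) 0"

text \<open>For a unit vector \<^term>\<open>n :: real^3\<close> the components are its direction cosines.\<close>

definition conormal :: "real \<Rightarrow> real^3 \<Rightarrow> (real^3 \<Rightarrow> real) \<Rightarrow> real^3 \<Rightarrow> real" where
  "conormal \<alpha> n u M = (M $ 1) powr (2 * \<alpha>) *
     (n $ 1 * partial_deriv 1 u M + n $ 2 * partial_deriv 2 u M + n $ 3 * partial_deriv 3 u M)"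

section \<open>Lyapunov surfaces\<close>

definition angle_between :: "real^3 \<Rightarrow> real^3 \<Rightarrow> real" where
  "angle_between u v = arccos ((u \<bullet> v) / (norm u * norm v))"

text \<open>
  \<^term>\<open>n\<close> is normal at \<^term>\<open>N\<close> if the plane through \<^term>\<open>N\<close> orthogonal to \<^term>\<open>n\<close> is
  tangent: the secants from \<^term>\<open>N\<close> become orthogonal to \<^term>\<open>n\<close> in the limit.
\<close>

definition unit_normal :: "(real^3) set \<Rightarrow> real^3 \<Rightarrow> real^3 \<Rightarrow> bool" where
  "unit_normal S N n \<longleftrightarrow> norm n = 1 \<and>
     ((\<lambda>Q. (n \<bullet> (Q - N)) / norm (Q - N)) \<longlongrightarrow> 0) (at N within S)"

definition outer_unit_normal :: "(real^3) set \<Rightarrow> (real^3) set \<Rightarrow> real^3 \<Rightarrow> real^3 \<Rightarrow> bool" where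
  "outer_unit_normal D S N n \<longleftrightarrow> unit_normal S N n \<and>
     (\<forall>\<^sub>F h in at_right 0. N - h *\<^sub>R n \<in> D) \<and>
     (\<forall>\<^sub>F h in at_right 0. N + h *\<^sub>R n \<notin> closure D)"

definition lyapunov_surface :: "(real^3) set \<Rightarrow> (real^3 \<Rightarrow> real^3) \<Rightarrow> bool" where
  "lyapunov_surface S \<nu> \<longleftrightarrow>
     (\<forall>N\<in>S. unit_normal S N (\<nu> N)) \<and>
     (\<exists>d>0. \<forall>N\<in>S. \<forall>P\<in>S \<inter> ball N d. \<forall>Q\<in>S \<inter> ball N d.
        (\<exists>c. Q - P = c *\<^sub>R \<nu> N) \<longrightarrow> P = Q) \<and>
     (\<exists>A>0. \<exists>\<mu>. 0 < \<mu> \<and> \<mu> \<le> 1 \<and>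
        (\<forall>N\<in>S. \<forall>N'\<in>S. angle_between (\<nu> N) (\<nu> N') \<le> A * dist N N' powr \<mu>))"

section \<open>Domains bounded by a plane region and a parametrized Lyapunov surface\<close>

definition area_density :: "(real \<times> real \<Rightarrow> real^3) \<Rightarrow> (real \<times> real \<Rightarrow> real^3) \<Rightarrow> real \<times> real \<Rightarrow> real" where
  "area_density rs rt p = norm (cross3 (rs p) (rt p))"

text \<open>
  \<^term>\<open>r\<close> is the parametrization and \<^term>\<open>rs\<close>, \<^term>\<open>rt\<close> are its partial derivatives (one-sided
  on the edges of the parameter rectangle); \<^term>\<open>\<nu>\<close> is the field of outer unit normals.
  The surface \<^term>\<open>\<Gamma>\<close> does not contain its boundary curve \<open>\<gamma>\<close>.

  The last assumption says that the parametrization covers the surface only once, up to a set of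
  zero area, so that integrals over the parameter rectangle against the area density are surface
  integrals.  Injectivity of \<^term>\<open>r\<close> on the open rectangle implies it.
\<close>

locale lyapunov_domain =
  fixes X \<Gamma> D :: "(real^3) set"
    and s1 s2 t1 t2 t0 :: real
    and r rs rt :: "real \<times> real \<Rightarrow> real^3"
    and \<nu> :: "real^3 \<Rightarrow> real^3"
  assumes rectangle: "s1 < s2" "t1 < t2"
    and t0_range: "t0 \<in> {t1..t2}"
    and deriv_s: "\<And>s t. s \<in> {s1..s2} \<Longrightarrow> t \<in> {t1..t2} \<Longrightarrow>
      ((\<lambda>s'. r (s', t)) has_vector_derivative rs (s, t)) (at s within {s1..s2})"
    and deriv_t: "\<And>s t. s \<in> {s1..s2} \<Longrightarrow> t \<in> {t1..t2} \<Longrightarrow>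
      ((\<lambda>t'. r (s, t')) has_vector_derivative rt (s, t)) (at t within {t1..t2})"
    and cont_rs: "continuous_on (cbox (s1, t1) (s2, t2)) rs"
    and cont_rt: "continuous_on (cbox (s1, t1) (s2, t2)) rt"
    and rs_nonzero: "\<And>p. p \<in> cbox (s1, t1) (s2, t2) \<Longrightarrow> rs p \<noteq> 0"
    and rt_nonzero: "\<And>p. p \<in> cbox (s1, t1) (s2, t2) \<Longrightarrow> rt p \<noteq> 0"
    and edge: "\<And>s. s \<in> {s1..s2} \<Longrightarrow> r (s, t0) $ 1 = 0"
    and surface: "closure \<Gamma> = r ` cbox (s1, t1) (s2, t2)"
    and surface_pos: "\<Gamma> \<subseteq> {P. P $ 1 > 0}"
    and surface_boundary: "closure \<Gamma> - \<Gamma> = (\<lambda>s. r (s, t0)) ` {s1..s2}"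
    and region_plane: "openin (top_of_set {P. P $ 1 = 0}) X" "X \<noteq> {}"
    and region_simply_connected: "simply_connected X"
    and region_boundary: "closure X - X = (\<lambda>s. r (s, t0)) ` {s1..s2}"
    and domain: "open D" "connected D" "bounded D" "D \<noteq> {}" "D \<subseteq> {P. P $ 1 > 0}"
    and domain_boundary: "frontier D = closure X \<union> closure \<Gamma>"
    and outer: "\<And>N. N \<in> \<Gamma> \<Longrightarrow> outer_unit_normal D \<Gamma> N (\<nu> N)"
    and lyapunov: "lyapunov_surface \<Gamma> \<nu>"
    and right_angle: "\<And>P. P \<in> closure \<Gamma> - \<Gamma> \<Longrightarrow>
      ((\<lambda>Q. angle_between (\<nu> Q) (axis 1 1)) \<longlongrightarrow> pi / 2) (at P within \<Gamma>)"
    and covers_once: "negligible {p \<in> box (s1, t1) (s2, t2). area_density rs rt p \<noteq> 0 \<and>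
      (\<exists>q \<in> box (s1, t1) (s2, t2). q \<noteq> p \<and> area_density rs rt q \<noteq> 0 \<and> r q = r p)}"

section \<open>The simple layer potential\<close>

definition surface_integral ::
  "(real \<times> real) set \<Rightarrow> (real \<times> real \<Rightarrow> real^3) \<Rightarrow> (real \<times> real \<Rightarrow> real^3) \<Rightarrow>
   (real \<times> real \<Rightarrow> real) \<Rightarrow> real" where
  "surface_integral \<Phi> rs rt f = (LINT p:\<Phi>|lebesgue. f p * area_density rs rt p)"

definition surface_integrable ::
  "(real \<times> real) set \<Rightarrow> (real \<times> real \<Rightarrow> real^3) \<Rightarrow> (real \<times> real \<Rightarrow> real^3) \<Rightarrow>
   (real \<times> real \<Rightarrow> real) \<Rightarrow> bool" where
  "surface_integrable \<Phi> rs rt f \<longleftrightarrow> set_integrable lebesgue \<Phi> (\<lambda>p. f p * area_density rs rt p)"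

definition v1 ::
  "real \<Rightarrow> (real \<times> real) set \<Rightarrow> (real \<times> real \<Rightarrow> real^3) \<Rightarrow> (real \<times> real \<Rightarrow> real^3) \<Rightarrow>
   (real \<times> real \<Rightarrow> real^3) \<Rightarrow> (real^3 \<Rightarrow> real) \<Rightarrow> real^3 \<Rightarrow> real" where
  "v1 \<alpha> \<Phi> r rs rt \<rho> M = surface_integral \<Phi> rs rt (\<lambda>p. \<rho> (r p) * q1 \<alpha> (r p) M)"

definition K1 ::
  "real \<Rightarrow> (real \<times> real \<Rightarrow> real^3) \<Rightarrow> (real^3 \<Rightarrow> real^3) \<Rightarrow> real \<times> real \<Rightarrow> real \<times> real \<Rightarrow> real" where
  "K1 \<alpha> r \<nu> p q = conormal \<alpha> (\<nu> (r q)) (\<lambda>M. q1 \<alpha> (r p) M) (r q)"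

end

theory Submission
  imports Defs "HOL-Complex_Analysis.Complex_Analysis"
begin

unbundle no Formal_Power_Series.fps_syntax

text \<open>
  The hypergeometric function in the kernel is elementary,
  $F(a+\frac12,a;2a;z)=(1-z)^{-1/2}\left(\frac{1+\sqrt{1-z}}2\right)^{1-2a}$, so with the distances
  $r$ and $r_1$ from the variable point and from its mirror image,
  $q_1=\frac{4^\alpha}{4\pi}\,\frac{(r+r_1)^{1-2\alpha}}{r\,r_1}$. Hence $B_n^\alpha[q_1]$ at $M$
  is $a\,\frac{n\cdot(P-M)}{r^3}+\frac br$ with $a$, $b$ continuous in $(P,M)$ and $a=\frac1{4\pi}$
  for $P=M=N$. When $M=N\mp hn$ the numerator is $n\cdot(P-N)\pm h$. The first part is dominated by
  $|P-N|^{\lambda-2}$ because of the Lyapunov condition and passes to the limit; the second part is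
  $\pm a$ times the Poisson kernel $h/(|P-N|^2+h^2)^{3/2}$ up to a factor tending to 1, and gives the
  jump $\pm\frac12\rho_1$. Besides the Lyapunov bound, all that is needed about the surface is that
  its measure has density 1 at $N$, that is, a ball of radius $u$ around $N$ has area $\sim\pi u^2$.
  Since the domain lies on one side of the surface, the orthogonal projection of the surface to the
  tangent plane covers a neighbourhood of $N$ and is injective there, so the density follows from
  the area formula for the projected parametrization.
\<close>

section \<open>The fundamental solution in closed form\<close>

text \<open>\<open>hyp2F1\<close> is a choice among the holomorphic functions with the Gauss series,
  so the closed form has to be derived from the series: the elementary function solves the
  hypergeometric equation, which determines its coefficients, and the identity theorem gives
  equality on the whole cut plane. The obstacle in the geometry is the weak regularity. The vectors
  \<open>rs\<close> and \<open>rt\<close> are nonzero but may be parallel, so the parametrization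
  need not be an immersion and the implicit function theorem yields no local graph. Its place is
  taken by a compact piece of the surface on which the projection to the tangent plane is injective
  and therefore has a continuous inverse; the height over the tangent plane is never differentiated,
  instead secant bounds at its points are chained. For the same reason the area formula admits
  points of zero Jacobian. The factor 2 pi of the Poisson part arises on the radius axis: there the
  quotient of the ball area by u^2, with limit pi, is integrated against a kernel of total mass 2
  that concentrates at 0. Multiplied by 1/(4 pi) it gives the 1/2.\<close>

definition hyp_closed :: "complex \<Rightarrow> complex \<Rightarrow> complex" where
  "hyp_closed a z = ((1 + csqrt (1 - z)) / 2) powr (1 - 2 * a) / csqrt (1 - z)"

abbreviation cut_plane :: "complex set" where
  "cut_plane \<equiv> - {z. Im z = 0 \<and> 1 \<le> Re z}"

text \<open>Off the cut, \<open>1 - z\<close> avoids the closed negative real axis, so its principal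
  root has positive real part. This one fact keeps the denominators below nonzero and the base of
  the complex power off its branch cut.\<close>

lemma cut_plane_sqrt:
  assumes "z \<in> cut_plane"
  shows "1 - z \<notin> \<real>\<^sub>\<le>\<^sub>0" "Re (csqrt (1 - z)) > 0" "csqrt (1 - z) \<noteq> 0" "1 + csqrt (1 - z) \<noteq> 0"
    "(1 + csqrt (1 - z)) / 2 \<notin> \<real>\<^sub>\<le>\<^sub>0"
proof -
  show 1: "1 - z \<notin> \<real>\<^sub>\<le>\<^sub>0"
    using assms by (auto simp: complex_nonpos_Reals_iff)
  show 2: "Re (csqrt (1 - z)) > 0"
    using 1 Re_csqrt[of "1 - z"] csqrt_principal[of "1 - z"]
    by (metis complex_nonpos_Reals_iff linorder_not_le power2_csqrt Re_power2 Im_power2 mult_zero_left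
        mult_zero_right zero_le_power2 diff_0 neg_le_0_iff_le power_zero_numeral)
  then show "csqrt (1 - z) \<noteq> 0" by (metis less_irrefl zero_complex.simps(1))
  have "Re (1 + csqrt (1 - z)) > 0" using 2 by (simp del: csqrt.simps)
  then show "1 + csqrt (1 - z) \<noteq> 0" by (metis less_irrefl zero_complex.simps(1))
  show "(1 + csqrt (1 - z)) / 2 \<notin> \<real>\<^sub>\<le>\<^sub>0"
    using 2 by (auto simp: complex_nonpos_Reals_iff simp del: csqrt.simps)
qed

lemma open_cut_plane: "open cut_plane"
proof -
  have "cut_plane = (\<lambda>z. 1 - z) -` (- \<real>\<^sub>\<le>\<^sub>0)"
    by (auto simp: complex_nonpos_Reals_iff)
  also have "open \<dots>"
    by (intro open_vimage continuous_intros) auto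
  finally show ?thesis .
qed

lemma connected_cut_plane: "connected cut_plane"
proof -
  have "starlike cut_plane"
    unfolding starlike_def
  proof (intro bexI[of _ 0] ballI subsetI)
    fix x z :: complex
    assume x: "x \<in> cut_plane" and "z \<in> closed_segment 0 x"
    then obtain u where u: "0 \<le> u" "u \<le> 1" "z = of_real u * x"
      by (auto simp: closed_segment_def scaleR_conv_of_real)
    show "z \<in> cut_plane"
    proof
      assume "z \<in> {z. Im z = 0 \<and> 1 \<le> Re z}"
      then have z: "u * Im x = 0" "1 \<le> u * Re x" using u by auto
      then have "Im x = 0" by auto
      moreover have "u * Re x \<le> Re x"
        using u z by (smt (verit) mult_left_le_one_le mult_nonneg_nonpos)
      ultimately show False using x z by auto
    qed
  qed auto
  then show ?thesis by (rule starlike_imp_connected)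
qed

lemma hyp_closed_holomorphic: "hyp_closed a holomorphic_on cut_plane"
proof -
  have "(\<lambda>z. ((1 + csqrt (1 - z)) / 2) powr (1 - 2 * a) / csqrt (1 - z)) holomorphic_on cut_plane"
    by (intro holomorphic_intros) ((rule cut_plane_sqrt, assumption) | simp only: zero_neq_numeral not_False_eq_True)+
  then show ?thesis by (simp add: hyp_closed_def[abs_def])
qed

text \<open>The logarithmic derivative of \<open>hyp_closed\<close> with respect to z, written in w
  = sqrt (1 - z), for which dw/dz = -1/(2w).\<close>

definition hyp_dlog :: "complex \<Rightarrow> complex \<Rightarrow> complex" where
  "hyp_dlog a w = 1 / (2 * w\<^sup>2) - (1 - 2 * a) / (2 * w * (1 + w))"

lemma hyp_closed_deriv:
  assumes "z \<in> cut_plane"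
  shows "(hyp_closed a has_field_derivative hyp_closed a z * hyp_dlog a (csqrt (1 - z))) (at z)"
proof -
  note * = cut_plane_sqrt[OF assms]
  define w where "w = csqrt (1 - z)"
  have w: "w \<noteq> 0" "1 + w \<noteq> 0" using * by (auto simp: w_def)
  have w2: "2 + w * 2 \<noteq> 0" "2 + 2 * w \<noteq> 0"
    using w(2) by (metis distrib_left_numeral mult.commute mult_eq_0_iff mult_numeral_1_right numeral_One zero_neq_numeral)+
  have "((1 + w) / 2) powr (1 - 2 * a - 1) = ((1 + w) / 2) powr (1 - 2 * a) / ((1 + w) / 2)"
    using w by (subst powr_diff) auto
  then have e: "((1 + w) / 2) powr (- (2 * a)) = ((1 + w) / 2) powr (1 - 2 * a) / ((1 + w) / 2)"
    by simp
  have "((\<lambda>z. ((1 + csqrt (1 - z)) / 2) powr (1 - 2 * a) / csqrt (1 - z)) has_field_derivative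
      (((1 - 2 * a) * ((1 + w) / 2) powr (1 - 2 * a - 1) * (- inverse (2 * w) / 2)) * w
        - ((1 + w) / 2) powr (1 - 2 * a) * (- inverse (2 * w))) / (w * w)) (at z)"
    unfolding w_def
    by (rule derivative_eq_intros refl | use * in \<open>simp; fail\<close>)+ (use * in \<open>simp add: field_simps\<close>)
  also have "(((1 - 2 * a) * ((1 + w) / 2) powr (1 - 2 * a - 1) * (- inverse (2 * w) / 2)) * w
        - ((1 + w) / 2) powr (1 - 2 * a) * (- inverse (2 * w))) / (w * w)
     = ((1 + w) / 2) powr (1 - 2 * a) / w * hyp_dlog a w"
    using w w2 by (simp add: hyp_dlog_def e divide_simps power2_eq_square) (simp add: algebra_simps)
  finally show ?thesis by (simp add: hyp_closed_def[abs_def] w_def)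
qed

lemma hyp_dlog_deriv:
  assumes "z \<in> cut_plane" "w = csqrt (1 - z)"
  shows "((\<lambda>z. hyp_dlog a (csqrt (1 - z))) has_field_derivative
     (- 1 / w ^ 3 + (1 - 2 * a) * (1 + 2 * w) / (2 * w\<^sup>2 * (1 + w)\<^sup>2)) * (- 1 / (2 * w))) (at z)"
proof -
  note * = cut_plane_sqrt[OF assms(1)]
  have w: "w \<noteq> 0" "1 + w \<noteq> 0" using * by (auto simp: assms)
  have eq: "(1 - 2 * a) * (4 * w + 2) / (4 * (w * ((1 + w) * (w * (1 + w))))) - w / w ^ 4
     = (1 - 2 * a) * (1 + 2 * w) / (2 * w\<^sup>2 * (1 + w)\<^sup>2) - 1 / w ^ 3"
  proof -
    have "(1 - 2 * a) * (4 * w + 2) / (4 * (w * ((1 + w) * (w * (1 + w)))))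
        = 2 * ((1 - 2 * a) * (1 + 2 * w)) / (2 * (2 * w\<^sup>2 * (1 + w)\<^sup>2))"
      by (rule arg_cong2[where f = divide]) (simp_all add: power2_eq_square algebra_simps)
    then show ?thesis
      using w by (simp only: mult_divide_mult_cancel_left_if) (simp add: power4_eq_xxxx power3_eq_cube)
  qed
  have "(hyp_dlog a has_field_derivative - 1 / w ^ 3 + (1 - 2 * a) * (1 + 2 * w) / (2 * w\<^sup>2 * (1 + w)\<^sup>2)) (at w)"
    unfolding hyp_dlog_def[abs_def]
    by (rule derivative_eq_intros refl | use w in \<open>simp; fail\<close>)+
       (simp, simp only: eq)
  moreover have "((\<lambda>z. csqrt (1 - z)) has_field_derivative - 1 / (2 * w)) (at z)"
  proof -
    have "((\<lambda>z. 1 - z) has_field_derivative -1) (at z)" by (auto intro!: derivative_eq_intros)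
    note DERIV_chain2[where f = csqrt and g = "\<lambda>z. 1 - z", OF has_field_derivative_csqrt[OF *(1)] this]
    moreover have "inverse (2 * csqrt (1 - z)) * - 1 = - 1 / (2 * w)"
      unfolding assms(2) by (simp only: divide_inverse mult.commute)
    ultimately show ?thesis by (simp only:)
  qed
  ultimately show ?thesis
    unfolding assms by (rule DERIV_chain2)
qed

text \<open>This is Gauss's equation z(1-z)f'' + (C - (A+B+1)z)f' - ABf = 0 for A = a + 1/2, B = a,
  C = 2a. Since f' is f times \<open>hyp_dlog\<close>, the factor f splits off from every term and a
  rational identity in w remains.\<close>

lemma hyp_closed_ode:
  assumes "z \<in> cut_plane"
  shows "z * (1 - z) * deriv (deriv (hyp_closed a)) z
     + (2 * a - (2 * a + 3/2) * z) * deriv (hyp_closed a) z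
     - a * (a + 1/2) * hyp_closed a z = 0"
proof -
  note * = cut_plane_sqrt[OF assms]
  define w where "w = csqrt (1 - z)"
  have w: "w \<noteq> 0" "1 + w \<noteq> 0" using * by (auto simp: w_def)
  have z: "z = 1 - w\<^sup>2" by (simp add: w_def)
  define P where "P = - 1 / w ^ 3 + (1 - 2 * a) * (1 + 2 * w) / (2 * w\<^sup>2 * (1 + w)\<^sup>2)"
  have d1: "deriv (hyp_closed a) y = hyp_closed a y * hyp_dlog a (csqrt (1 - y))" if "y \<in> cut_plane" for y
    using hyp_closed_deriv[OF that] by (rule DERIV_imp_deriv)
  have "((\<lambda>y. hyp_closed a y * hyp_dlog a (csqrt (1 - y))) has_field_derivative
     (hyp_closed a z * hyp_dlog a w) * hyp_dlog a w + (P * (- 1 / (2 * w))) * hyp_closed a z) (at z)"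
    using DERIV_mult[OF hyp_closed_deriv[OF assms, of a] hyp_dlog_deriv[OF assms w_def, of a]]
    by (simp add: w_def P_def)
  then have "((deriv (hyp_closed a)) has_field_derivative
     (hyp_closed a z * hyp_dlog a w) * hyp_dlog a w + (P * (- 1 / (2 * w))) * hyp_closed a z) (at z)"
    by (rule has_field_derivative_transform_within_open[OF _ open_cut_plane assms]) (simp add: d1)
  then have d2: "deriv (deriv (hyp_closed a)) z =
     hyp_closed a z * ((hyp_dlog a w)\<^sup>2 - P / (2 * w))"
    by (subst DERIV_imp_deriv) (auto simp: algebra_simps power2_eq_square)
  have "z * (1 - z) * ((hyp_dlog a w)\<^sup>2 - P / (2 * w))
     + (2 * a - (2 * a + 3/2) * z) * hyp_dlog a w - a * (a + 1/2) = 0"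
  proof -
    \<comment> \<open>The inverses of w and 1 + w become variables of their own, tied by i w = 1 and
      j (1 + w) = 1; this turns the rational identity into a polynomial one that
      \<open>algebra\<close> decides.\<close>
    define i j b where "i = inverse w" and "j = inverse (1 + w)" and "b = 1 - 2 * a"
    have i: "i * w = 1" and j: "j * (1 + w) = 1" using w by (auto simp: i_def j_def)
    have a: "a = (1 - b) / 2" by (simp add: b_def)
    have \<phi>: "hyp_dlog a w = (i\<^sup>2 - b * i * j) / 2"
      unfolding hyp_dlog_def i_def j_def b_def by (simp only: divide_inverse inverse_mult_distrib power_inverse) algebra
    have \<psi>: "P / (2 * w) = (- (i ^ 4) * 2 + b * (1 + 2 * w) * i ^ 3 * j\<^sup>2) / 4"
    proof -
      define k where "k = inverse (2::complex)"
      have "inverse (4::complex) = k\<^sup>2" "2 * k = 1" by (auto simp: k_def power2_eq_square)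
      then show ?thesis
        unfolding P_def i_def j_def b_def
        by (simp only: divide_inverse inverse_mult_distrib power_inverse[symmetric] k_def[symmetric]) algebra
    qed
    have "(1 - w\<^sup>2) * w\<^sup>2 * ((i\<^sup>2 - b * i * j)\<^sup>2 + 2 * i ^ 4 - b * (1 + 2 * w) * i ^ 3 * j\<^sup>2)
        + (2 * (1 - b) - (5 - 2 * b) * (1 - w\<^sup>2)) * (i\<^sup>2 - b * i * j) - (1 - b) * (2 - b) = 0"
      using i j by algebra
    moreover have "z * (1 - z) * ((hyp_dlog a w)\<^sup>2 - P / (2 * w))
       + (2 * a - (2 * a + 3/2) * z) * hyp_dlog a w - a * (a + 1/2)
     = ((1 - w\<^sup>2) * w\<^sup>2 * ((i\<^sup>2 - b * i * j)\<^sup>2 + 2 * i ^ 4 - b * (1 + 2 * w) * i ^ 3 * j\<^sup>2)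
        + (2 * (1 - b) - (5 - 2 * b) * (1 - w\<^sup>2)) * (i\<^sup>2 - b * i * j) - (1 - b) * (2 - b)) / 4"
      unfolding \<phi> \<psi> unfolding z a by (simp add: field_simps power2_eq_square)
    ultimately show ?thesis by simp
  qed
  then have "hyp_closed a z * (z * (1 - z) * ((hyp_dlog a w)\<^sup>2 - P / (2 * w))
     + (2 * a - (2 * a + 3/2) * z) * hyp_dlog a w - a * (a + 1/2)) = 0" by simp
  then show ?thesis
    unfolding d1[OF assms] d2 w_def[symmetric] by (simp add: algebra_simps)
qed

text \<open>Comparing coefficients in the differential equation gives a two-term recurrence, whose
  solution with initial value 1 is the quotient of Pochhammer symbols. The hypothesis keeps the
  factor 2a + n, by which the recurrence is divided, away from zero.\<close>

lemma hyp_closed_coeff: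
  assumes "\<And>n. 2 * a + of_nat n \<noteq> 0"
  shows "(deriv ^^ n) (hyp_closed a) 0 / fact n =
    pochhammer (a + 1/2) n * pochhammer a n / (pochhammer (2 * a) n * fact n)"
proof -
  define F where "F = fps_expansion (hyp_closed a) 0"
  have 0: "(0::complex) \<in> cut_plane" by auto
  have F: "hyp_closed a has_fps_expansion F"
    unfolding F_def
    by (rule has_fps_expansion_fps_expansion[OF open_cut_plane 0 hyp_closed_holomorphic])
  have D1: "deriv (hyp_closed a) has_fps_expansion fps_deriv F"
    using has_fps_expansion_deriv[OF F] .
  have D2: "deriv (deriv (hyp_closed a)) has_fps_expansion fps_deriv (fps_deriv F)"
    using has_fps_expansion_deriv[OF D1] .
  let ?L = "fps_X * (1 - fps_X) * fps_deriv (fps_deriv F)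
     + (fps_const (2 * a) - fps_const (2 * a + 3/2) * fps_X) * fps_deriv F - fps_const (a * (a + 1/2)) * F"
  have "(\<lambda>z. z * (1 - z) * deriv (deriv (hyp_closed a)) z
     + (2 * a - (2 * a + 3/2) * z) * deriv (hyp_closed a) z
     - a * (a + 1/2) * hyp_closed a z) has_fps_expansion ?L"
    by (intro fps_expansion_intros F D1 D2)
  moreover have "\<forall>\<^sub>F z in nhds 0. z \<in> cut_plane"
    using eventually_nhds_in_open[OF open_cut_plane 0] .
  then have "\<forall>\<^sub>F z in nhds 0. (z * (1 - z) * deriv (deriv (hyp_closed a)) z
     + (2 * a - (2 * a + 3/2) * z) * deriv (hyp_closed a) z
     - a * (a + 1/2) * hyp_closed a z) = 0"
    by eventually_elim (rule hyp_closed_ode)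
  ultimately have "(\<lambda>z::complex. 0::complex) has_fps_expansion ?L"
    by (simp only: has_fps_expansion_cong[OF _ refl])
  moreover have "(\<lambda>z::complex. 0::complex) has_fps_expansion 0" by simp
  ultimately have L: "?L = 0"
    by (rule fps_expansion_unique_complex)
  have rec: "of_nat (Suc n) * (2 * a + of_nat n) * fps_nth F (Suc n)
      = (a + 1/2 + of_nat n) * (a + of_nat n) * fps_nth F n" for n
  proof -
    have "fps_nth ?L n = 0" by (simp only: L fps_zero_nth)
    moreover have "?L = fps_X * fps_deriv (fps_deriv F) - fps_X * (fps_X * fps_deriv (fps_deriv F))
       + fps_const (2 * a) * fps_deriv F - fps_const (2 * a + 3/2) * (fps_X * fps_deriv F)
       - fps_const (a * (a + 1/2)) * F"
      by (simp add: algebra_simps)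
    ultimately have "fps_nth (fps_X * fps_deriv (fps_deriv F) - fps_X * (fps_X * fps_deriv (fps_deriv F))
       + fps_const (2 * a) * fps_deriv F - fps_const (2 * a + 3/2) * (fps_X * fps_deriv F)
       - fps_const (a * (a + 1/2)) * F) n = 0" by simp
    \<comment> \<open>The factors n and n(n - 1) keep the shifted formulas correct at n = 0 and n =
      1 too, where the shift runs out of the series.\<close>
    moreover have "fps_nth (fps_X * fps_deriv (fps_deriv F)) n = of_nat n * (of_nat n + 1) * fps_nth F (Suc n)"
      by (cases n) (auto simp: algebra_simps)
    moreover have "fps_nth (fps_X * (fps_X * fps_deriv (fps_deriv F))) n = of_nat n * (of_nat n - 1) * fps_nth F n"
      by (cases n; cases "n - 1") (auto simp: algebra_simps)
    moreover have "fps_nth (fps_X * fps_deriv F) n = of_nat n * fps_nth F n"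
      by (cases n) (auto simp: algebra_simps)
    ultimately have "of_nat n * (of_nat n + 1) * fps_nth F (Suc n) - of_nat n * (of_nat n - 1) * fps_nth F n
       + 2 * a * ((of_nat n + 1) * fps_nth F (Suc n)) - (2 * a + 3/2) * (of_nat n * fps_nth F n)
       - a * (a + 1/2) * fps_nth F n = 0"
      by (simp add: fps_deriv_nth add.commute del: fps_X_mult_nth)
    then show ?thesis by (simp add: algebra_simps)
  qed
  have "fps_nth F n = pochhammer (a + 1/2) n * pochhammer a n / (pochhammer (2 * a) n * fact n)" for n
  proof (induction n)
    case 0
    then show ?case by (simp add: F_def fps_expansion_def hyp_closed_def)
  next
    case (Suc n)
    have "pochhammer (2 * a) n \<noteq> 0"
      using assms by (auto simp: pochhammer_eq_0_iff) (metis add.commute add.left_inverse)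
    then show ?case
      using rec[of n] assms[of n] Suc
      by (simp add: pochhammer_Suc divide_simps del: of_nat_Suc) (simp add: algebra_simps)
  qed
  then show ?thesis by (simp add: F_def fps_expansion_def)
qed

text \<open>\<open>hyp_closed\<close> is itself a witness for the choice in \<open>hyp2F1\<close>,
  so the chosen function does have the defining properties. Both functions have the same sum in the
  unit disc, hence agree on the connected cut plane.\<close>

lemma hyp2F1_closed_form:
  assumes "\<And>n. 2 * a + of_nat n \<noteq> 0" "z \<in> cut_plane"
  shows "hyp2F1 (a + 1/2) a (2 * a) z = hyp_closed a z"
proof -
  let ?c = "\<lambda>n. pochhammer (a + 1/2) n * pochhammer a n / (pochhammer (2 * a) n * fact n)"
  let ?P = "\<lambda>F. F holomorphic_on cut_plane \<and> (\<forall>z\<in>ball 0 1. (\<lambda>n. ?c n * z ^ n) sums F z)"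
  have ball: "ball 0 1 \<subseteq> cut_plane"
  proof
    fix z :: complex assume "z \<in> ball 0 1"
    then have "Re z < 1" using complex_Re_le_cmod[of z] by simp
    then show "z \<in> cut_plane" by simp
  qed
  have P: "?P (hyp_closed a)"
  proof (intro conjI ballI)
    show "hyp_closed a holomorphic_on cut_plane" by (rule hyp_closed_holomorphic)
    then have "hyp_closed a holomorphic_on ball 0 1"
      using ball by (rule holomorphic_on_subset)
    fix z :: complex assume "z \<in> ball 0 1"
    from holomorphic_power_series[OF \<open>hyp_closed a holomorphic_on ball 0 1\<close> this]
    show "(\<lambda>n. ?c n * z ^ n) sums hyp_closed a z"
      by (simp add: hyp_closed_coeff[OF assms(1)])
  qed
  have "?P (hyp2F1 (a + 1/2) a (2 * a))"
    unfolding hyp2F1_def by (rule someI[of ?P, OF P])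
  then have Q: "hyp2F1 (a + 1/2) a (2 * a) holomorphic_on cut_plane"
     "\<And>z. z \<in> ball 0 1 \<Longrightarrow> (\<lambda>n. ?c n * z ^ n) sums hyp2F1 (a + 1/2) a (2 * a) z" by auto
  show ?thesis
  proof (rule analytic_continuation_open[where f = "hyp2F1 (a + 1/2) a (2 * a)" and g = "hyp_closed a" and s = "ball 0 1" and s' = cut_plane])
    show "hyp2F1 (a + 1/2) a (2 * a) z = hyp_closed a z" if "z \<in> ball 0 1" for z
      using sums_unique2[OF Q(2)[OF that]] P that by auto
  qed (use ball Q P open_cut_plane connected_cut_plane assms in auto)
qed

section \<open>The kernel as a function of the two distances\<close>

definition reflect :: "real^3 \<Rightarrow> real^3" where
  "reflect P = vector [- (P $ 1), P $ 2, P $ 3]"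

lemma reflect_nth [simp]: "reflect P $ 1 = - (P $ 1)" "reflect P $ 2 = P $ 2" "reflect P $ 3 = P $ 3"
  by (simp_all add: reflect_def)

lemma dist_sq_eq: "dist_sq P Q = (dist P Q)\<^sup>2"
  unfolding dist_sq_def dist_norm power2_norm_eq_inner by (simp add: inner_vec_def sum_3 power2_eq_square)

lemma refl_dist_sq_eq: "refl_dist_sq P Q = (dist (reflect P) Q)\<^sup>2"
  unfolding refl_dist_sq_def dist_norm power2_norm_eq_inner
  by (simp add: inner_vec_def sum_3 power2_eq_square algebra_simps)

definition q1_factor :: "real \<Rightarrow> real" where
  "q1_factor \<alpha> = 2 powr (2 * \<alpha>) / (4 * pi)"

definition q1_closed :: "real \<Rightarrow> real^3 \<Rightarrow> real^3 \<Rightarrow> real" where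
  "q1_closed \<alpha> P M = q1_factor \<alpha> * (dist P M + dist (reflect P) M) powr (1 - 2 * \<alpha>) / (dist P M * dist (reflect P) M)"

text \<open>With z = 1 - r'^2/r^2 the square root of 1 - z is r'/r, so the complex power reduces to
  a real one with positive base.\<close>

lemma q1_eq_q1_closed:
  assumes "0 < \<alpha>" "P $ 1 \<ge> 0" "M $ 1 > 0" "P \<noteq> M"
  shows "q1 \<alpha> P M = q1_closed \<alpha> P M"
proof -
  define r r' where "r = dist P M" and "r' = dist (reflect P) M"
  have r: "r > 0" using assms by (simp add: r_def)
  \<comment> \<open>The difference of the squares is 4 times \<open>P $ 1\<close> times
    \<open>M $ 1\<close>, which is nonnegative. Hence r' is positive along with r, and z <
    1.\<close>
  have "r\<^sup>2 \<le> r'\<^sup>2"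
    unfolding r_def r'_def dist_sq_eq[symmetric] refl_dist_sq_eq[symmetric] dist_sq_def refl_dist_sq_def
    using assms by (simp add: power2_eq_square algebra_simps)
  then have r': "r \<le> r'"
    by (metis power2_le_imp_le r'_def zero_le_dist)
  define z :: real where "z = 1 - r'\<^sup>2 / r\<^sup>2"
  have 1: "1 - z = (r' / r)\<^sup>2" by (simp add: z_def power_divide)
  have z1: "1 - complex_of_real z = complex_of_real ((r' / r)\<^sup>2)"
    unfolding 1[symmetric] by simp
  have s: "csqrt (1 - complex_of_real z) = complex_of_real (r' / r)"
    unfolding z1 using r r' by (subst csqrt_of_real_nonneg) (auto simp: real_sqrt_divide)
  have "z < 1" using r r' by (simp add: z_def)
  have "hyp2F1 (of_real (\<alpha> + 1/2)) (of_real \<alpha>) (of_real (2 * \<alpha>)) (of_real z)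
     = hyp_closed (of_real \<alpha>) (of_real z)"
  proof -
    have "2 * complex_of_real \<alpha> + of_nat n \<noteq> 0" for n
    proof -
      have "2 * \<alpha> + real n > 0" using assms by simp
      then have "complex_of_real (2 * \<alpha> + real n) \<noteq> 0" by (metis less_irrefl of_real_eq_0_iff)
      then show ?thesis by simp
    qed
    from hyp2F1_closed_form[OF this, of "of_real z"] \<open>z < 1\<close> show ?thesis by simp
  qed
  also have "\<dots> = complex_of_real (((1 + r' / r) / 2) powr (1 - 2 * \<alpha>)) / complex_of_real (r' / r)"
  proof -
    have "(1 + complex_of_real (r' / r)) / 2 = complex_of_real ((1 + r' / r) / 2)" by simp
    moreover have "complex_of_real ((1 + r' / r) / 2) powr (1 - 2 * complex_of_real \<alpha>)
       = complex_of_real (((1 + r' / r) / 2) powr (1 - 2 * \<alpha>))"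
      using r r' powr_of_real[of "(1 + r' / r) / 2" "1 - 2 * \<alpha>"] by simp
    ultimately show ?thesis unfolding hyp_closed_def s by simp
  qed
  finally have "Re (hyp2F1 (of_real (\<alpha> + 1/2)) (of_real \<alpha>) (of_real (2 * \<alpha>)) (of_real z))
     = ((1 + r' / r) / 2) powr (1 - 2 * \<alpha>) / (r' / r)"
    by (metis Re_complex_of_real of_real_divide)
  then have "q1 \<alpha> P M = 1 / (2 * pi) * r powr (- 2 * \<alpha> - 1) * (((1 + r' / r) / 2) powr (1 - 2 * \<alpha>) / (r' / r))"
    using r unfolding q1_def dist_sq_eq refl_dist_sq_eq r_def[symmetric] r'_def[symmetric] z_def by simp
  also have "(1 + r' / r) / 2 = (r + r') / (2 * r)" using r by (simp add: field_simps)
  also have "((r + r') / (2 * r)) powr (1 - 2 * \<alpha>) = (r + r') powr (1 - 2 * \<alpha>) / (2 powr (1 - 2 * \<alpha>) * r powr (1 - 2 * \<alpha>))"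
    using r r' by (simp add: powr_divide powr_mult)
  also have "r powr (1 - 2 * \<alpha>) = r powr (- 2 * \<alpha> - 1) * r\<^sup>2"
    using r powr_add[of r "- 2 * \<alpha> - 1" 2] by simp
  also have "2 powr (1 - 2 * \<alpha>) = 2 / 2 powr (2 * \<alpha>)" by (simp add: powr_diff)
  finally show ?thesis
    unfolding q1_closed_def r_def[symmetric] r'_def[symmetric] q1_factor_def
    using r r' by (simp add: field_simps power2_eq_square)
qed

section \<open>Jump relation at a point of density\<close>

lemma nn_integral_indicator_has_integral:
  fixes f :: "'a::euclidean_space \<Rightarrow> real"
  assumes "(f has_integral I) \<Omega>" "\<And>x. x \<in> \<Omega> \<Longrightarrow> 0 \<le> f x"
  shows "(\<integral>\<^sup>+x. ennreal (f x) * indicator \<Omega> x \<partial>lborel) = ennreal I"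
proof -
  have "(\<integral>\<^sup>+x. ennreal (f x) * indicator \<Omega> x \<partial>lborel) = (\<integral>\<^sup>+x. ennreal (indicator \<Omega> x * f x) \<partial>lborel)"
    by (intro nn_integral_cong) (auto simp: indicator_def)
  also have "\<dots> = ennreal I" by (rule nn_integral_has_integral_lebesgue) (use assms in auto)
  finally show ?thesis .
qed

text \<open>Tonelli's theorem, applied to a radial function given as the tail integral of \<psi>
  beyond the radius. It reduces the powers of the distance and the Poisson kernel to the growth of
  ball measures.\<close>

lemma nn_integral_layer_cake:
  fixes \<sigma> :: "'a::euclidean_space measure"
  assumes "finite_measure \<sigma>" and sets: "sets \<sigma> = sets borel"
    and [measurable]: "\<psi> \<in> borel_measurable borel"
  shows "(\<integral>\<^sup>+P. (\<integral>\<^sup>+u. \<psi> u * indicator {dist N P..} u \<partial>lborel) \<partial>\<sigma>)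
     = (\<integral>\<^sup>+u. \<psi> u * emeasure \<sigma> (cball N u) \<partial>lborel)"
proof -
  interpret finite_measure \<sigma> by fact
  interpret pair_sigma_finite \<sigma> lborel ..
  note sets[measurable_cong]
  have [measurable]: "Measurable.pred (\<sigma> \<Otimes>\<^sub>M (borel::real measure)) (\<lambda>x. dist N (fst x) \<le> snd x)"
    by measurable
  have meas: "case_prod (\<lambda>P u. \<psi> u * indicator {dist N P..} u) \<in> borel_measurable (\<sigma> \<Otimes>\<^sub>M lborel)"
  proof -
    have "(\<lambda>(P, u). \<psi> u * indicator {dist N P..} u) = (\<lambda>(P, u). \<psi> u * (if dist N P \<le> u then 1 else 0))"
      by (auto simp: indicator_def fun_eq_iff)
    then show ?thesis by simp
  qed
  have "(\<integral>\<^sup>+P. (\<integral>\<^sup>+u. \<psi> u * indicator {dist N P..} u \<partial>lborel) \<partial>\<sigma>)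
      = (\<integral>\<^sup>+u. (\<integral>\<^sup>+P. \<psi> u * indicator {dist N P..} u \<partial>\<sigma>) \<partial>lborel)"
    by (rule Fubini'[OF meas, symmetric])
  also have "\<dots> = (\<integral>\<^sup>+u. \<psi> u * emeasure \<sigma> (cball N u) \<partial>lborel)"
  proof (rule nn_integral_cong)
    fix u :: real
    have "(\<integral>\<^sup>+P. \<psi> u * indicator {dist N P..} u \<partial>\<sigma>) = (\<integral>\<^sup>+P. \<psi> u * indicator (cball N u) P \<partial>\<sigma>)"
      by (intro nn_integral_cong) (auto simp: indicator_def)
    then show "(\<integral>\<^sup>+P. \<psi> u * indicator {dist N P..} u \<partial>\<sigma>) = \<psi> u * emeasure \<sigma> (cball N u)"
      by (simp add: nn_integral_cmult_indicator sets)
  qed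
  finally show ?thesis .
qed

lemma integrable_continuous_on_compact:
  fixes g :: "'a::euclidean_space \<Rightarrow> real"
  assumes "finite_measure \<sigma>" "sets \<sigma> = sets borel" "compact S" "AE P in \<sigma>. P \<in> S"
    "continuous_on S g" "g \<in> borel_measurable borel"
  shows "integrable \<sigma> g"
proof -
  interpret finite_measure \<sigma> by fact
  have "bounded (g ` S)" using assms by (intro compact_imp_bounded compact_continuous_image)
  then obtain B where B: "\<And>x. x \<in> S \<Longrightarrow> norm (g x) \<le> B" by (auto simp: bounded_iff)
  have "g \<in> borel_measurable \<sigma>" using assms(2,6) by (simp cong: measurable_cong_sets)
  moreover have "AE x in \<sigma>. norm (g x) \<le> B" using assms(4) by eventually_elim (rule B)
  ultimately show ?thesis by (intro integrable_const_bound[of _ B])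
qed

text \<open>On the compact product of parameters and points \<open>f'\<close> is uniformly
  continuous, so by the mean value theorem the difference quotients converge uniformly in P, and the
  measure is finite.\<close>

lemma has_derivative_integral_compact:
  fixes \<sigma> :: "'a::euclidean_space measure" and f f' :: "real \<Rightarrow> 'a \<Rightarrow> real"
  assumes "finite_measure \<sigma>" and sets: "sets \<sigma> = sets borel"
    and S: "compact S" "AE P in \<sigma>. P \<in> S"
    and "d > 0"
    and meas: "\<And>t. \<bar>t\<bar> \<le> d \<Longrightarrow> f t \<in> borel_measurable borel" "f' 0 \<in> borel_measurable borel"
    and cont: "\<And>t. \<bar>t\<bar> \<le> d \<Longrightarrow> continuous_on S (f t)"
      "continuous_on ({-d..d} \<times> S) (\<lambda>(t, P). f' t P)"
    and deriv: "\<And>t P. \<bar>t\<bar> \<le> d \<Longrightarrow> P \<in> S \<Longrightarrow> ((\<lambda>t. f t P) has_real_derivative f' t P) (at t)"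
  shows "((\<lambda>t. \<integral>P. f t P \<partial>\<sigma>) has_real_derivative (\<integral>P. f' 0 P \<partial>\<sigma>)) (at 0)"
proof -
  interpret finite_measure \<sigma> by fact
  note sets[measurable_cong]
  note int = integrable_continuous_on_compact[OF finite_measure_axioms sets S]
  have if': "integrable \<sigma> (f' 0)"
  proof (rule int)
    have "continuous_on S (\<lambda>P. (\<lambda>(t, P). f' t P) (0, P))"
      using \<open>d > 0\<close> by (intro continuous_on_compose2[OF cont(2)] continuous_intros) auto
    then show "continuous_on S (f' 0)" by simp
  qed (rule meas)
  define M where "M = measure \<sigma> (space \<sigma>)"
  have M: "M \<ge> 0" by (simp add: M_def)
  show ?thesis
    unfolding has_field_derivative_iff
  proof (rule tendstoI)
    fix e :: real assume "e > 0"
    \<comment> \<open>The summand 1 covers a measure of total mass 0.\<close>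
    define e' where "e' = e / (M + 1)"
    have e': "e' > 0" using \<open>e > 0\<close> M by (simp add: e'_def)
    have "uniformly_continuous_on ({-d..d} \<times> S) (\<lambda>(t, P). f' t P)"
      by (intro compact_uniformly_continuous cont(2) compact_Times S) auto
    then obtain \<delta> where \<delta>: "\<delta> > 0" "\<And>x y. x \<in> {-d..d} \<times> S \<Longrightarrow> y \<in> {-d..d} \<times> S \<Longrightarrow> dist y x < \<delta> \<Longrightarrow>
        dist (case_prod f' y) (case_prod f' x) < e'"
      using e' unfolding uniformly_continuous_on_def by metis
    have "\<forall>\<^sub>F h in at 0. \<bar>h\<bar> < min d \<delta> \<and> h \<noteq> (0::real)"
      using \<open>d > 0\<close> \<delta>(1) by (auto simp: eventually_at dist_real_def intro!: exI[of _ "min d \<delta>"])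
    then show "\<forall>\<^sub>F h in at 0. dist (((\<integral>P. f h P \<partial>\<sigma>) - (\<integral>P. f 0 P \<partial>\<sigma>)) / (h - 0)) (\<integral>P. f' 0 P \<partial>\<sigma>) < e"
    proof eventually_elim
      case (elim h)
      have q: "\<bar>(f h P - f 0 P) / h - f' 0 P\<bar> \<le> e'" if "P \<in> S" for P
      proof -
        obtain \<xi> where \<xi>: "\<bar>\<xi>\<bar> \<le> \<bar>h\<bar>" "f h P - f 0 P = h * f' \<xi> P"
        proof (cases "h > 0")
          case True
          have "\<exists>z>0. z < h \<and> f h P - f 0 P = (h - 0) * f' z P"
            using True elim \<open>P \<in> S\<close> by (intro MVT2 deriv) auto
          then obtain z where "0 < z" "z < h" "f h P - f 0 P = h * f' z P" by auto
          then show thesis by (intro that[of z]) auto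
        next
          case False
          then have "h < 0" using elim by auto
          have "\<exists>z>h. z < 0 \<and> f 0 P - f h P = (0 - h) * f' z P"
            using \<open>h < 0\<close> elim \<open>P \<in> S\<close> by (intro MVT2 deriv) auto
          then obtain z where "h < z" "z < 0" "f 0 P - f h P = - h * f' z P" by auto
          then show thesis by (intro that[of z]) auto
        qed
        have "dist (case_prod f' (\<xi>, P)) (case_prod f' (0, P)) < e'"
          using \<xi>(1) elim that \<open>d > 0\<close> by (intro \<delta>(2)) (auto simp: dist_Pair_Pair dist_real_def)
        moreover have "(f h P - f 0 P) / h = f' \<xi> P" using \<xi> elim by simp
        ultimately show ?thesis by (simp add: dist_real_def)
      qed
      have i: "integrable \<sigma> (f h)" "integrable \<sigma> (f 0)"
        using elim \<open>d > 0\<close> by (auto intro!: int cont meas)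
      have "((\<integral>P. f h P \<partial>\<sigma>) - (\<integral>P. f 0 P \<partial>\<sigma>)) / (h - 0) - (\<integral>P. f' 0 P \<partial>\<sigma>)
         = (\<integral>P. (f h P - f 0 P) / h - f' 0 P \<partial>\<sigma>)"
        using i if' by simp
      also have "\<bar>\<dots>\<bar> \<le> (\<integral>P. \<bar>(f h P - f 0 P) / h - f' 0 P\<bar> \<partial>\<sigma>)"
        by (rule integral_abs_bound)
      also have "\<dots> \<le> (\<integral>P. e' \<partial>\<sigma>)"
        using i if' S(2) q by (intro integral_mono_AE) auto
      also have "\<dots> = M * e'" by (simp add: M_def)
      also have "\<dots> < e" using M \<open>e > 0\<close> by (simp add: e'_def field_simps)
      finally show ?case by (simp add: dist_real_def)
    qed
  qed
qed

section \<open>Integrals of the Poisson kernel\<close>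

text \<open>The first derivative is minus the derivative of the Poisson kernel in the distance u,
  that is, the density of its layer-cake representation. The second carries an extra factor u^2,
  which pairs with the quotient of a ball measure by u^2. Both primitives are normalized to vanish
  at infinity.\<close>

lemma sqrt_pow_deriv:
  assumes "h > (0::real)"
  shows "((\<lambda>u. - h / sqrt (u\<^sup>2 + h\<^sup>2) ^ 3) has_real_derivative 3 * h * u / sqrt (u\<^sup>2 + h\<^sup>2) ^ 5) (at u)"
    "((\<lambda>u. - 3 * h / sqrt (u\<^sup>2 + h\<^sup>2) + h ^ 3 / sqrt (u\<^sup>2 + h\<^sup>2) ^ 3) has_real_derivative 3 * h * u ^ 3 / sqrt (u\<^sup>2 + h\<^sup>2) ^ 5) (at u)"
proof -
  define s where "s = sqrt (u\<^sup>2 + h\<^sup>2)"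
  have p: "u\<^sup>2 + h\<^sup>2 > 0" using assms by (simp add: add_nonneg_pos)
  have s: "s > 0" "s\<^sup>2 = u\<^sup>2 + h\<^sup>2" using p by (auto simp: s_def)
  have ds: "((\<lambda>u. sqrt (u\<^sup>2 + h\<^sup>2)) has_real_derivative u / s) (at u)"
    using p by (auto intro!: derivative_eq_intros simp: s_def field_simps)
  have i1: "((\<lambda>u. inverse (sqrt (u\<^sup>2 + h\<^sup>2))) has_real_derivative - (u / s ^ 3)) (at u)"
  proof -
    have "- (inverse s * (u / s) * inverse s) = - (u / s ^ 3)"
      using s by (simp add: field_simps power3_eq_cube)
    with DERIV_inverse'[OF ds] s show ?thesis by (simp only: s_def[symmetric] less_imp_neq)
  qed
  have i3: "((\<lambda>u. inverse (sqrt (u\<^sup>2 + h\<^sup>2)) ^ 3) has_real_derivative - (3 * u / s ^ 5)) (at u)"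
    using DERIV_power[OF i1, of 3] s by (simp add: s_def[symmetric] field_simps power2_eq_square eval_nat_numeral)
  show "((\<lambda>u. - h / sqrt (u\<^sup>2 + h\<^sup>2) ^ 3) has_real_derivative 3 * h * u / sqrt (u\<^sup>2 + h\<^sup>2) ^ 5) (at u)"
    using DERIV_cmult[OF i3, of "-h"] by (simp add: s_def[symmetric] divide_inverse power_inverse mult_ac)
  have "- 3 * h * - (u / s ^ 3) + h ^ 3 * - (3 * u / s ^ 5) = 3 * h * u * (s\<^sup>2 - h\<^sup>2) / s ^ 5"
    using s(1) by (simp add: field_simps eval_nat_numeral)
  also have "\<dots> = 3 * h * u ^ 3 / s ^ 5" unfolding s(2) by (simp add: eval_nat_numeral)
  finally show "((\<lambda>u. - 3 * h / sqrt (u\<^sup>2 + h\<^sup>2) + h ^ 3 / sqrt (u\<^sup>2 + h\<^sup>2) ^ 3) has_real_derivative 3 * h * u ^ 3 / sqrt (u\<^sup>2 + h\<^sup>2) ^ 5) (at u)"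
    using DERIV_add[OF DERIV_cmult[OF i1, of "- 3 * h"] DERIV_cmult[OF i3, of "h ^ 3"]]
    by (simp add: s_def[symmetric] divide_inverse power_inverse mult_ac)
qed

lemma sqrt_pow_limits:
  "((\<lambda>u. - h / sqrt (u\<^sup>2 + h\<^sup>2) ^ 3) \<longlongrightarrow> 0) at_top"
  "((\<lambda>u. - 3 * h / sqrt (u\<^sup>2 + h\<^sup>2) + h ^ 3 / sqrt (u\<^sup>2 + h\<^sup>2) ^ 3) \<longlongrightarrow> 0) at_top"
proof -
  have "filterlim (\<lambda>u. sqrt (u\<^sup>2 + h\<^sup>2)) at_top at_top"
  proof (rule filterlim_at_top_mono)
    show "filterlim (\<lambda>u::real. u) at_top at_top" by (rule filterlim_ident)
    show "\<forall>\<^sub>F u in at_top. u \<le> sqrt (u\<^sup>2 + h\<^sup>2)"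
      by (intro always_eventually allI real_le_rsqrt) simp
  qed
  then have i: "((\<lambda>u. inverse (sqrt (u\<^sup>2 + h\<^sup>2))) \<longlongrightarrow> 0) at_top"
    by (rule tendsto_inverse_0_at_top)
  show "((\<lambda>u. - h / sqrt (u\<^sup>2 + h\<^sup>2) ^ 3) \<longlongrightarrow> 0) at_top"
    using tendsto_mult[OF tendsto_const[of "-h"] tendsto_power[OF i, of 3]]
    by (simp add: divide_inverse power_inverse)
  show "((\<lambda>u. - 3 * h / sqrt (u\<^sup>2 + h\<^sup>2) + h ^ 3 / sqrt (u\<^sup>2 + h\<^sup>2) ^ 3) \<longlongrightarrow> 0) at_top"
    using tendsto_add[OF tendsto_mult[OF tendsto_const[of "-3 * h"] i] tendsto_mult[OF tendsto_const[of "h ^ 3"] tendsto_power[OF i, of 3]]]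
    by (simp add: divide_inverse power_inverse)
qed

text \<open>The Poisson kernel of a half-space of dimension 3, without its normalization $1/(2\pi)$;
  \<^term>\<open>d\<close> is the distance to the foot point.\<close>

definition poisson_kernel :: "real \<Rightarrow> real \<Rightarrow> real" where
  "poisson_kernel h d = h / sqrt (d\<^sup>2 + h\<^sup>2) ^ 3"

lemma poisson_kernel_nonneg: "h \<ge> 0 \<Longrightarrow> poisson_kernel h d \<ge> 0" by (simp add: poisson_kernel_def)

lemma poisson_kernel_le:
  assumes "h \<ge> 0" "0 < \<delta>" "\<delta> \<le> d" shows "poisson_kernel h d \<le> h / \<delta> ^ 3"
proof -
  have "\<delta> \<le> sqrt (d\<^sup>2 + h\<^sup>2)" using assms by (intro real_le_rsqrt) (simp add: add_increasing2 power_mono)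
  then show ?thesis unfolding poisson_kernel_def using assms by (intro divide_left_mono power_mono mult_pos_pos zero_less_power) (auto simp: add_pos_nonneg)
qed

lemma poisson_kernel_le_const:
  assumes "h > 0" shows "poisson_kernel h d \<le> h / h ^ 3"
proof -
  have "h \<le> sqrt (d\<^sup>2 + h\<^sup>2)" using assms by (intro real_le_rsqrt) simp
  then show ?thesis unfolding poisson_kernel_def using assms by (intro divide_left_mono power_mono) (auto simp: add_nonneg_pos)
qed

lemma poisson_kernel_nn_integral:
  assumes "h > 0" "d \<ge> 0"
  shows "(\<integral>\<^sup>+u. ennreal (3 * h * u / sqrt (u\<^sup>2 + h\<^sup>2) ^ 5) * indicator {d..} u \<partial>lborel) = ennreal (poisson_kernel h d)"
proof -
  have "(\<integral>\<^sup>+u. ennreal (3 * h * u / sqrt (u\<^sup>2 + h\<^sup>2) ^ 5) * indicator {d..} u \<partial>lborel) = ennreal (0 - (- h / sqrt (d\<^sup>2 + h\<^sup>2) ^ 3))"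
    using assms by (intro nn_integral_FTC_atLeast sqrt_pow_deriv sqrt_pow_limits) auto
  then show ?thesis by (simp add: poisson_kernel_def)
qed

text \<open>For d = 0 the value is 3 - 1 = 2, the total mass behind the constant 2 pi; for d > 0 it
  is at most 3h/d and vanishes with h.\<close>

lemma poisson_kernel_moment:
  assumes "h > 0" "d \<ge> 0"
  shows "has_bochner_integral lborel (\<lambda>u. 3 * h * u ^ 3 / sqrt (u\<^sup>2 + h\<^sup>2) ^ 5 * indicator {d..} u)
     (3 * h / sqrt (d\<^sup>2 + h\<^sup>2) - h ^ 3 / sqrt (d\<^sup>2 + h\<^sup>2) ^ 3)"
proof -
  have "(\<integral>\<^sup>+u. ennreal (3 * h * u ^ 3 / sqrt (u\<^sup>2 + h\<^sup>2) ^ 5) * indicator {d..} u \<partial>lborel)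
     = ennreal (0 - (- 3 * h / sqrt (d\<^sup>2 + h\<^sup>2) + h ^ 3 / sqrt (d\<^sup>2 + h\<^sup>2) ^ 3))"
    using assms by (intro nn_integral_FTC_atLeast sqrt_pow_deriv sqrt_pow_limits) auto
  also have "(\<integral>\<^sup>+u. ennreal (3 * h * u ^ 3 / sqrt (u\<^sup>2 + h\<^sup>2) ^ 5) * indicator {d..} u \<partial>lborel)
     = (\<integral>\<^sup>+u. ennreal (3 * h * u ^ 3 / sqrt (u\<^sup>2 + h\<^sup>2) ^ 5 * indicator {d..} u) \<partial>lborel)"
    using assms by (intro nn_integral_cong) (auto simp: indicator_def)
  finally have eq: "(\<integral>\<^sup>+u. ennreal (3 * h * u ^ 3 / sqrt (u\<^sup>2 + h\<^sup>2) ^ 5 * indicator {d..} u) \<partial>lborel)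
     = ennreal (3 * h / sqrt (d\<^sup>2 + h\<^sup>2) - h ^ 3 / sqrt (d\<^sup>2 + h\<^sup>2) ^ 3)" by simp
  \<comment> \<open>The value has to be shown nonnegative, because \<open>ennreal\<close> maps
    negative reals to 0 and the equation above would not determine it otherwise.\<close>
  define s where "s = sqrt (d\<^sup>2 + h\<^sup>2)"
  have s: "h \<le> s" "s > 0" unfolding s_def using assms by (auto intro!: real_le_rsqrt simp: add_nonneg_pos)
  have "h ^ 3 / s ^ 3 \<le> h / s"
  proof -
    have "(h / s) ^ 3 \<le> (h / s) ^ 1" using s assms by (intro power_decreasing) auto
    then show ?thesis by (simp add: power_divide)
  qed
  moreover have "h / s \<le> 3 * h / s" using s assms by (intro divide_right_mono) auto
  ultimately have nn: "0 \<le> 3 * h / s - h ^ 3 / s ^ 3" by linarith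
  show ?thesis
    using assms nn eq unfolding s_def[symmetric]
    by (intro has_bochner_integral_nn_integral) (auto simp: indicator_def)
qed

section \<open>Finite measures with planar density at a point\<close>

text \<open>The part of the surface geometry that concerns area: balls around N behave like plane
  discs. Stated for an arbitrary finite Borel measure, it frees the kernel estimates from the
  parametrization.\<close>

locale density_point = finite_measure \<sigma> for \<sigma> :: "'a::euclidean_space measure" +
  fixes N :: 'a
  assumes sets: "sets \<sigma> = sets borel"
    and density: "((\<lambda>u. measure \<sigma> (cball N u) / u\<^sup>2) \<longlongrightarrow> pi) (at_right 0)"
begin

declare sets[measurable_cong]

text \<open>Near 0 the density gives the constant 4, since pi < 4; for radii at least b the total
  mass M is at most (M / b^2) u^2. The case u = 0 says that N carries no mass and follows by
  shrinking balls.\<close>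

lemma quadratic_growth:
  obtains C where "C > 0" "\<And>u. u \<ge> 0 \<Longrightarrow> measure \<sigma> (cball N u) \<le> C * u\<^sup>2"
proof -
  have "\<forall>\<^sub>F u in at_right 0. measure \<sigma> (cball N u) / u\<^sup>2 < 4"
    using density pi_less_4 by (rule order_tendstoD(2))
  then obtain b where b: "b > 0" "\<And>u. 0 < u \<Longrightarrow> u < b \<Longrightarrow> measure \<sigma> (cball N u) / u\<^sup>2 < 4"
    unfolding eventually_at_right_field by auto
  define M where "M = measure \<sigma> (space \<sigma>)"
  define C where "C = 4 + 4 * M / b\<^sup>2"
  have M: "measure \<sigma> (cball N u) \<le> M" for u unfolding M_def by (rule bounded_measure)
  have M0: "M \<ge> 0" by (simp add: M_def)
  have *: "measure \<sigma> (cball N u) \<le> C * u\<^sup>2" if "u > 0" for u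
  proof (cases "u < b")
    case True
    have "measure \<sigma> (cball N u) \<le> 4 * u\<^sup>2" using b(2)[OF that True] that by (simp add: divide_simps)
    also have "\<dots> \<le> C * u\<^sup>2" using M0 by (intro mult_right_mono) (auto simp: C_def)
    finally show ?thesis .
  next
    case False
    have "M * b\<^sup>2 \<le> M * u\<^sup>2" using M0 False b(1) by (intro mult_left_mono power_mono) auto
    then have "M \<le> M / b\<^sup>2 * u\<^sup>2" using b(1) by (simp add: field_simps)
    also have "\<dots> \<le> C * u\<^sup>2"
    proof (intro mult_right_mono)
      have "M / b\<^sup>2 \<ge> 0" using M0 by simp
      then show "M / b\<^sup>2 \<le> C" by (simp add: C_def)
    qed simp
    finally show ?thesis using M[of u] by linarith
  qed
  have C: "C > 0" using M0 by (simp add: C_def add_pos_nonneg)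
  have "measure \<sigma> {N} \<le> e" if "e > 0" for e
  proof -
    define u where "u = sqrt (e / C)"
    have u: "u > 0" "u\<^sup>2 = e / C" using that C by (auto simp: u_def)
    have "measure \<sigma> {N} \<le> measure \<sigma> (cball N u)" using u by (intro finite_measure_mono) (auto simp: sets)
    also have "\<dots> \<le> C * u\<^sup>2" using * u(1) by blast
    also have "\<dots> = e" using C by (simp add: u)
    finally show ?thesis .
  qed
  then have "measure \<sigma> {N} \<le> 0" by (meson dense_ge)
  then have "measure \<sigma> (cball N 0) = 0" by (simp add: measure_le_0_iff)
  with * have "measure \<sigma> (cball N u) \<le> C * u\<^sup>2" if "u \<ge> 0" for u
    using that by (cases "u = 0") auto
  with C show ?thesis by (rule that)
qed

lemma emeasure_center: "emeasure \<sigma> {N} = 0"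
proof -
  obtain C where C: "\<And>u. u \<ge> 0 \<Longrightarrow> measure \<sigma> (cball N u) \<le> C * u\<^sup>2" using quadratic_growth by metis
  have "measure \<sigma> {N} = 0" using C[of 0] by (simp add: measure_le_0_iff)
  then show ?thesis by (simp add: emeasure_eq_measure)
qed

lemma AE_not_center: "AE P in \<sigma>. P \<noteq> N"
proof -
  have "{N} \<in> null_sets \<sigma>" using emeasure_center by (auto simp: sets)
  from AE_not_in[OF this] show ?thesis by simp
qed

text \<open>The power of a distance d is the integral of \<beta> u powr (-\<beta> - 1) over u \<ge>
  d. Against ball measures this density is integrable at 0, because they are O(u^2) and \<beta> < 2,
  and at infinity, because they are bounded and \<beta> > 0.\<close>

lemma integrable_dist_powr:
  assumes "0 < \<beta>" "\<beta> < 2"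
  shows "integrable \<sigma> (\<lambda>P. dist N P powr (- \<beta>))"
proof -
  obtain C where C: "C > 0" "\<And>u. u \<ge> 0 \<Longrightarrow> measure \<sigma> (cball N u) \<le> C * u\<^sup>2" using quadratic_growth by metis
  define M where "M = measure \<sigma> (space \<sigma>)"
  have M: "measure \<sigma> (cball N u) \<le> M" for u unfolding M_def by (rule bounded_measure)
  have M0: "M \<ge> 0" by (simp add: M_def)
  let ?\<psi> = "\<lambda>u. ennreal (\<beta> * u powr (- \<beta> - 1)) * indicator {0..} u"
  have *: "ennreal (d powr (- \<beta>)) = (\<integral>\<^sup>+u. ?\<psi> u * indicator {d..} u \<partial>lborel)" if "d > 0" for d
  proof -
    have "((\<lambda>x. x powr (- \<beta> - 1)) has_integral - (d powr (- \<beta> - 1 + 1)) / (- \<beta> - 1 + 1)) {d..}"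
      using that assms by (intro has_integral_powr_to_inf) auto
    from has_integral_mult_right[OF this, of \<beta>]
    have "((\<lambda>x. \<beta> * x powr (- \<beta> - 1)) has_integral d powr (- \<beta>)) {d..}"
      using assms by simp
    then have "(\<integral>\<^sup>+u. ennreal (\<beta> * u powr (- \<beta> - 1)) * indicator {d..} u \<partial>lborel) = ennreal (d powr (- \<beta>))"
      using assms by (intro nn_integral_indicator_has_integral) auto
    also have "(\<integral>\<^sup>+u. ennreal (\<beta> * u powr (- \<beta> - 1)) * indicator {d..} u \<partial>lborel) = (\<integral>\<^sup>+u. ?\<psi> u * indicator {d..} u \<partial>lborel)"
      using that by (intro nn_integral_cong) (auto simp: indicator_def)
    finally show ?thesis by simp
  qed
  have "(\<integral>\<^sup>+P. ennreal (norm (dist N P powr (- \<beta>))) \<partial>\<sigma>) \<le> (\<integral>\<^sup>+P. (\<integral>\<^sup>+u. ?\<psi> u * indicator {dist N P..} u \<partial>lborel) \<partial>\<sigma>)"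
  proof (rule nn_integral_mono)
    \<comment> \<open>At P = N the left side is 0, because \<open>0 powr x = 0\<close> for every x;
      elsewhere the representation applies.\<close>
    fix P show "ennreal (norm (dist N P powr (- \<beta>))) \<le> (\<integral>\<^sup>+u. ?\<psi> u * indicator {dist N P..} u \<partial>lborel)"
      using *[of "dist N P"] by (cases "P = N") auto
  qed
  also have "\<dots> = (\<integral>\<^sup>+u. ?\<psi> u * emeasure \<sigma> (cball N u) \<partial>lborel)"
    using finite_measure_axioms sets by (rule nn_integral_layer_cake) measurable
  also have "\<dots> \<le> (\<integral>\<^sup>+u. ennreal (\<beta> * C * u powr (1 - \<beta>)) * indicator {0..1} u
      + ennreal (\<beta> * M * u powr (- \<beta> - 1)) * indicator {1..} u \<partial>lborel)"
  proof (rule nn_integral_mono)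
    fix u :: real
    consider "u \<le> 0" | "u > 0" "u \<le> 1" | "u > 1" by linarith
    then show "?\<psi> u * emeasure \<sigma> (cball N u) \<le> ennreal (\<beta> * C * u powr (1 - \<beta>)) * indicator {0..1} u
      + ennreal (\<beta> * M * u powr (- \<beta> - 1)) * indicator {1..} u"
    proof cases
      case 1 then show ?thesis by (cases "u = 0") (auto simp: indicator_def)
    next
      case 2
      have "\<beta> * u powr (- \<beta> - 1) * measure \<sigma> (cball N u) \<le> \<beta> * u powr (- \<beta> - 1) * (C * u\<^sup>2)"
        using assms 2 C by (intro mult_left_mono) auto
      also have "\<dots> = \<beta> * C * (u powr (- \<beta> - 1) * u powr 2)" using 2 by simp
      also have "u powr (- \<beta> - 1) * u powr 2 = u powr (1 - \<beta>)" by (simp flip: powr_add)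
      finally have "ennreal (\<beta> * u powr (- \<beta> - 1) * measure \<sigma> (cball N u)) \<le> ennreal (\<beta> * C * u powr (1 - \<beta>))"
        by (rule ennreal_leI)
      then have "?\<psi> u * emeasure \<sigma> (cball N u) \<le> ennreal (\<beta> * C * u powr (1 - \<beta>))"
        using 2 assms by (simp add: emeasure_eq_measure indicator_def ennreal_mult)
      then show ?thesis using 2 by (simp add: add_increasing2)
    next
      case 3
      have "\<beta> * u powr (- \<beta> - 1) * measure \<sigma> (cball N u) \<le> \<beta> * u powr (- \<beta> - 1) * M"
        using assms 3 M by (intro mult_left_mono) auto
      then have "ennreal (\<beta> * u powr (- \<beta> - 1) * measure \<sigma> (cball N u)) \<le> ennreal (\<beta> * u powr (- \<beta> - 1) * M)"
        by (rule ennreal_leI)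
      then have "?\<psi> u * emeasure \<sigma> (cball N u) \<le> ennreal (\<beta> * M * u powr (- \<beta> - 1))"
        using 3 assms by (simp add: emeasure_eq_measure indicator_def ennreal_mult mult_ac)
      then show ?thesis using 3 by (simp add: add_increasing)
    qed
  qed
  also have "\<dots> = (\<integral>\<^sup>+u. ennreal (\<beta> * C * u powr (1 - \<beta>)) * indicator {0..1} u \<partial>lborel)
      + (\<integral>\<^sup>+u. ennreal (\<beta> * M * u powr (- \<beta> - 1)) * indicator {1..} u \<partial>lborel)"
    by (intro nn_integral_add) measurable
  also have "(\<integral>\<^sup>+u. ennreal (\<beta> * C * u powr (1 - \<beta>)) * indicator {0..1} u \<partial>lborel) < \<infinity>"
  proof -
    have "((\<lambda>x. x powr (1 - \<beta>)) has_integral (1 powr (1 - \<beta> + 1) / (1 - \<beta> + 1))) {0..1}"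
      using assms by (intro has_integral_powr_from_0) auto
    from has_integral_mult_right[OF this, of "\<beta> * C"]
    have "(\<integral>\<^sup>+u. ennreal (\<beta> * C * u powr (1 - \<beta>)) * indicator {0..1} u \<partial>lborel) = ennreal (\<beta> * C * (1 powr (1 - \<beta> + 1) / (1 - \<beta> + 1)))"
      using assms C by (intro nn_integral_indicator_has_integral) auto
    then show ?thesis by simp
  qed
  then have "(\<integral>\<^sup>+u. ennreal (\<beta> * C * u powr (1 - \<beta>)) * indicator {0..1} u \<partial>lborel)
      + (\<integral>\<^sup>+u. ennreal (\<beta> * M * u powr (- \<beta> - 1)) * indicator {1..} u \<partial>lborel) < \<infinity>"
  proof -
    have "((\<lambda>x. x powr (- \<beta> - 1)) has_integral - (1 powr (- \<beta> - 1 + 1)) / (- \<beta> - 1 + 1)) {1..}"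
      using assms by (intro has_integral_powr_to_inf) auto
    from has_integral_mult_right[OF this, of "\<beta> * M"]
    have "(\<integral>\<^sup>+u. ennreal (\<beta> * M * u powr (- \<beta> - 1)) * indicator {1..} u \<partial>lborel) = ennreal (\<beta> * M * (- (1 powr (- \<beta> - 1 + 1)) / (- \<beta> - 1 + 1)))"
      using assms M0 by (intro nn_integral_indicator_has_integral) auto
    then show ?thesis using \<open>_ < \<infinity>\<close> by simp
  qed
  finally have "(\<integral>\<^sup>+P. ennreal (norm (dist N P powr (- \<beta>))) \<partial>\<sigma>) < \<infinity>" .
  moreover have "(\<lambda>P. dist N P powr (- \<beta>)) \<in> borel_measurable \<sigma>" by measurable
  ultimately show ?thesis by (simp add: integrable_iff_bounded)
qed

lemma measure_cball_measurable [measurable]: "(\<lambda>u. measure \<sigma> (cball N u)) \<in> borel_measurable borel"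
  by (intro borel_measurable_mono monoI finite_measure_mono) (auto simp: sets)

lemma poisson_kernel_integrable:
  assumes "h > 0" shows "integrable \<sigma> (\<lambda>P. poisson_kernel h (dist N P))"
  using poisson_kernel_le_const[OF assms] poisson_kernel_nonneg[of h] assms
  by (intro integrable_const_bound[of _ "h / h ^ 3"]) (auto simp: poisson_kernel_def[abs_def])

text \<open>Factoring out u^2 leaves a kernel in the radius of total mass 2, concentrating at 0 as h
  decreases, against the quotient whose limit is the density.\<close>

lemma poisson_kernel_integral_eq:
  assumes "h > 0"
  shows "(\<integral>P. poisson_kernel h (dist N P) \<partial>\<sigma>) =
     (\<integral>u. 3 * h * u ^ 3 / sqrt (u\<^sup>2 + h\<^sup>2) ^ 5 * indicator {0..} u * (measure \<sigma> (cball N u) / u\<^sup>2) \<partial>lborel)"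
proof -
  let ?\<psi> = "\<lambda>u. ennreal (3 * h * u / sqrt (u\<^sup>2 + h\<^sup>2) ^ 5) * indicator {0..} u"
  have "(\<integral>\<^sup>+P. ennreal (poisson_kernel h (dist N P)) \<partial>\<sigma>) = (\<integral>\<^sup>+P. (\<integral>\<^sup>+u. ?\<psi> u * indicator {dist N P..} u \<partial>lborel) \<partial>\<sigma>)"
  proof (rule nn_integral_cong)
    fix P
    have "ennreal (poisson_kernel h (dist N P)) = (\<integral>\<^sup>+u. ennreal (3 * h * u / sqrt (u\<^sup>2 + h\<^sup>2) ^ 5) * indicator {dist N P..} u \<partial>lborel)"
      using assms by (intro poisson_kernel_nn_integral[symmetric]) auto
    also have "\<dots> = (\<integral>\<^sup>+u. ?\<psi> u * indicator {dist N P..} u \<partial>lborel)"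
      by (intro nn_integral_cong) (auto simp: indicator_def intro: order_trans[OF zero_le_dist])
    finally show "ennreal (poisson_kernel h (dist N P)) = (\<integral>\<^sup>+u. ?\<psi> u * indicator {dist N P..} u \<partial>lborel)" .
  qed
  also have "\<dots> = (\<integral>\<^sup>+u. ?\<psi> u * emeasure \<sigma> (cball N u) \<partial>lborel)"
    using finite_measure_axioms sets by (rule nn_integral_layer_cake) measurable
  also have "\<dots> = (\<integral>\<^sup>+u. ennreal (3 * h * u ^ 3 / sqrt (u\<^sup>2 + h\<^sup>2) ^ 5 * indicator {0..} u * (measure \<sigma> (cball N u) / u\<^sup>2)) \<partial>lborel)"
  proof (rule nn_integral_cong_AE)
    have "AE u in lborel. u \<noteq> (0::real)" by (rule AE_lborel_singleton)
    then show "AE u in lborel. ?\<psi> u * emeasure \<sigma> (cball N u)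
      = ennreal (3 * h * u ^ 3 / sqrt (u\<^sup>2 + h\<^sup>2) ^ 5 * indicator {0..} u * (measure \<sigma> (cball N u) / u\<^sup>2))"
    proof eventually_elim
      case (elim u)
      have "3 * h * u * X / s = 3 * h * u ^ 3 / s * (X / u\<^sup>2)" for X s :: real
        using elim by (simp add: power2_eq_square power3_eq_cube)
      from this[of "measure \<sigma> (cball N u)" "sqrt (u\<^sup>2 + h\<^sup>2) ^ 5"]
      show ?case using elim assms
        by (auto simp: indicator_def emeasure_eq_measure simp flip: ennreal_mult)
    qed
  qed
  finally have eq: "(\<integral>\<^sup>+P. ennreal (poisson_kernel h (dist N P)) \<partial>\<sigma>) = \<dots>" .
  have "(\<integral>P. poisson_kernel h (dist N P) \<partial>\<sigma>) = enn2real (\<integral>\<^sup>+P. ennreal (poisson_kernel h (dist N P)) \<partial>\<sigma>)"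
    using assms by (intro integral_eq_nn_integral) (auto simp: poisson_kernel_nonneg poisson_kernel_def[abs_def])
  also have "\<dots> = (\<integral>u. 3 * h * u ^ 3 / sqrt (u\<^sup>2 + h\<^sup>2) ^ 5 * indicator {0..} u * (measure \<sigma> (cball N u) / u\<^sup>2) \<partial>lborel)"
    unfolding eq using assms by (intro integral_eq_nn_integral[symmetric]) (auto simp: indicator_def)
  finally show ?thesis .
qed

text \<open>An approximate identity in the radius: below \<delta> the quotient is within e/8 of pi
  and the kernel has mass at most 2; beyond \<delta> the quotient is bounded and the kernel has mass
  at most 3h/\<delta>.\<close>

lemma poisson_kernel_tendsto: "((\<lambda>h. \<integral>P. poisson_kernel h (dist N P) \<partial>\<sigma>) \<longlongrightarrow> 2 * pi) (at_right 0)"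
proof (rule tendstoI)
  fix e :: real assume "e > 0"
  obtain C where C: "C > 0" "\<And>u. u \<ge> 0 \<Longrightarrow> measure \<sigma> (cball N u) \<le> C * u\<^sup>2" using quadratic_growth by metis
  define \<phi> where "\<phi> = (\<lambda>u. measure \<sigma> (cball N u) / u\<^sup>2)"
  have \<phi>: "0 \<le> \<phi> u" "\<phi> u \<le> C" if "u \<ge> 0" for u
  proof -
    show "0 \<le> \<phi> u" by (simp add: \<phi>_def)
    show "\<phi> u \<le> C" using C that by (cases "u = 0") (auto simp: \<phi>_def divide_simps)
  qed
  have "\<forall>\<^sub>F u in at_right 0. dist (\<phi> u) pi < e / 8"
    unfolding \<phi>_def using density \<open>e > 0\<close> by (intro tendstoD) auto
  then obtain \<delta> where \<delta>: "\<delta> > 0" "\<And>u. 0 < u \<Longrightarrow> u < \<delta> \<Longrightarrow> dist (\<phi> u) pi < e / 8"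
    unfolding eventually_at_right_field by auto
  define B where "B = C + 4"
  have B: "\<bar>\<phi> u - pi\<bar> \<le> B" if "u \<ge> 0" for u
    using \<phi>[OF that] pi_less_4 pi_gt_zero C(1) unfolding B_def by linarith
  \<comment> \<open>Below this threshold the large radii contribute less than 3e/8, on top of e/4
    from the small ones.\<close>
  have "\<forall>\<^sub>F h in at_right 0. h < e * \<delta> / (8 * B) \<and> h > 0"
  proof -
    have "e * \<delta> / (8 * B) > 0" using \<open>e > 0\<close> \<delta>(1) C(1) by (simp add: B_def)
    then show ?thesis unfolding eventually_at_right_field by (intro exI[of _ "e * \<delta> / (8 * B)"]) auto
  qed
  then show "\<forall>\<^sub>F h in at_right 0. dist (\<integral>P. poisson_kernel h (dist N P) \<partial>\<sigma>) (2 * pi) < e"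
  proof eventually_elim
    case (elim h)
    then have h: "h > 0" by simp
    define g where "g = (\<lambda>u. 3 * h * u ^ 3 / sqrt (u\<^sup>2 + h\<^sup>2) ^ 5 * indicator {0..} u)"
    have g0: "g u \<ge> 0" for u using h by (auto simp: g_def indicator_def)
    have [measurable]: "g \<in> borel_measurable borel" by (simp add: g_def)
    have [measurable]: "\<phi> \<in> borel_measurable borel" by (simp add: \<phi>_def)
    have "has_bochner_integral lborel g 2"
      using poisson_kernel_moment[OF h, of 0] h by (simp add: g_def)
    then have g: "integrable lborel g" "(\<integral>u. g u \<partial>lborel) = 2"
      by (auto simp: has_bochner_integral_iff)
    define s where "s = sqrt (\<delta>\<^sup>2 + h\<^sup>2)"
    have s: "s \<ge> \<delta>" using \<delta>(1) by (auto simp: s_def intro!: real_le_rsqrt)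
    have t: "has_bochner_integral lborel (\<lambda>u. g u * indicator {\<delta>..} u) (3 * h / s - h ^ 3 / s ^ 3)"
    proof -
      have "(\<lambda>u. g u * indicator {\<delta>..} u) = (\<lambda>u. 3 * h * u ^ 3 / sqrt (u\<^sup>2 + h\<^sup>2) ^ 5 * indicator {\<delta>..} u)"
        using \<delta>(1) by (auto simp: g_def indicator_def fun_eq_iff)
      then show ?thesis using poisson_kernel_moment[OF h, of \<delta>] \<delta>(1) by (simp add: s_def)
    qed
    have tail: "integrable lborel (\<lambda>u. g u * indicator {\<delta>..} u)" "(\<integral>u. g u * indicator {\<delta>..} u \<partial>lborel) \<le> 3 * h / \<delta>"
    proof -
      show "integrable lborel (\<lambda>u. g u * indicator {\<delta>..} u)" using t by (auto simp: has_bochner_integral_iff)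
      have "(\<integral>u. g u * indicator {\<delta>..} u \<partial>lborel) = 3 * h / s - h ^ 3 / s ^ 3"
        using t by (auto simp: has_bochner_integral_iff)
      also have "\<dots> \<le> 3 * h / s" using h s \<delta>(1) by simp
      also have "\<dots> \<le> 3 * h / \<delta>" using h s \<delta>(1) by (intro divide_left_mono) auto
      finally show "(\<integral>u. g u * indicator {\<delta>..} u \<partial>lborel) \<le> 3 * h / \<delta>" .
    qed
    have bd: "\<bar>g u * (\<phi> u - pi)\<bar> \<le> e / 8 * g u + B * (g u * indicator {\<delta>..} u)" for u
    proof -
      consider "u < 0" | "u = 0" | "0 < u" "u < \<delta>" | "u \<ge> \<delta>" by linarith
      then show ?thesis
      proof cases
        case 3
        then have "g u * \<bar>\<phi> u - pi\<bar> \<le> g u * (e / 8)"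
          using \<delta>(2)[of u] g0[of u] by (intro mult_left_mono) (auto simp: dist_real_def)
        then show ?thesis using 3 g0[of u] by (simp add: abs_mult mult.commute)
      next
        case 4
        then have "g u * \<bar>\<phi> u - pi\<bar> \<le> g u * B"
          using \<delta>(1) B[of u] g0[of u] by (intro mult_left_mono) auto
        moreover have "0 \<le> e / 8 * g u" using g0[of u] \<open>e > 0\<close> by simp
        ultimately show ?thesis using 4 g0[of u] by (simp add: abs_mult mult.commute)
      qed (auto simp: g_def)
    qed
    have ib: "integrable lborel (\<lambda>u. e / 8 * g u + B * (g u * indicator {\<delta>..} u))"
      using g tail by auto
    have i1: "integrable lborel (\<lambda>u. g u * (\<phi> u - pi))"
      by (rule Bochner_Integration.integrable_bound[OF ib]) (use order_trans[OF bd abs_ge_self] in auto)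
    have "(\<integral>u. g u * (\<phi> u - pi) + pi * g u \<partial>lborel) = (\<integral>u. g u * (\<phi> u - pi) \<partial>lborel) + pi * 2"
      using i1 g by simp
    moreover have "(\<integral>P. poisson_kernel h (dist N P) \<partial>\<sigma>) = (\<integral>u. g u * (\<phi> u - pi) + pi * g u \<partial>lborel)"
    proof -
      have "g u * (\<phi> u - pi) + pi * g u = g u * \<phi> u" for u by (simp add: right_diff_distrib)
      then show ?thesis unfolding poisson_kernel_integral_eq[OF h] by (simp only: g_def \<phi>_def)
    qed
    ultimately have "(\<integral>P. poisson_kernel h (dist N P) \<partial>\<sigma>) - 2 * pi = (\<integral>u. g u * (\<phi> u - pi) \<partial>lborel)" by simp
    also have "\<bar>\<dots>\<bar> \<le> (\<integral>u. \<bar>g u * (\<phi> u - pi)\<bar> \<partial>lborel)" by (rule integral_abs_bound)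
    also have "\<dots> \<le> (\<integral>u. e / 8 * g u + B * (g u * indicator {\<delta>..} u) \<partial>lborel)"
      using i1 ib bd by (intro integral_mono) auto
    also have "\<dots> = e / 8 * 2 + B * (\<integral>u. g u * indicator {\<delta>..} u \<partial>lborel)"
      using g tail by simp
    also have "\<dots> \<le> e / 4 + B * (3 * h / \<delta>)"
      using mult_left_mono[OF tail(2), of B] C(1) by (simp add: B_def)
    also have "B * (3 * h / \<delta>) < 3 * e / 8"
      using elim \<delta>(1) C(1) by (simp add: B_def field_simps)
    finally show ?case using \<open>e > 0\<close> by (simp add: dist_real_def)
  qed
qed

lemma poisson_kernel_weighted_integrable:
  assumes "h > 0" and meas [measurable]: "G \<in> borel_measurable borel" and bound: "AE P in \<sigma>. \<bar>G P\<bar> \<le> B"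
  shows "integrable \<sigma> (\<lambda>P. G P * poisson_kernel h (dist N P))"
proof (rule Bochner_Integration.integrable_bound[OF integrable_mult_right[OF poisson_kernel_integrable[OF assms(1)], of B]])
  show "(\<lambda>P. G P * poisson_kernel h (dist N P)) \<in> borel_measurable \<sigma>" unfolding poisson_kernel_def by measurable
  show "AE P in \<sigma>. norm (G P * poisson_kernel h (dist N P)) \<le> norm (B * poisson_kernel h (dist N P))"
    using bound
  proof eventually_elim
    case (elim P)
    then show ?case using poisson_kernel_nonneg[of h "dist N P"] \<open>h > 0\<close> by (auto simp: abs_mult intro!: mult_right_mono)
  qed
qed

text \<open>The weight moves with h, so its limit at (0, N) is taken jointly in h and P. Near N the
  weight is close to G and the kernel has bounded mass; away from N the kernel is at most
  h/\<delta>^3 and boundedness of the weight suffices.\<close>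

lemma poisson_kernel_weighted_tendsto:
  assumes meas: "\<And>h. H h \<in> borel_measurable borel"
    and S: "AE P in \<sigma>. P \<in> S"
    and bound: "h0 > 0" "\<And>h P. 0 < h \<Longrightarrow> h < h0 \<Longrightarrow> P \<in> S \<Longrightarrow> \<bar>H h P\<bar> \<le> B"
    and lim: "((\<lambda>(h, P). H h P) \<longlongrightarrow> G) (at (0, N) within {0<..} \<times> S)"
  shows "((\<lambda>h. \<integral>P. H h P * poisson_kernel h (dist N P) \<partial>\<sigma>) \<longlongrightarrow> 2 * pi * G) (at_right 0)"
proof -
  have int: "integrable \<sigma> (\<lambda>P. H h P * poisson_kernel h (dist N P))" if "0 < h" "h < h0" for h
    using S by (intro poisson_kernel_weighted_integrable[OF that(1) meas, of _ B]) (auto elim!: eventually_mono bound(2)[OF that])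
  have "((\<lambda>h. (\<integral>P. H h P * poisson_kernel h (dist N P) \<partial>\<sigma>) - G * (\<integral>P. poisson_kernel h (dist N P) \<partial>\<sigma>)) \<longlongrightarrow> 0) (at_right 0)"
  proof (rule tendstoI)
    fix e :: real assume "e > 0"
    \<comment> \<open>The kernel integral is eventually below 2 pi + 1 < 9 and the far part below
      e', so the total stays below 10 e' < e.\<close>
    define e' where "e' = e / 16"
    have "e' > 0" using \<open>e > 0\<close> by (simp add: e'_def)
    have "\<forall>\<^sub>F x in at (0, N) within {0<..} \<times> S. dist (case x of (h, P) \<Rightarrow> H h P) G < e'"
      using lim \<open>e' > 0\<close> by (rule tendstoD)
    then obtain d where d: "d > 0" "\<And>h P. h > 0 \<Longrightarrow> P \<in> S \<Longrightarrow> dist (h, P) (0, N) < d \<Longrightarrow> dist (H h P) G < e'"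
      unfolding eventually_at by fastforce
    define \<delta> where "\<delta> = d / 2"
    have \<delta>: "\<delta> > 0" using d by (simp add: \<delta>_def)
    have near: "\<bar>H h P - G\<bar> \<le> e'" if "0 < h" "h < \<delta>" "P \<in> S" "dist N P < \<delta>" for h P
    proof -
      have "dist (h, P) (0, N) \<le> dist h 0 + dist P N"
        unfolding dist_Pair_Pair by (intro sqrt_sum_squares_le_sum) auto
      also have "\<dots> < d" using that by (simp add: \<delta>_def dist_commute dist_real_def)
      finally show ?thesis using d(2)[of h P] that by (auto simp: dist_real_def)
    qed
    define B' where "B' = \<bar>B\<bar> + \<bar>G\<bar>"
    define M where "M = measure \<sigma> (space \<sigma>)"
    have M: "M \<ge> 0" by (simp add: M_def)
    have far: "\<bar>H h P - G\<bar> \<le> B'" if "0 < h" "h < h0" "P \<in> S" for h P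
      using bound(2)[OF that] unfolding B'_def by linarith
    define c where "c = B' * M / \<delta> ^ 3"
    have c: "c \<ge> 0" using M \<delta> by (simp add: c_def B'_def)
    have "\<forall>\<^sub>F h in at_right 0. dist (\<integral>P. poisson_kernel h (dist N P) \<partial>\<sigma>) (2 * pi) < 1"
      using poisson_kernel_tendsto by (rule tendstoD) auto
    moreover have "\<forall>\<^sub>F h in at_right 0. 0 < h \<and> h < min (min h0 \<delta>) (e' / (c + 1))"
    proof -
      have "min (min h0 \<delta>) (e' / (c + 1)) > 0" using \<open>e' > 0\<close> \<delta> bound(1) c by simp
      then show ?thesis unfolding eventually_at_right_field by blast
    qed
    ultimately show "\<forall>\<^sub>F h in at_right 0. dist ((\<integral>P. H h P * poisson_kernel h (dist N P) \<partial>\<sigma>) - G * (\<integral>P. poisson_kernel h (dist N P) \<partial>\<sigma>)) 0 < e"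
    proof eventually_elim
      case (elim h)
      then have h: "0 < h" "h < h0" "h < \<delta>" "h < e' / (c + 1)" by auto
      have "h * (c + 1) < e'" using h(4) c by (simp add: pos_less_divide_eq)
      then have hc: "c * h < e'" using h(1) by (simp add: algebra_simps)
      have bd: "AE P in \<sigma>. \<bar>H h P * poisson_kernel h (dist N P) - G * poisson_kernel h (dist N P)\<bar> \<le> e' * poisson_kernel h (dist N P) + B' * h / \<delta> ^ 3"
        using S
      proof eventually_elim
        case (elim P)
        have eq: "\<bar>H h P * poisson_kernel h (dist N P) - G * poisson_kernel h (dist N P)\<bar> = \<bar>H h P - G\<bar> * poisson_kernel h (dist N P)"
          using poisson_kernel_nonneg[of h "dist N P"] h by (simp add: abs_mult flip: left_diff_distrib)
        show ?case
        proof (cases "dist N P < \<delta>")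
          case True
          have "\<bar>H h P - G\<bar> * poisson_kernel h (dist N P) \<le> e' * poisson_kernel h (dist N P)"
            using near[OF h(1,3) elim True] poisson_kernel_nonneg[of h "dist N P"] h by (intro mult_right_mono) auto
          moreover have "0 \<le> B' * h / \<delta> ^ 3" using \<delta> h by (simp add: B'_def)
          ultimately show ?thesis unfolding eq by linarith
        next
          case False
          have "\<bar>H h P - G\<bar> * poisson_kernel h (dist N P) \<le> B' * (h / \<delta> ^ 3)"
            using far[OF h(1,2) elim] poisson_kernel_nonneg[of h "dist N P"] poisson_kernel_le[of h \<delta> "dist N P"] h \<delta> False
            by (intro mult_mono) (auto simp: B'_def)
          moreover have "0 \<le> e' * poisson_kernel h (dist N P)" using \<open>e' > 0\<close> poisson_kernel_nonneg[of h "dist N P"] h by simp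
          ultimately show ?thesis unfolding eq by simp
        qed
      qed
      note ii = int[OF h(1,2)] poisson_kernel_integrable[OF h(1)]
      have "(\<integral>P. H h P * poisson_kernel h (dist N P) \<partial>\<sigma>) - G * (\<integral>P. poisson_kernel h (dist N P) \<partial>\<sigma>)
        = (\<integral>P. H h P * poisson_kernel h (dist N P) - G * poisson_kernel h (dist N P) \<partial>\<sigma>)"
        using ii by simp
      also have "\<bar>\<dots>\<bar> \<le> (\<integral>P. \<bar>H h P * poisson_kernel h (dist N P) - G * poisson_kernel h (dist N P)\<bar> \<partial>\<sigma>)" by (rule integral_abs_bound)
      also have "\<dots> \<le> (\<integral>P. e' * poisson_kernel h (dist N P) + B' * h / \<delta> ^ 3 \<partial>\<sigma>)"
        using ii bd by (intro integral_mono_AE) auto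
      also have "\<dots> = e' * (\<integral>P. poisson_kernel h (dist N P) \<partial>\<sigma>) + M * (B' * h / \<delta> ^ 3)"
        using ii by (simp add: M_def)
      also have "M * (B' * h / \<delta> ^ 3) = c * h" by (simp add: c_def)
      also have "e' * (\<integral>P. poisson_kernel h (dist N P) \<partial>\<sigma>) \<le> e' * 9"
        using elim \<open>e' > 0\<close> pi_less_4 by (intro mult_left_mono) (auto simp: dist_real_def)
      finally show ?case using hc \<open>e > 0\<close> by (simp add: dist_real_def e'_def)
    qed
  qed
  from tendsto_add[OF this tendsto_mult[OF tendsto_const[of G] poisson_kernel_tendsto]]
  show ?thesis by (simp add: mult.commute)
qed

text \<open>The sign \<open>e\<close> treats both sides at once: e = 1 approaches N against n, e =
  -1 along n. The difficulty is the denominator |P - M|, which depends on h. The Hoelder bound makes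
  |P - M|^2 equal to |P - N|^2 + h^2 up to a relative error that vanishes at N, so a single
  integrable bound serves for all small h and the Poisson kernel centred at the foot point can be
  split off.\<close>

lemma layer_potential_jump:
  fixes a b :: "'a \<Rightarrow> 'a \<Rightarrow> real" and n :: 'a
  defines "K \<equiv> \<lambda>P M. a P M * (n \<bullet> (P - M)) / dist P M ^ 3 + b P M / dist P M"
  assumes S: "compact S" "N \<in> S" "AE P in \<sigma>. P \<in> S" and n: "norm n = 1"
    and meas: "\<And>M. (\<lambda>P. a P M) \<in> borel_measurable borel" "\<And>M. (\<lambda>P. b P M) \<in> borel_measurable borel"
    and "\<epsilon> > 0"
    and cont: "continuous_on (S \<times> cball N \<epsilon>) (\<lambda>(P, M). a P M)" "continuous_on (S \<times> cball N \<epsilon>) (\<lambda>(P, M). b P M)"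
    and l: "0 < l" "l \<le> 1"
    and holder: "\<And>P. P \<in> S \<Longrightarrow> dist N P < \<epsilon> \<Longrightarrow> \<bar>n \<bullet> (P - N)\<bar> \<le> C * dist N P powr (1 + l)"
    and e: "e\<^sup>2 = 1"
  shows "integrable \<sigma> (\<lambda>P. K P N)"
    and "((\<lambda>h. \<integral>P. K P (N - (e * h) *\<^sub>R n) \<partial>\<sigma>) \<longlongrightarrow> 2 * pi * (e * a N N) + (\<integral>P. K P N \<partial>\<sigma>)) (at_right 0)"
proof -
  note meas[measurable]
  have ae: "\<bar>e\<bar> = 1" using e by (auto simp: power2_eq_1_iff)
  define X where "X = (\<lambda>h::real. N - (e * h) *\<^sub>R n)"
  have X0: "X 0 = N" by (simp add: X_def)
  have dX: "dist N (X h) = \<bar>h\<bar>" for h by (simp add: X_def dist_norm n abs_mult ae)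
  have Xc: "X h \<in> cball N \<epsilon>" if "\<bar>h\<bar> \<le> \<epsilon>" for h using that by (simp add: dX)
  define t where "t = (\<lambda>P. n \<bullet> (P - N))"
  have t: "\<bar>t P\<bar> \<le> dist N P" for P
    unfolding t_def using Cauchy_Schwarz_ineq2[of n "P - N"] n by (simp add: dist_norm norm_minus_commute)
  have tX: "n \<bullet> (P - X h) = t P + e * h" for P h
    using n by (simp add: X_def t_def algebra_simps dot_square_norm)
  have sq: "(dist P (X h))\<^sup>2 = (dist N P)\<^sup>2 + h\<^sup>2 + 2 * e * h * t P" for P h
  proof -
    have "P - X h = (P - N) + (e * h) *\<^sub>R n" by (simp add: X_def)
    then have "(dist P (X h))\<^sup>2 = ((P - N) + (e * h) *\<^sub>R n) \<bullet> ((P - N) + (e * h) *\<^sub>R n)"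
      by (simp only: dist_norm power2_norm_eq_inner)
    also have "\<dots> = (P - N) \<bullet> (P - N) + e\<^sup>2 * h\<^sup>2 * (n \<bullet> n) + 2 * e * h * t P"
      by (simp add: t_def inner_commute power2_eq_square algebra_simps)
    also have "(P - N) \<bullet> (P - N) = (dist N P)\<^sup>2"
      by (subst dist_commute) (simp only: dist_norm power2_norm_eq_inner)
    finally show ?thesis using e n by (simp add: dot_square_norm)
  qed
  define C' where "C' = \<bar>C\<bar> + 1"
  have C': "C' > 0" by (simp add: C'_def)
  have hold: "\<bar>t P\<bar> \<le> C' * dist N P powr (1 + l)" if "P \<in> S" "dist N P < \<epsilon>" for P
  proof -
    have "C * dist N P powr (1 + l) \<le> C' * dist N P powr (1 + l)"
      by (intro mult_right_mono) (auto simp: C'_def)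
    then show ?thesis using holder[OF that] unfolding t_def by linarith
  qed
  \<comment> \<open>With d = |P - N|, the mixed term is at most C' d^l times 2|h|d, and 2|h|d is at
    most d^2 + h^2.\<close>
  have ratio: "\<bar>(dist P (X h))\<^sup>2 - ((dist N P)\<^sup>2 + h\<^sup>2)\<bar> \<le> C' * dist N P powr l * ((dist N P)\<^sup>2 + h\<^sup>2)"
    if "P \<in> S" "dist N P < \<epsilon>" for P h
  proof -
    define d where "d = dist N P"
    have "d powr (1 + l) = d * d powr l" using powr_add[of d 1 l] by (simp add: d_def)
    then have "\<bar>2 * e * h * t P\<bar> \<le> 2 * \<bar>h\<bar> * (C' * (d * d powr l))"
      using hold[OF that] by (simp add: abs_mult ae d_def mult_left_mono)
    also have "\<dots> = C' * d powr l * (2 * \<bar>h\<bar> * d)" by simp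
    also have "\<dots> \<le> C' * d powr l * (d\<^sup>2 + h\<^sup>2)"
      using sum_squares_bound[of "\<bar>h\<bar>" d] C' by (intro mult_left_mono) auto
    finally show ?thesis unfolding sq d_def by simp
  qed
  \<comment> \<open>The second entry makes C' d^l at most 1/2 for d up to \<delta>; the first keeps
    \<delta> inside the range of the Hoelder bound.\<close>
  define \<delta> where "\<delta> = min (\<epsilon> / 2) ((1 / (2 * C')) powr (1 / l))"
  have \<delta>: "\<delta> > 0" "\<delta> < \<epsilon>" using \<open>\<epsilon> > 0\<close> C' by (auto simp: \<delta>_def)
  have \<delta>l: "C' * d powr l \<le> 1/2" if "0 \<le> d" "d \<le> \<delta>" for d
  proof -
    have "d powr l \<le> ((1 / (2 * C')) powr (1 / l)) powr l"
      using that l by (intro powr_mono2) (auto simp: \<delta>_def)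
    also have "\<dots> = 1 / (2 * C')" using l C' by (simp add: powr_powr)
    finally show ?thesis using C' by (simp add: field_simps)
  qed
  \<comment> \<open>Near N the relative error is at most 1/2. For d = |P - N| > \<delta> the trivial
    bound |n . (P - N)| \<le> d is enough: |h| \<le> \<delta>/4 < d/4 makes the mixed term at most
    d^2/2.\<close>
  have lower: "((dist N P)\<^sup>2 + h\<^sup>2) / 2 \<le> (dist P (X h))\<^sup>2" if "P \<in> S" "\<bar>h\<bar> \<le> \<delta> / 4" for P h
  proof (cases "dist N P \<le> \<delta>")
    case True
    have "C' * dist N P powr l * ((dist N P)\<^sup>2 + h\<^sup>2) \<le> 1/2 * ((dist N P)\<^sup>2 + h\<^sup>2)"
      using \<delta>l[of "dist N P"] True by (intro mult_right_mono) auto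
    then show ?thesis using ratio[of P h] that True \<delta> by auto
  next
    case False
    define d where "d = dist N P"
    have d: "\<delta> < d" using False by (simp add: d_def)
    have hd: "\<bar>h\<bar> \<le> d / 4" using that d by linarith
    have "\<bar>2 * e * h * t P\<bar> \<le> 2 * \<bar>h\<bar> * d"
      using t[of P] by (simp add: abs_mult ae d_def mult_left_mono)
    also have "\<dots> \<le> 2 * (d / 4) * d" using hd d \<delta> by (intro mult_right_mono mult_left_mono) auto
    finally have "- (d\<^sup>2 / 2) \<le> 2 * e * h * t P" by (simp add: power2_eq_square)
    moreover have "(d\<^sup>2 + h\<^sup>2) / 2 \<le> d\<^sup>2 + h\<^sup>2 + x" if "- (d\<^sup>2 / 2) \<le> x" for x
    proof -
      have "d\<^sup>2 + h\<^sup>2 + x - (d\<^sup>2 + h\<^sup>2) / 2 = (x + d\<^sup>2 / 2) + h\<^sup>2 / 2" by (simp add: field_simps)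
      moreover have "0 \<le> h\<^sup>2 / 2" by simp
      ultimately show ?thesis using that by linarith
    qed
    ultimately show ?thesis unfolding sq d_def[symmetric] by blast
  qed
  have lower_d: "dist N P / sqrt 2 \<le> dist P (X h)" if "P \<in> S" "\<bar>h\<bar> \<le> \<delta> / 4" for P h
  proof (rule power2_le_imp_le)
    show "(dist N P / sqrt 2)\<^sup>2 \<le> (dist P (X h))\<^sup>2"
      using lower[OF that] by (simp add: power_divide) (smt (verit) zero_le_power2)
  qed simp
  obtain A where A: "\<And>P M. P \<in> S \<Longrightarrow> M \<in> cball N \<epsilon> \<Longrightarrow> \<bar>a P M\<bar> \<le> A"
      and B: "\<And>P M. P \<in> S \<Longrightarrow> M \<in> cball N \<epsilon> \<Longrightarrow> \<bar>b P M\<bar> \<le> A" and A0: "A \<ge> 0"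
  proof -
    have "bounded ((\<lambda>(P, M). a P M) ` (S \<times> cball N \<epsilon>))" "bounded ((\<lambda>(P, M). b P M) ` (S \<times> cball N \<epsilon>))"
      using cont S by (auto intro!: compact_imp_bounded compact_continuous_image compact_Times)
    then obtain A1 A2 where "\<And>P M. P \<in> S \<Longrightarrow> M \<in> cball N \<epsilon> \<Longrightarrow> \<bar>a P M\<bar> \<le> A1"
       "\<And>P M. P \<in> S \<Longrightarrow> M \<in> cball N \<epsilon> \<Longrightarrow> \<bar>b P M\<bar> \<le> A2"
      unfolding bounded_iff by fastforce
    then show thesis by (intro that[of "max (max A1 A2) 0"]) (auto simp: le_max_iff_disj)
  qed
  \<comment> \<open>\<open>R\<close> keeps the numerator n . (P - N) and will be dominated;
    \<open>H\<close> is the coefficient that remains when the other numerator e h is expressed by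
    the Poisson kernel.\<close>
  define R where "R = (\<lambda>h P. a P (X h) * t P / dist P (X h) ^ 3 + b P (X h) / dist P (X h))"
  define H where "H = (\<lambda>h P. a P (X h) * (sqrt ((dist N P)\<^sup>2 + h\<^sup>2) / dist P (X h)) ^ 3)"
  have [measurable]: "t \<in> borel_measurable borel" by (simp add: t_def)
  have [measurable]: "R h \<in> borel_measurable borel" "H h \<in> borel_measurable borel" for h
    unfolding R_def H_def by measurable
  have KR: "K P N = R 0 P" for P by (simp add: K_def R_def X0 t_def)
  have KX: "K P (X h) = R h P + e * (H h P * poisson_kernel h (dist N P))" if "h > 0" for h P
  proof -
    have "sqrt ((dist N P)\<^sup>2 + h\<^sup>2) > 0" using that by (simp add: add_nonneg_pos)
    then have "H h P * poisson_kernel h (dist N P) = a P (X h) * h / dist P (X h) ^ 3"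
      by (simp add: H_def poisson_kernel_def power_divide)
    then show ?thesis unfolding K_def R_def tX by (simp add: algebra_simps add_divide_distrib)
  qed
  \<comment> \<open>For d \<ge> \<epsilon> the trivial bound d is at most \<epsilon> powr (-l) times
    d powr (1 + l), so the Hoelder bound extends to all of S.\<close>
  define C2 where "C2 = C' + \<epsilon> powr (- l)"
  have C2: "C2 \<ge> 0" using C' by (simp add: C2_def)
  have tb: "\<bar>t P\<bar> \<le> C2 * dist N P powr (1 + l)" if "P \<in> S" for P
  proof (cases "dist N P < \<epsilon>")
    case True
    have "C' * dist N P powr (1 + l) \<le> C2 * dist N P powr (1 + l)" by (intro mult_right_mono) (auto simp: C2_def)
    then show ?thesis using hold[OF that True] by linarith
  next
    case False
    define d where "d = dist N P"
    have d: "\<epsilon> \<le> d" using False by (simp add: d_def)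
    have "d * 1 \<le> d * (\<epsilon> powr (- l) * d powr l)"
    proof (rule mult_left_mono)
      have "\<epsilon> powr (- l) * \<epsilon> powr l \<le> \<epsilon> powr (- l) * d powr l"
        using d \<open>\<epsilon> > 0\<close> l by (intro mult_left_mono powr_mono2) auto
      then show "1 \<le> \<epsilon> powr (- l) * d powr l" using \<open>\<epsilon> > 0\<close> by (simp flip: powr_add)
    qed (simp add: d_def)
    also have "\<dots> = \<epsilon> powr (- l) * d powr (1 + l)" using d \<open>\<epsilon> > 0\<close> by (simp add: powr_add)
    also have "\<dots> \<le> C2 * d powr (1 + l)" using C' by (intro mult_right_mono) (auto simp: C2_def)
    finally show ?thesis using t[of P] by (simp add: d_def)
  qed
  \<comment> \<open>The exponents 2 - l and 1 both lie strictly between 0 and 2. The powers of sqrt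
    2 come from |P - M| \<ge> |P - N| / sqrt 2.\<close>
  define W where "W = (\<lambda>P. A * C2 * sqrt 2 ^ 3 * dist N P powr (- (2 - l)) + A * sqrt 2 * dist N P powr (- 1))"
  have Rb: "norm (R h P) \<le> W P" if "P \<in> S" "P \<noteq> N" "\<bar>h\<bar> \<le> \<delta> / 4" for h P
  proof -
    define d where "d = dist N P"
    have d: "d > 0" using that by (simp add: d_def)
    have D: "d / sqrt 2 \<le> dist P (X h)" using lower_d[OF that(1,3)] by (simp add: d_def)
    have "d / sqrt 2 > 0" using d by simp
    then have D0: "dist P (X h) > 0" using D by linarith
    have c: "X h \<in> cball N \<epsilon>" using that(3) \<delta> by (intro Xc) auto
    have "\<bar>a P (X h) * t P / dist P (X h) ^ 3\<bar> \<le> A * (C2 * d powr (1 + l)) / (d / sqrt 2) ^ 3"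
      unfolding abs_mult abs_divide using A[OF that(1) c] tb[OF that(1)] A0 C2 D \<open>d / sqrt 2 > 0\<close>
      by (intro frac_le mult_mono) (auto simp: d_def intro!: power_mono simp flip: power_divide)
    also have "\<dots> = A * C2 * sqrt 2 ^ 3 * (d powr (1 + l) / d ^ 3)" by (simp add: power_divide)
    also have "d powr (1 + l) / d ^ 3 = d powr (- (2 - l))"
      using d powr_diff[of d "1 + l" 3] by simp
    finally have 1: "\<bar>a P (X h) * t P / dist P (X h) ^ 3\<bar> \<le> A * C2 * sqrt 2 ^ 3 * d powr (- (2 - l))" .
    have "\<bar>b P (X h) / dist P (X h)\<bar> \<le> A / (d / sqrt 2)"
      unfolding abs_divide using B[OF that(1) c] A0 D \<open>d / sqrt 2 > 0\<close> by (intro frac_le) auto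
    also have "\<dots> = A * sqrt 2 * d powr (- 1)" using d by (simp add: powr_minus_divide)
    finally show ?thesis using 1 unfolding R_def W_def d_def real_norm_def by linarith
  qed
  have W: "integrable \<sigma> W"
    unfolding W_def using l by (intro Bochner_Integration.integrable_add integrable_mult_right integrable_dist_powr) auto
  have Rb': "AE P in \<sigma>. norm (R h P) \<le> W P" if "\<bar>h\<bar> \<le> \<delta> / 4" for h
    using S(3) AE_not_center by eventually_elim (use Rb that in auto)
  have Ri: "integrable \<sigma> (R h)" if "\<bar>h\<bar> \<le> \<delta> / 4" for h
  proof (rule Bochner_Integration.integrable_bound[OF W])
    show "AE P in \<sigma>. norm (R h P) \<le> norm (W P)"
      using Rb'[OF that] by eventually_elim auto
  qed simp
  show "integrable \<sigma> (\<lambda>P. K P N)" unfolding KR using \<delta> by (intro Ri) simp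
  have Xcont: "(X \<longlongrightarrow> X h) (at h within T)" for h T
    unfolding X_def by (intro tendsto_intros)
  have Rlim: "((\<lambda>h. \<integral>P. R h P \<partial>\<sigma>) \<longlongrightarrow> (\<integral>P. R 0 P \<partial>\<sigma>)) (at_right 0)"
  proof (rule tendsto_at_right_sequentially)
    show "(0::real) < \<delta> / 4" using \<delta> by simp
    fix s :: "nat \<Rightarrow> real" assume s: "\<And>n. 0 < s n" "\<And>n. s n < \<delta> / 4" "s \<longlonglongrightarrow> 0"
    show "(\<lambda>n. \<integral>P. R (s n) P \<partial>\<sigma>) \<longlonglongrightarrow> (\<integral>P. R 0 P \<partial>\<sigma>)"
    proof (rule integral_dominated_convergence[where w = W])
      show "AE P in \<sigma>. (\<lambda>n. R (s n) P) \<longlonglongrightarrow> R 0 P"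
        using S(3) AE_not_center
      proof eventually_elim
        case (elim P)
        have Xs: "(\<lambda>n. X (s n)) \<longlonglongrightarrow> N"
          unfolding X_def using s(3) by (auto intro!: tendsto_eq_intros)
        have ev: "\<forall>\<^sub>F n in sequentially. (P, X (s n)) \<in> S \<times> cball N \<epsilon>"
        proof (intro always_eventually allI SigmaI Xc)
          show "\<bar>s n\<bar> \<le> \<epsilon>" for n using s(1,2)[of n] \<delta> by linarith
        qed (use elim in auto)
        have "(\<lambda>n. (\<lambda>(P, M). a P M) (P, X (s n))) \<longlonglongrightarrow> (\<lambda>(P, M). a P M) (P, N)"
          using elim \<open>\<epsilon> > 0\<close> ev by (intro continuous_on_tendsto_compose[OF cont(1)] tendsto_intros Xs) auto
        then have "(\<lambda>n. a P (X (s n))) \<longlonglongrightarrow> a P N" by simp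
        moreover have "(\<lambda>n. (\<lambda>(P, M). b P M) (P, X (s n))) \<longlonglongrightarrow> (\<lambda>(P, M). b P M) (P, N)"
          using elim \<open>\<epsilon> > 0\<close> ev by (intro continuous_on_tendsto_compose[OF cont(2)] tendsto_intros Xs) auto
        then have "(\<lambda>n. b P (X (s n))) \<longlonglongrightarrow> b P N" by simp
        ultimately show ?case
          unfolding R_def X0 using elim by (intro tendsto_intros Xs) auto
      qed
      show "AE P in \<sigma>. norm (R (s n) P) \<le> W P" for n
        using s(1,2)[of n] by (intro Rb') auto
    qed (use W in auto)
  qed
  have Hb: "\<bar>H h P\<bar> \<le> A * sqrt 2 ^ 3" if "0 < h" "h < \<delta> / 4" "P \<in> S" for h P
  proof -
    have c: "X h \<in> cball N \<epsilon>" using that \<delta> by (intro Xc) auto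
    define q where "q = sqrt ((dist N P)\<^sup>2 + h\<^sup>2)"
    have q0: "q > 0" using that by (simp add: q_def add_nonneg_pos)
    have "q\<^sup>2 / 2 \<le> (dist P (X h))\<^sup>2" using lower[of P h] that by (simp add: q_def)
    then have "q\<^sup>2 \<le> (sqrt 2 * dist P (X h))\<^sup>2" by (simp add: power_mult_distrib)
    then have "q \<le> sqrt 2 * dist P (X h)" by (rule power2_le_imp_le) simp
    moreover from this q0 have "dist P (X h) > 0" by (smt (verit) mult_nonneg_nonpos real_sqrt_ge_zero zero_le_dist)
    ultimately have "q / dist P (X h) \<le> sqrt 2" by (simp add: pos_divide_le_eq)
    then have "(q / dist P (X h)) ^ 3 \<le> sqrt 2 ^ 3" using q0 by (intro power_mono) auto
    then show ?thesis
      unfolding H_def q_def[symmetric] abs_mult using A[OF that(3) c] A0 q0 by (intro mult_mono) (auto simp: power_abs)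
  qed
  have Hlim: "((\<lambda>(h, P). H h P) \<longlongrightarrow> a N N) (at (0, N) within {0<..} \<times> S)"
  proof -
    let ?F = "at (0::real, N) within {0<..} \<times> S"
    have lim: "(fst \<longlongrightarrow> 0) ?F" "(snd \<longlongrightarrow> N) ?F"
      using tendsto_fst[OF tendsto_ident_at[of "(0::real, N)" "{0<..} \<times> S"]]
        tendsto_snd[OF tendsto_ident_at[of "(0::real, N)" "{0<..} \<times> S"]] by simp_all
    have in_set: "\<forall>\<^sub>F x in ?F. x \<in> {0<..} \<times> S" by (auto simp: eventually_at_filter)
    have Xl: "((\<lambda>x. X (fst x)) \<longlongrightarrow> N) ?F"
      unfolding X_def using lim by (auto intro!: tendsto_eq_intros)
    have ev1: "\<forall>\<^sub>F x in ?F. dist (fst x) 0 < \<epsilon>" using lim(1) \<open>\<epsilon> > 0\<close> by (rule tendstoD)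
    have ev2: "\<forall>\<^sub>F x in ?F. dist (snd x) N < \<epsilon>" using lim(2) \<open>\<epsilon> > 0\<close> by (rule tendstoD)
    have al: "((\<lambda>x. (\<lambda>(P, M). a P M) (snd x, X (fst x))) \<longlongrightarrow> (\<lambda>(P, M). a P M) (N, N)) ?F"
    proof (rule continuous_on_tendsto_compose[OF cont(1)])
      show "((\<lambda>x. (snd x, X (fst x))) \<longlongrightarrow> (N, N)) ?F" using lim Xl by (intro tendsto_intros)
      show "\<forall>\<^sub>F x in ?F. (snd x, X (fst x)) \<in> S \<times> cball N \<epsilon>"
        using in_set ev1 by eventually_elim (auto simp: dX dist_real_def)
    qed (use S \<open>\<epsilon> > 0\<close> in auto)
    \<comment> \<open>The joint limit of \<open>H\<close> is reduced to this ratio of squared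
      distances, whose deviation from 1 is the relative error bounded by
      \<open>ratio\<close>.\<close>
    define Q where "Q = (\<lambda>x. (dist (snd x) (X (fst x)))\<^sup>2 / ((dist N (snd x))\<^sup>2 + (fst x)\<^sup>2))"
    have "((\<lambda>x. Q x - 1) \<longlongrightarrow> 0) ?F"
    proof (rule Lim_null_comparison)
      show "\<forall>\<^sub>F x in ?F. norm (Q x - 1) \<le> C' * dist N (snd x) powr l"
        using in_set ev2
      proof eventually_elim
        case (elim x)
        define D where "D = (dist N (snd x))\<^sup>2 + (fst x)\<^sup>2"
        have D: "D > 0" using elim by (auto simp: D_def add_nonneg_pos)
        have "\<bar>(dist (snd x) (X (fst x)))\<^sup>2 - D\<bar> \<le> C' * dist N (snd x) powr l * D"
          unfolding D_def using elim by (intro ratio) (auto simp: dist_commute)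
        moreover have "Q x - 1 = ((dist (snd x) (X (fst x)))\<^sup>2 - D) / D"
          using D by (simp add: Q_def D_def[symmetric] diff_divide_distrib)
        ultimately show ?case using D by (simp add: abs_divide pos_divide_le_eq)
      qed
      have "((\<lambda>x. dist N (snd x) powr l) \<longlongrightarrow> 0) ?F"
        using l lim(2) by (intro tendsto_zero_powrI[where b = l]) (auto intro!: tendsto_eq_intros)
      then show "((\<lambda>x. C' * dist N (snd x) powr l) \<longlongrightarrow> 0) ?F" by (rule tendsto_mult_right_zero)
    qed
    from tendsto_add[OF this tendsto_const[of 1]] have "(Q \<longlongrightarrow> 1) ?F" by simp
    then have "((\<lambda>x. (1 / sqrt (Q x)) ^ 3) \<longlongrightarrow> (1 / sqrt 1) ^ 3) ?F"
      by (intro tendsto_intros) auto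
    from tendsto_mult[OF al this]
    have "((\<lambda>x. a (snd x) (X (fst x)) * (1 / sqrt (Q x)) ^ 3) \<longlongrightarrow> a N N) ?F" by simp
    moreover have "(\<lambda>x. a (snd x) (X (fst x)) * (1 / sqrt (Q x)) ^ 3) = (\<lambda>(h, P). H h P)"
      by (auto simp: fun_eq_iff H_def Q_def real_sqrt_divide)
    ultimately show ?thesis by simp
  qed
  have Hint: "((\<lambda>h. \<integral>P. H h P * poisson_kernel h (dist N P) \<partial>\<sigma>) \<longlongrightarrow> 2 * pi * a N N) (at_right 0)"
    using \<delta> by (intro poisson_kernel_weighted_tendsto[OF _ S(3) _ Hb Hlim, of "\<delta> / 4"]) auto
  have Hi: "integrable \<sigma> (\<lambda>P. H h P * poisson_kernel h (dist N P))" if "0 < h" "h < \<delta> / 4" for h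
    using S(3) by (intro poisson_kernel_weighted_integrable[OF that(1), of _ "A * sqrt 2 ^ 3"]) (auto elim!: eventually_mono Hb[OF that])
  have "((\<lambda>h. (\<integral>P. R h P \<partial>\<sigma>) + e * (\<integral>P. H h P * poisson_kernel h (dist N P) \<partial>\<sigma>)) \<longlongrightarrow> (\<integral>P. R 0 P \<partial>\<sigma>) + e * (2 * pi * a N N)) (at_right 0)"
    by (intro tendsto_intros Rlim Hint)
  moreover have "\<forall>\<^sub>F h in at_right 0. (\<integral>P. R h P \<partial>\<sigma>) + e * (\<integral>P. H h P * poisson_kernel h (dist N P) \<partial>\<sigma>) = (\<integral>P. K P (X h) \<partial>\<sigma>)"
  proof -
    have "\<forall>\<^sub>F h in at_right 0. 0 < h \<and> h < \<delta> / 4"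
      unfolding eventually_at_right_field using \<delta> by (intro exI[of _ "\<delta> / 4"]) auto
    then show ?thesis
    proof eventually_elim
      case (elim h)
      have "(\<integral>P. K P (X h) \<partial>\<sigma>) = (\<integral>P. R h P + e * (H h P * poisson_kernel h (dist N P)) \<partial>\<sigma>)"
        using elim by (simp add: KX)
      also have "\<dots> = (\<integral>P. R h P \<partial>\<sigma>) + e * (\<integral>P. H h P * poisson_kernel h (dist N P) \<partial>\<sigma>)"
        using Ri[of h] Hi[of h] elim by simp
      finally show ?case by simp
    qed
  qed
  ultimately have "((\<lambda>h. \<integral>P. K P (X h) \<partial>\<sigma>) \<longlongrightarrow> (\<integral>P. R 0 P \<partial>\<sigma>) + e * (2 * pi * a N N)) (at_right 0)"
    by (rule Lim_transform_eventually)
  then show "((\<lambda>h. \<integral>P. K P (N - (e * h) *\<^sub>R n) \<partial>\<sigma>) \<longlongrightarrow> 2 * pi * (e * a N N) + (\<integral>P. K P N \<partial>\<sigma>)) (at_right 0)"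
    by (simp add: X_def KR algebra_simps)
qed

end

section \<open>Local geometry of the surface\<close>

lemma one_minus_cos_le: "1 - cos x \<le> x\<^sup>2 / 2" for x :: real
proof -
  have "(sin (x / 2))\<^sup>2 \<le> (x / 2)\<^sup>2"
    using abs_sin_x_le_abs_x[of "x / 2"] unfolding abs_le_square_iff .
  moreover have "cos x = 1 - 2 * (sin (x / 2))\<^sup>2" using cos_double_sin[of "x / 2"] by simp
  ultimately show ?thesis by (simp add: power_divide)
qed

text \<open>A chord is no longer than its arc: |u - v|^2 = 2 (1 - cos \<theta>) \<le> \<theta>^2.
  This turns the Lyapunov condition on angles into a bound on differences of normals.\<close>

lemma norm_diff_le_angle:
  assumes "norm u = 1" "norm v = 1"
  shows "norm (u - v) \<le> angle_between u v"
proof -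
  define c where "c = u \<bullet> v"
  have c: "-1 \<le> c" "c \<le> 1" using Cauchy_Schwarz_ineq2[of u v] assms by (auto simp: c_def abs_le_iff)
  have a: "angle_between u v = arccos c" by (simp add: angle_between_def assms c_def)
  have "(norm (u - v))\<^sup>2 = 2 * (1 - c)"
  proof -
    have "u \<bullet> u = 1" "v \<bullet> v = 1" using assms by (auto simp: dot_square_norm)
    then show ?thesis unfolding power2_norm_eq_inner c_def
      by (simp add: inner_diff_left inner_diff_right inner_commute)
  qed
  also have "\<dots> \<le> (arccos c)\<^sup>2" using one_minus_cos_le[of "arccos c"] c by simp
  finally show ?thesis unfolding a by (rule power2_le_imp_le) (use c arccos_lbound in auto)
qed

text \<open>Around each x only increments from x itself are controlled, a condition that secant
  bounds deliver without any differentiability. The bound passes to a union of adjacent intervals by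
  the triangle inequality, so bisection makes it global.\<close>

lemma lipschitz_on_interval:
  fixes g :: "real \<Rightarrow> 'b::real_normed_vector"
  assumes "a \<le> b" and loc: "\<And>x. x \<in> {a..b} \<Longrightarrow> \<exists>d>0. \<forall>y\<in>{a..b}. \<bar>y - x\<bar> < d \<longrightarrow> norm (g y - g x) \<le> K * \<bar>y - x\<bar>"
  shows "norm (g b - g a) \<le> K * (b - a)"
proof -
  have "a \<le> a \<and> b \<le> b \<longrightarrow> norm (g b - g a) \<le> K * (b - a)"
    using \<open>a \<le> b\<close>
  proof (induction rule: Bolzano[where P = "\<lambda>u v. a \<le> u \<and> v \<le> b \<longrightarrow> norm (g v - g u) \<le> K * (v - u)"])
    case (trans u v w)
    show ?case
    proof
      assume "a \<le> u \<and> w \<le> b"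
      with trans have "norm (g v - g u) \<le> K * (v - u)" "norm (g w - g v) \<le> K * (w - v)" by auto
      moreover have "norm (g w - g u) \<le> norm (g w - g v) + norm (g v - g u)"
        using norm_triangle_ineq[of "g w - g v" "g v - g u"] by simp
      ultimately show "norm (g w - g u) \<le> K * (w - u)" by (simp add: algebra_simps)
    qed
  next
    case (local x)
    then obtain d where d: "d > 0" "\<And>y. y \<in> {a..b} \<Longrightarrow> \<bar>y - x\<bar> < d \<Longrightarrow> norm (g y - g x) \<le> K * \<bar>y - x\<bar>"
      using loc[of x] by auto
    show ?case
    proof (intro exI[of _ d] conjI allI impI)
      fix u v assume uv: "u \<le> x \<and> x \<le> v \<and> v - u < d" and "a \<le> u \<and> v \<le> b"
      then have "norm (g v - g x) \<le> K * (v - x)" "norm (g u - g x) \<le> K * (x - u)"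
        using d(2)[of v] d(2)[of u] local by auto
      moreover have "norm (g v - g u) \<le> norm (g v - g x) + norm (g u - g x)"
        using norm_triangle_ineq4[of "g v - g x" "g u - g x"] by simp
      ultimately show "norm (g v - g u) \<le> K * (v - u)" by (simp add: algebra_simps)
    qed (rule d)
  qed
  then show ?thesis by simp
qed

section \<open>Consequences of the domain assumptions\<close>

context lyapunov_domain
begin

lemma closure_X: "P \<in> closure X \<Longrightarrow> P $ 1 = 0"
proof -
  have "X \<subseteq> {P. P $ 1 = 0}" using region_plane(1) by (rule openin_imp_subset)
  moreover have "closed {P::real^3. P $ 1 = 0}" by (intro closed_Collect_eq continuous_intros)
  ultimately have "closure X \<subseteq> {P. P $ 1 = 0}" by (rule closure_minimal)
  then show "P \<in> closure X \<Longrightarrow> P $ 1 = 0" by auto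
qed

lemma closure_\<Gamma>_nonneg: "P \<in> closure \<Gamma> \<Longrightarrow> P $ 1 \<ge> 0"
proof -
  have "\<Gamma> \<subseteq> {P. P $ 1 \<ge> 0}" using surface_pos by auto
  moreover have "closed {P::real^3. P $ 1 \<ge> 0}" by (intro closed_Collect_le continuous_intros)
  ultimately have "closure \<Gamma> \<subseteq> {P. P $ 1 \<ge> 0}" by (rule closure_minimal)
  then show "P \<in> closure \<Gamma> \<Longrightarrow> P $ 1 \<ge> 0" by auto
qed

text \<open>The closure adds only the edge curve, which lies in the plane x = 0; in the open
  half-space the surface and its closure coincide.\<close>

lemma mem_\<Gamma>: "P \<in> closure \<Gamma> \<Longrightarrow> P $ 1 > 0 \<Longrightarrow> P \<in> \<Gamma>"
proof (rule ccontr)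
  assume "P \<in> closure \<Gamma>" "P $ 1 > 0" "P \<notin> \<Gamma>"
  then have "P \<in> (\<lambda>s. r (s, t0)) ` {s1..s2}" using surface_boundary by blast
  then show False using edge \<open>P $ 1 > 0\<close> by force
qed

lemma \<Gamma>_pos: "P \<in> \<Gamma> \<Longrightarrow> P $ 1 > 0"
  using surface_pos by auto

lemma frontier_\<Gamma>: "P \<in> frontier D \<Longrightarrow> P $ 1 > 0 \<Longrightarrow> P \<in> \<Gamma>"
  using domain_boundary closure_X[of P] mem_\<Gamma>[of P] by auto

lemma ball_pos:
  assumes "dist N P < N $ 1" shows "P $ 1 > 0"
  using component_le_norm_cart[of "N - P" 1] assms by (simp add: dist_norm)

lemma normal_norm: "N \<in> \<Gamma> \<Longrightarrow> norm (\<nu> N) = 1"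
  using outer by (auto simp: outer_unit_normal_def unit_normal_def)

lemma secant_bound:
  assumes "N \<in> \<Gamma>" "\<delta> > 0"
  obtains \<epsilon> where "\<epsilon> > 0" "\<And>Q. Q \<in> \<Gamma> \<Longrightarrow> dist N Q < \<epsilon> \<Longrightarrow> \<bar>\<nu> N \<bullet> (Q - N)\<bar> \<le> \<delta> * dist N Q"
proof -
  have "((\<lambda>Q. (\<nu> N \<bullet> (Q - N)) / norm (Q - N)) \<longlongrightarrow> 0) (at N within \<Gamma>)"
    using outer[OF assms(1)] by (auto simp: outer_unit_normal_def unit_normal_def)
  from tendstoD[OF this assms(2)] obtain \<epsilon> where \<epsilon>: "\<epsilon> > 0"
    "\<And>Q. Q \<in> \<Gamma> \<Longrightarrow> Q \<noteq> N \<Longrightarrow> dist Q N < \<epsilon> \<Longrightarrow> \<bar>(\<nu> N \<bullet> (Q - N)) / norm (Q - N)\<bar> < \<delta>"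
    by (auto simp: eventually_at)
  show ?thesis
  proof (rule that[OF \<epsilon>(1)])
    fix Q assume "Q \<in> \<Gamma>" "dist N Q < \<epsilon>"
    then show "\<bar>\<nu> N \<bullet> (Q - N)\<bar> \<le> \<delta> * dist N Q"
      using \<epsilon>(2)[of Q] assms by (cases "Q = N") (auto simp: dist_commute dist_norm norm_minus_commute abs_divide divide_simps split: if_splits)
  qed
qed

lemma normals_holder:
  obtains A \<mu> where "A > 0" "0 < \<mu>" "\<mu> \<le> 1"
    "\<And>N N'. N \<in> \<Gamma> \<Longrightarrow> N' \<in> \<Gamma> \<Longrightarrow> norm (\<nu> N' - \<nu> N) \<le> A * dist N N' powr \<mu>"
proof -
  obtain A \<mu> where A: "A > 0" "0 < \<mu>" "\<mu> \<le> 1"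
    and *: "\<And>N N'. N \<in> \<Gamma> \<Longrightarrow> N' \<in> \<Gamma> \<Longrightarrow> angle_between (\<nu> N) (\<nu> N') \<le> A * dist N N' powr \<mu>"
    using lyapunov unfolding lyapunov_surface_def by metis
  show ?thesis
  proof (rule that[OF A])
    fix N N' assume "N \<in> \<Gamma>" "N' \<in> \<Gamma>"
    then show "norm (\<nu> N' - \<nu> N) \<le> A * dist N N' powr \<mu>"
      using *[of N N'] norm_diff_le_angle[of "\<nu> N" "\<nu> N'"] normal_norm by (simp add: norm_minus_commute)
  qed
qed

lemma normal_lines:
  obtains d where "d > 0" "\<And>N P Q c. N \<in> \<Gamma> \<Longrightarrow> P \<in> \<Gamma> \<Longrightarrow> Q \<in> \<Gamma> \<Longrightarrow> dist N P < d \<Longrightarrow> dist N Q < d \<Longrightarrow>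
    Q - P = c *\<^sub>R \<nu> N \<Longrightarrow> P = Q"
proof -
  obtain d where d: "d > 0" "\<forall>N\<in>\<Gamma>. \<forall>P\<in>\<Gamma> \<inter> ball N d. \<forall>Q\<in>\<Gamma> \<inter> ball N d. (\<exists>c. Q - P = c *\<^sub>R \<nu> N) \<longrightarrow> P = Q"
    using lyapunov unfolding lyapunov_surface_def by blast
  show ?thesis by (rule that[OF d(1)]) (use d(2) in auto)
qed

text \<open>The cones above and below the tangent plane avoid the boundary of \<^term>\<open>D\<close>, so one lies in
  \<^term>\<open>D\<close> and the other outside of it, and every short normal segment from one to the other meets \<^term>\<open>\<Gamma>\<close>.\<close>

lemma normal_segment_meets:
  assumes N: "N \<in> \<Gamma>" and \<delta>: "0 < \<delta>" "\<delta> \<le> 1/2"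
  obtains \<epsilon> where "\<epsilon> > 0"
    "\<And>y. \<nu> N \<bullet> y = 0 \<Longrightarrow> norm y < \<epsilon> \<Longrightarrow> \<exists>\<tau>. \<bar>\<tau>\<bar> \<le> 2 * \<delta> * norm y \<and> N + y + \<tau> *\<^sub>R \<nu> N \<in> \<Gamma>"
proof -
  define n where "n = \<nu> N"
  have n: "norm n = 1" "n \<bullet> n = 1" using normal_norm[OF N] by (auto simp: n_def dot_square_norm)
  obtain \<epsilon>1 where \<epsilon>1: "\<epsilon>1 > 0" "\<And>Q. Q \<in> \<Gamma> \<Longrightarrow> dist N Q < \<epsilon>1 \<Longrightarrow> \<bar>n \<bullet> (Q - N)\<bar> \<le> \<delta> * dist N Q"
    using secant_bound[OF N \<delta>(1)] unfolding n_def by metis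
  \<comment> \<open>The radius \<open>N $ 1\<close> keeps the ball in the half-space x > 0, where
    every frontier point of \<open>D\<close> lies on \<Gamma>.\<close>
  define \<epsilon> where "\<epsilon> = min \<epsilon>1 (N $ 1)"
  have \<epsilon>: "\<epsilon> > 0" using \<epsilon>1 \<Gamma>_pos[OF N] by (simp add: \<epsilon>_def)
  have out: "\<forall>\<^sub>F h in at_right 0. N - h *\<^sub>R n \<in> D" "\<forall>\<^sub>F h in at_right 0. N + h *\<^sub>R n \<notin> closure D"
    using outer[OF N] by (auto simp: outer_unit_normal_def n_def)
  have "\<forall>\<^sub>F h in at_right 0. 0 < h \<and> h < \<epsilon>"
    unfolding eventually_at_right_field using \<epsilon> by (intro exI[of _ \<epsilon>]) auto
  then have "\<forall>\<^sub>F h in at_right 0. 0 < h \<and> h < \<epsilon> \<and> N - h *\<^sub>R n \<in> D \<and> N + h *\<^sub>R n \<notin> closure D"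
    using out by eventually_elim auto
  then obtain h0 where h0: "0 < h0" "h0 < \<epsilon>" "N - h0 *\<^sub>R n \<in> D" "N + h0 *\<^sub>R n \<notin> closure D"
    using eventually_happens'[OF trivial_limit_at_right_real] by blast
  \<comment> \<open>For e = 1 this is the cone on the side of n, for e = -1 the opposite one. Its
    points violate the secant bound, so it contains no frontier point, and being convex it lies
    entirely inside or entirely outside \<open>D\<close>.\<close>
  define cone where "cone = (\<lambda>e. ball N \<epsilon> \<inter> {Q. \<delta> * norm (Q - N) < e * (n \<bullet> (Q - N))})"
  have conv: "connected (cone e)" for e
  proof -
    have "convex {Q. \<delta> * norm (Q - N) < e * (n \<bullet> (Q - N))}"
    proof (rule convexI)
      fix x y :: "real^3" and u v :: real
      assume *: "x \<in> {Q. \<delta> * norm (Q - N) < e * (n \<bullet> (Q - N))}" "y \<in> {Q. \<delta> * norm (Q - N) < e * (n \<bullet> (Q - N))}"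
        "0 \<le> u" "0 \<le> v" "u + v = 1"
      have eq: "u *\<^sub>R x + v *\<^sub>R y - N = u *\<^sub>R (x - N) + v *\<^sub>R (y - N)"
        using *(5) by (simp add: algebra_simps flip: scaleR_add_left)
      have "\<delta> * norm (u *\<^sub>R x + v *\<^sub>R y - N) \<le> \<delta> * (u * norm (x - N) + v * norm (y - N))"
        unfolding eq using * \<delta> by (intro mult_left_mono norm_triangle_le) auto
      also have "\<dots> = u * (\<delta> * norm (x - N)) + v * (\<delta> * norm (y - N))" by (simp add: algebra_simps)
      also have "\<dots> < u * (e * (n \<bullet> (x - N))) + v * (e * (n \<bullet> (y - N)))"
      proof (cases "u = 0")
        case True
        then show ?thesis using * by auto
      next
        case False
        then have "u * (\<delta> * norm (x - N)) < u * (e * (n \<bullet> (x - N)))" using * by (intro mult_strict_left_mono) auto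
        moreover have "v * (\<delta> * norm (y - N)) \<le> v * (e * (n \<bullet> (y - N)))" using * by (intro mult_left_mono) auto
        ultimately show ?thesis by linarith
      qed
      also have "\<dots> = e * (n \<bullet> (u *\<^sub>R x + v *\<^sub>R y - N))"
        unfolding eq by (simp add: algebra_simps)
      finally show "u *\<^sub>R x + v *\<^sub>R y \<in> {Q. \<delta> * norm (Q - N) < e * (n \<bullet> (Q - N))}" by simp
    qed
    then show ?thesis unfolding cone_def by (intro convex_connected convex_Int) auto
  qed
  have nofr: "cone e \<inter> frontier D = {}" if "\<bar>e\<bar> = 1" for e
  proof (rule ccontr)
    assume "cone e \<inter> frontier D \<noteq> {}"
    then obtain Q where Q: "Q \<in> cone e" "Q \<in> frontier D" by auto
    then have "dist N Q < \<epsilon>" "\<delta> * norm (Q - N) < e * (n \<bullet> (Q - N))" by (auto simp: cone_def)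
    then have "Q \<in> \<Gamma>" using Q ball_pos[of N Q] by (intro frontier_\<Gamma>) (auto simp: \<epsilon>_def)
    then have "\<bar>n \<bullet> (Q - N)\<bar> \<le> \<delta> * norm (Q - N)"
      using \<epsilon>1(2)[of Q] \<open>dist N Q < \<epsilon>\<close> by (simp add: \<epsilon>_def dist_norm norm_minus_commute)
    moreover have "e * (n \<bullet> (Q - N)) \<le> \<bar>n \<bullet> (Q - N)\<bar>"
      using abs_ge_self[of "e * (n \<bullet> (Q - N))"] that by (simp add: abs_mult)
    ultimately show False using \<open>\<delta> * norm (Q - N) < _\<close> by linarith
  qed
  have mem: "N + (e * h0) *\<^sub>R n \<in> cone e" if "e\<^sup>2 = 1" for e
    using h0 n \<delta> that by (simp add: cone_def dist_norm abs_mult power2_eq_square[symmetric] power2_eq_1_iff mult.assoc[symmetric]) auto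
  have down: "cone (-1) \<subseteq> D"
    using connected_Int_frontier[OF conv, of "-1" D] nofr[of "-1"] mem[of "-1"] h0(3) by auto
  have up: "cone 1 \<inter> D = {}"
  proof -
    have "N + h0 *\<^sub>R n \<in> cone 1" "N + h0 *\<^sub>R n \<notin> D" using mem[of 1] h0(4) closure_subset[of D] by auto
    then show ?thesis using connected_Int_frontier[OF conv, of 1 D] nofr[of 1] by auto
  qed
  show ?thesis
  proof (rule that[of "\<epsilon> / 2"])
    show "\<epsilon> / 2 > 0" using \<epsilon> by simp
    fix y assume y: "\<nu> N \<bullet> y = 0" "norm y < \<epsilon> / 2"
    show "\<exists>\<tau>. \<bar>\<tau>\<bar> \<le> 2 * \<delta> * norm y \<and> N + y + \<tau> *\<^sub>R \<nu> N \<in> \<Gamma>"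
    proof (cases "y = 0")
      case True then show ?thesis using N by (intro exI[of _ 0]) auto
    next
      case False
      \<comment> \<open>At this height the distance from N is |y| sqrt (1 + 4 \<delta>^2), which is
        less than 2|y| because \<delta> \<le> 1/2; so \<delta> times the distance is less than the
        height, and the endpoints lie in the two cones.\<close>
      define \<tau>0 where "\<tau>0 = 2 * \<delta> * norm y"
      have \<tau>0: "\<tau>0 > 0" using False \<delta> by (simp add: \<tau>0_def)
      have pt: "N + y + \<tau> *\<^sub>R n \<in> ball N \<epsilon>" if "\<bar>\<tau>\<bar> \<le> \<tau>0" for \<tau>
      proof -
        have "norm (y + \<tau> *\<^sub>R n) \<le> norm y + \<bar>\<tau>\<bar>" using norm_triangle_ineq[of y "\<tau> *\<^sub>R n"] n by simp
        also have "\<dots> \<le> norm y + 1 * norm y"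
          using that \<delta> mult_right_mono[of "2 * \<delta>" 1 "norm y"] by (simp add: \<tau>0_def)
        also have "\<dots> < \<epsilon>" using y by simp
        moreover have "dist N (N + y + \<tau> *\<^sub>R n) = norm (y + \<tau> *\<^sub>R n)"
          by (subst dist_commute) (simp add: dist_norm)
        ultimately show ?thesis by simp
      qed
      have cn: "N + y + (e * \<tau>0) *\<^sub>R n \<in> cone e" if "e\<^sup>2 = 1" for e
      proof -
        have e: "\<bar>e\<bar> = 1" using that by (auto simp: power2_eq_1_iff)
        have q: "N + y + (e * \<tau>0) *\<^sub>R n - N = y + (e * \<tau>0) *\<^sub>R n" by simp
        have "(norm (y + (e * \<tau>0) *\<^sub>R n))\<^sup>2 = (norm y)\<^sup>2 + \<tau>0\<^sup>2"
          unfolding power2_norm_eq_inner using y n that by (simp add: n_def[symmetric] algebra_simps inner_commute power2_eq_square)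
        also have "\<dots> = (norm y)\<^sup>2 * (1 + 4 * \<delta>\<^sup>2)" by (simp add: \<tau>0_def power_mult_distrib algebra_simps)
        also have "\<dots> < (norm y)\<^sup>2 * 2\<^sup>2"
        proof (rule mult_strict_left_mono)
          have "\<delta>\<^sup>2 \<le> (1/2)\<^sup>2" using \<delta> by (intro power_mono) auto
          then show "1 + 4 * \<delta>\<^sup>2 < 2\<^sup>2" by (simp add: power_divide)
        qed (use False in auto)
        finally have "(norm (y + (e * \<tau>0) *\<^sub>R n))\<^sup>2 < (2 * norm y)\<^sup>2" by (simp add: power_mult_distrib mult.commute)
        then have "norm (y + (e * \<tau>0) *\<^sub>R n) < 2 * norm y" by (rule power_less_imp_less_base) simp
        then have "\<delta> * norm (y + (e * \<tau>0) *\<^sub>R n) < \<tau>0" using \<delta> by (simp add: \<tau>0_def)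
        moreover have "e * (n \<bullet> (y + (e * \<tau>0) *\<^sub>R n)) = \<tau>0"
          using y n that by (simp add: n_def[symmetric] inner_add_right power2_eq_square)
        ultimately show ?thesis using pt[of "e * \<tau>0"] e \<tau>0 unfolding cone_def q by (simp add: q abs_mult)
      qed
      define seg where "seg = (\<lambda>\<tau>. N + y + \<tau> *\<^sub>R n) ` {-\<tau>0..\<tau>0}"
      have "connected seg" unfolding seg_def by (intro connected_continuous_image continuous_intros) auto
      moreover have "N + y + (- \<tau>0) *\<^sub>R n \<in> seg \<inter> D" "N + y + \<tau>0 *\<^sub>R n \<in> seg - D"
      proof -
        have "N + y + \<tau> *\<^sub>R n \<in> seg" if "\<bar>\<tau>\<bar> \<le> \<tau>0" for \<tau>
          unfolding seg_def using that by (intro imageI) auto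
        from this[of "- \<tau>0"] this[of \<tau>0] cn[of "-1"] cn[of 1] down up \<tau>0
        show "N + y + (- \<tau>0) *\<^sub>R n \<in> seg \<inter> D" "N + y + \<tau>0 *\<^sub>R n \<in> seg - D" by auto
      qed
      ultimately have "seg \<inter> frontier D \<noteq> {}" by (intro connected_Int_frontier) blast+
      then obtain \<tau> where "\<tau> \<in> {-\<tau>0..\<tau>0}" and \<tau>2: "N + y + \<tau> *\<^sub>R n \<in> frontier D" unfolding seg_def by blast
      then have \<tau>: "\<bar>\<tau>\<bar> \<le> \<tau>0" "N + y + \<tau> *\<^sub>R n \<in> frontier D" by auto
      then have "N + y + \<tau> *\<^sub>R n \<in> \<Gamma>"
        using pt[OF \<tau>(1)] by (intro frontier_\<Gamma> ball_pos) (auto simp: \<epsilon>_def)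
      then show ?thesis using \<tau>(1) by (auto simp: \<tau>0_def n_def)
    qed
  qed
qed

section \<open>The Hoelder bound for secants of the surface\<close>

text \<open>Over the segment from 0 to the projection y of a point \<open>Q0\<close> the surface
  gives a curve \<open>F\<close> whose height \<open>q\<close> starts at 0. At each point of the
  curve the normal differs from the one at N by at most \<beta>, which is of order |y|^\<mu>; so
  \<open>q\<close> has local slope at most 4 \<beta> |y|, and chaining these slopes bounds the
  height of \<open>Q0\<close> by a multiple of |y|^(1 + \<mu>).\<close>

lemma normal_secant_holder:
  assumes N: "N \<in> \<Gamma>"
  obtains C \<mu> \<epsilon> where "0 < \<mu>" "\<mu> \<le> 1" "\<epsilon> > 0"
    "\<And>Q. Q \<in> \<Gamma> \<Longrightarrow> dist N Q < \<epsilon> \<Longrightarrow> \<bar>\<nu> N \<bullet> (Q - N)\<bar> \<le> C * dist N Q powr (1 + \<mu>)"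
proof -
  define n where "n = \<nu> N"
  have n: "norm n = 1" "n \<bullet> n = 1" using normal_norm[OF N] by (auto simp: n_def dot_square_norm)
  obtain A \<mu> where A: "A > 0" "0 < \<mu>" "\<mu> \<le> 1"
    and close: "\<And>Q. Q \<in> \<Gamma> \<Longrightarrow> norm (\<nu> Q - n) \<le> A * dist N Q powr \<mu>"
    using normals_holder N unfolding n_def by metis
  obtain d where d: "d > 0" "\<And>P Q c. P \<in> \<Gamma> \<Longrightarrow> Q \<in> \<Gamma> \<Longrightarrow> dist N P < d \<Longrightarrow> dist N Q < d \<Longrightarrow> Q - P = c *\<^sub>R n \<Longrightarrow> P = Q"
    using normal_lines N unfolding n_def by metis
  obtain \<epsilon>1 where \<epsilon>1: "\<epsilon>1 > 0"
    "\<And>y. n \<bullet> y = 0 \<Longrightarrow> norm y < \<epsilon>1 \<Longrightarrow> \<exists>\<tau>. \<bar>\<tau>\<bar> \<le> 2 * (1/4) * norm y \<and> N + y + \<tau> *\<^sub>R n \<in> \<Gamma>"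
  proof (rule normal_segment_meets[OF N, of "1/4"])
    fix \<epsilon>1 assume "\<epsilon>1 > 0" "\<And>y. \<nu> N \<bullet> y = 0 \<Longrightarrow> norm y < \<epsilon>1 \<Longrightarrow> \<exists>\<tau>. \<bar>\<tau>\<bar> \<le> 2 * (1/4) * norm y \<and> N + y + \<tau> *\<^sub>R \<nu> N \<in> \<Gamma>"
    then show thesis by (intro that[of \<epsilon>1]) (auto simp: n_def)
  qed simp_all
  \<comment> \<open>The three entries keep points in the half-space x > 0, make the projection
    injective, and make the normals differ from n by at most 1/4.\<close>
  define \<epsilon>0 where "\<epsilon>0 = min (min (N $ 1) d) ((1 / (4 * A)) powr (1 / \<mu>))"
  have \<epsilon>0: "\<epsilon>0 > 0" "\<epsilon>0 \<le> N $ 1" "\<epsilon>0 \<le> d" using \<Gamma>_pos[OF N] d A by (auto simp: \<epsilon>0_def)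
  have close4: "norm (\<nu> Q - n) \<le> 1/4" if "Q \<in> \<Gamma>" "dist N Q \<le> \<epsilon>0" for Q
  proof -
    have "dist N Q powr \<mu> \<le> ((1 / (4 * A)) powr (1 / \<mu>)) powr \<mu>"
      using that A by (intro powr_mono2) (auto simp: \<epsilon>0_def)
    also have "\<dots> = 1 / (4 * A)" using A by (simp add: powr_powr)
    finally have "A * dist N Q powr \<mu> \<le> A * (1 / (4 * A))" using A by (intro mult_left_mono) auto
    then show ?thesis using close[OF that(1)] A by simp
  qed
  define pr where "pr = (\<lambda>P. P - N - (n \<bullet> (P - N)) *\<^sub>R n)"
  have pr_n: "n \<bullet> pr P = 0" for P using n by (simp add: pr_def inner_diff_right)
  have pr_eq: "P = N + pr P + (n \<bullet> (P - N)) *\<^sub>R n" for P by (simp add: pr_def)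
  have pr_graph: "pr (N + y + \<tau> *\<^sub>R n) = y" "n \<bullet> (N + y + \<tau> *\<^sub>R n - N) = \<tau>" if "n \<bullet> y = 0" for y \<tau>
    using that n by (auto simp: pr_def inner_add_right)
  have inj: "P = Q" if "P \<in> \<Gamma>" "Q \<in> \<Gamma>" "dist N P < \<epsilon>0" "dist N Q < \<epsilon>0" "pr P = pr Q" for P Q
  proof -
    have "Q - P = (n \<bullet> (Q - N) - n \<bullet> (P - N)) *\<^sub>R n"
      using that(5) by (simp add: pr_def scaleR_diff_left algebra_simps)
    then show ?thesis using d(2)[of P Q] that \<epsilon>0 by auto
  qed
  \<comment> \<open>Compact because the closure is taken; half the radius leaves room for all points
    of \<open>K\<close> to belong to \<Gamma> and to the ball where the projection is
    injective.\<close>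
  define K where "K = closure \<Gamma> \<inter> cball N (\<epsilon>0 / 2)"
  have compK: "compact K"
    unfolding K_def by (metis closed_Int_compact closed_closure compact_cball)
  have K: "P \<in> \<Gamma> \<and> dist N P < \<epsilon>0" if "P \<in> K" for P
    using that ball_pos[of N P] mem_\<Gamma>[of P] \<epsilon>0 by (auto simp: K_def)
  have injK: "inj_on pr K" using inj K by (auto intro!: inj_onI)
  have contpr: "continuous_on K pr" unfolding pr_def by (intro continuous_intros)
  define g where "g = the_inv_into K pr"
  have contg: "continuous_on (pr ` K) g"
    unfolding g_def by (rule continuous_on_inv_into[OF contpr compK injK])
  have norm_pr: "norm (pr P) \<le> dist N P" for P
  proof -
    have "(norm (pr P))\<^sup>2 = (norm (P - N))\<^sup>2 - (n \<bullet> (P - N))\<^sup>2"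
      unfolding pr_def power2_norm_eq_inner using n
      by (simp add: inner_diff_left inner_diff_right inner_commute power2_eq_square)
    then have "(norm (pr P))\<^sup>2 \<le> (dist N P)\<^sup>2" by (simp add: dist_norm norm_minus_commute)
    then show ?thesis by (rule power2_le_imp_le) simp
  qed
  \<comment> \<open>The points found over the segment are within 2|y| of N, so |y| < \<epsilon>0/4
    keeps the whole curve in \<open>K\<close>.\<close>
  define \<epsilon> where "\<epsilon> = min \<epsilon>1 (\<epsilon>0 / 4)"
  have \<epsilon>: "\<epsilon> > 0" using \<epsilon>0 \<epsilon>1 by (simp add: \<epsilon>_def)
  show ?thesis
  proof (rule that[OF A(2,3) \<epsilon>, of "4 * A * 2 powr \<mu>"])
    fix Q0 assume Q0: "Q0 \<in> \<Gamma>" "dist N Q0 < \<epsilon>"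
    define y where "y = pr Q0"
    have ny: "n \<bullet> y = 0" by (simp add: y_def pr_n)
    have y\<epsilon>: "norm y < \<epsilon>" using norm_pr[of Q0] Q0 by (simp add: y_def)
    show "\<bar>\<nu> N \<bullet> (Q0 - N)\<bar> \<le> 4 * A * 2 powr \<mu> * dist N Q0 powr (1 + \<mu>)"
    proof (cases "y = 0")
      case True
      have "pr N = 0" by (simp add: pr_def)
      moreover have "pr Q0 = 0" using True by (simp only: y_def)
      moreover have "dist N Q0 < \<epsilon>0" using Q0(2) \<epsilon>0(1) by (simp add: \<epsilon>_def)
      ultimately have "Q0 = N" using Q0(1) N \<epsilon>0(1) by (intro inj[of Q0 N]) simp_all
      then show ?thesis by simp
    next
      case False
      define F where "F = (\<lambda>\<tau>. g (\<tau> *\<^sub>R y))"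
      have ex: "\<exists>\<tau>'. \<bar>\<tau>'\<bar> \<le> norm y \<and> N + \<tau> *\<^sub>R y + \<tau>' *\<^sub>R n \<in> K" if "\<tau> \<in> {0..1}" for \<tau>
      proof -
        have l: "norm (\<tau> *\<^sub>R y) \<le> norm y" using that by (simp add: mult_left_le_one_le)
        then obtain \<tau>' where \<tau>': "\<bar>\<tau>'\<bar> \<le> 2 * (1/4) * norm (\<tau> *\<^sub>R y)" "N + \<tau> *\<^sub>R y + \<tau>' *\<^sub>R n \<in> \<Gamma>"
          using \<epsilon>1(2)[of "\<tau> *\<^sub>R y"] ny y\<epsilon> by (auto simp: \<epsilon>_def)
        have \<tau>y: "\<bar>\<tau>'\<bar> \<le> norm y" using \<tau>'(1) l norm_ge_zero[of "\<tau> *\<^sub>R y"] by linarith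
        have "dist (N + \<tau> *\<^sub>R y + \<tau>' *\<^sub>R n) N \<le> norm (\<tau> *\<^sub>R y) + \<bar>\<tau>'\<bar>"
          using norm_triangle_ineq[of "\<tau> *\<^sub>R y" "\<tau>' *\<^sub>R n"] n by (simp add: dist_norm)
        also have "\<dots> \<le> \<epsilon>0 / 2" using \<tau>y l y\<epsilon> by (simp add: \<epsilon>_def)
        finally show ?thesis using \<tau>'(2) \<tau>y closure_subset[of \<Gamma>] by (auto simp: K_def dist_commute)
      qed
      have F: "F \<tau> \<in> K" "pr (F \<tau>) = \<tau> *\<^sub>R y" "\<tau> *\<^sub>R y \<in> pr ` K" if "\<tau> \<in> {0..1}" for \<tau>
      proof -
        obtain \<tau>' where \<tau>': "N + \<tau> *\<^sub>R y + \<tau>' *\<^sub>R n \<in> K" using ex[OF \<open>\<tau> \<in> {0..1}\<close>] by auto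
        have "\<tau> *\<^sub>R y = pr (N + \<tau> *\<^sub>R y + \<tau>' *\<^sub>R n)" using pr_graph(1)[of "\<tau> *\<^sub>R y"] ny by simp
        then show *: "\<tau> *\<^sub>R y \<in> pr ` K" using \<tau>' by blast
        show "F \<tau> \<in> K" unfolding F_def g_def by (rule the_inv_into_into[OF injK * subset_refl])
        show "pr (F \<tau>) = \<tau> *\<^sub>R y" unfolding F_def g_def by (rule f_the_inv_into_f[OF injK *])
      qed
      define q where "q = (\<lambda>\<tau>. n \<bullet> (F \<tau> - N))"
      have Feq: "F \<tau> = N + \<tau> *\<^sub>R y + q \<tau> *\<^sub>R n" if "\<tau> \<in> {0..1}" for \<tau>
        unfolding q_def F(2)[OF that, symmetric] by (rule pr_eq)
      have contF: "continuous_on {0..1} F"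
        unfolding F_def using F(3) by (intro continuous_on_compose2[OF contg] continuous_intros) auto
      have F0: "F 0 = N"
      proof (rule inj[OF _ N])
        show "pr (F 0) = pr N" using F(2)[of 0] by (simp add: pr_def)
      qed (use K[OF F(1)[of 0]] \<epsilon>0(1) in auto)
      have F1: "F 1 = Q0"
      proof (rule inj[OF _ Q0(1)])
        show "pr (F 1) = pr Q0" using F(2)[of 1] by (simp add: y_def)
        show "dist N Q0 < \<epsilon>0" using Q0(2) \<epsilon>0(1) by (simp add: \<epsilon>_def)
      qed (use K[OF F(1)[of 1]] in auto)
      \<comment> \<open>The curve stays within 2|y| of N, since its height is at most |y|; so
        \<beta> bounds the deviation of its normals from n.\<close>
      define \<beta> where "\<beta> = A * (2 * norm y) powr \<mu>"
      have \<beta>: "\<beta> > 0" using A False by (simp add: \<beta>_def)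
      have qy: "\<bar>q \<tau>\<bar> \<le> norm y" if \<tau>: "\<tau> \<in> {0..1}" for \<tau>
      proof -
        obtain \<tau>' where \<tau>': "\<bar>\<tau>'\<bar> \<le> norm y" "N + \<tau> *\<^sub>R y + \<tau>' *\<^sub>R n \<in> K" using ex[OF \<tau>] by auto
        have "F \<tau> = N + \<tau> *\<^sub>R y + \<tau>' *\<^sub>R n"
          using \<tau>'(2) F(1,2)[OF \<tau>] pr_graph(1)[of "\<tau> *\<^sub>R y"] ny by (rule_tac inj_onD[OF injK]) simp_all
        then show ?thesis using \<tau>'(1) pr_graph(2)[of "\<tau> *\<^sub>R y" \<tau>'] ny by (simp add: q_def)
      qed
      have close\<beta>: "norm (\<nu> (F \<tau>) - n) \<le> \<beta>" if "\<tau> \<in> {0..1}" for \<tau>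
      proof -
        have l: "norm (\<tau> *\<^sub>R y) \<le> norm y" using that by (simp add: mult_left_le_one_le)
        have "dist (F \<tau>) N \<le> norm (\<tau> *\<^sub>R y) + \<bar>q \<tau>\<bar>"
          unfolding Feq[OF that] using norm_triangle_ineq[of "\<tau> *\<^sub>R y" "q \<tau> *\<^sub>R n"] n by (simp add: dist_norm)
        also have "\<dots> \<le> 2 * norm y" using qy[OF that] l by simp
        finally have "A * dist N (F \<tau>) powr \<mu> \<le> \<beta>"
          unfolding \<beta>_def using A by (intro mult_left_mono powr_mono2) (auto simp: dist_commute)
        then show ?thesis using close[of "F \<tau>"] K F that by fastforce
      qed
      have "norm (q 1 - q 0) \<le> (4 * \<beta> * norm y) * (1 - 0)"
      proof (rule lipschitz_on_interval)
        fix x :: real assume x: "x \<in> {0..1}"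
        define Q where "Q = F x"
        have Q: "Q \<in> \<Gamma>" "dist N Q < \<epsilon>0" using K[OF F(1)[OF x]] by (auto simp: Q_def)
        \<comment> \<open>Tolerance of the secant bound at Q: at most \<beta> to preserve the order
          of the slope, at most 1/4 so that its share of |k| is absorbed by 3/4 |k| on the left.
          What remains is 1/2 |k| \<le> 2 \<beta> |y| |w|.\<close>
        define \<beta>' where "\<beta>' = min \<beta> (1/4)"
        have \<beta>': "\<beta>' > 0" using \<beta> by (simp add: \<beta>'_def)
        obtain \<eta> where \<eta>: "\<eta> > 0" "\<And>P. P \<in> \<Gamma> \<Longrightarrow> dist Q P < \<eta> \<Longrightarrow> \<bar>\<nu> Q \<bullet> (P - Q)\<bar> \<le> \<beta>' * dist Q P"
          using secant_bound[OF Q(1) \<beta>'] by metis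
        obtain \<delta> where \<delta>: "\<delta> > 0" "\<And>z. z \<in> {0..1} \<Longrightarrow> dist z x < \<delta> \<Longrightarrow> dist (F z) (F x) < \<eta>"
          using contF x \<eta>(1) unfolding continuous_on_iff by metis
        have \<nu>n: "\<nu> Q \<bullet> n \<ge> 3/4"
        proof -
          have "\<nu> Q \<bullet> n = 1 + (\<nu> Q - n) \<bullet> n" using n by (simp add: inner_diff_left)
          moreover have "\<bar>(\<nu> Q - n) \<bullet> n\<bar> \<le> 1/4"
            using Cauchy_Schwarz_ineq2[of "\<nu> Q - n" n] close4[OF Q(1)] Q(2) n by simp
          ultimately show ?thesis by linarith
        qed
        have \<nu>y: "\<bar>\<nu> Q \<bullet> y\<bar> \<le> \<beta> * norm y"
        proof -
          have "\<nu> Q \<bullet> y = (\<nu> Q - n) \<bullet> y" using ny by (simp add: inner_diff_left)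
          also have "\<bar>\<dots>\<bar> \<le> norm (\<nu> Q - n) * norm y" by (rule Cauchy_Schwarz_ineq2)
          also have "\<dots> \<le> \<beta> * norm y" using close\<beta>[OF x] by (intro mult_right_mono) (auto simp: Q_def)
          finally show ?thesis .
        qed
        show "\<exists>d>0. \<forall>z\<in>{0..1}. \<bar>z - x\<bar> < d \<longrightarrow> norm (q z - q x) \<le> 4 * \<beta> * norm y * \<bar>z - x\<bar>"
        proof (intro exI[of _ \<delta>] conjI ballI impI)
          fix z :: real assume z: "z \<in> {0..1}" "\<bar>z - x\<bar> < \<delta>"
          define k w where "k = q z - q x" and "w = z - x"
          have "F z \<in> \<Gamma>" using K F z by blast
          moreover have "dist Q (F z) < \<eta>" using \<delta>(2)[OF z(1)] z(2) by (simp add: dist_real_def Q_def dist_commute)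
          ultimately have "\<bar>\<nu> Q \<bullet> (F z - Q)\<bar> \<le> \<beta>' * dist Q (F z)" by (rule \<eta>(2))
          also have Fd: "F z - Q = w *\<^sub>R y + k *\<^sub>R n"
            unfolding Q_def Feq[OF z(1)] Feq[OF x] k_def w_def by (simp add: algebra_simps)
          also have "dist Q (F z) = norm (w *\<^sub>R y + k *\<^sub>R n)"
            by (subst dist_commute) (simp only: dist_norm Fd)
          also have "\<dots> \<le> \<bar>w\<bar> * norm y + \<bar>k\<bar>"
            using norm_triangle_ineq[of "w *\<^sub>R y" "k *\<^sub>R n"] n by simp
          finally have 1: "\<bar>\<nu> Q \<bullet> (w *\<^sub>R y + k *\<^sub>R n)\<bar> \<le> \<beta>' * (\<bar>w\<bar> * norm y + \<bar>k\<bar>)"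
            using \<beta>' by (simp add: mult_left_mono)
          have "k * (\<nu> Q \<bullet> n) = \<nu> Q \<bullet> (w *\<^sub>R y + k *\<^sub>R n) - w * (\<nu> Q \<bullet> y)"
            by (simp add: inner_add_right)
          then have "\<bar>k\<bar> * \<bar>\<nu> Q \<bullet> n\<bar> \<le> \<bar>\<nu> Q \<bullet> (w *\<^sub>R y + k *\<^sub>R n)\<bar> + \<bar>w\<bar> * \<bar>\<nu> Q \<bullet> y\<bar>"
            by (metis abs_mult abs_triangle_ineq4)
          also have "\<dots> \<le> \<beta>' * (\<bar>w\<bar> * norm y + \<bar>k\<bar>) + \<bar>w\<bar> * (\<beta> * norm y)"
            using 1 \<nu>y by (intro add_mono mult_left_mono) auto
          also have "\<dots> \<le> \<beta> * (\<bar>w\<bar> * norm y) + 1/4 * \<bar>k\<bar> + \<bar>w\<bar> * (\<beta> * norm y)"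
          proof -
            have "\<beta>' * (\<bar>w\<bar> * norm y) \<le> \<beta> * (\<bar>w\<bar> * norm y)" by (intro mult_right_mono) (auto simp: \<beta>'_def)
            moreover have "\<beta>' * \<bar>k\<bar> \<le> 1/4 * \<bar>k\<bar>" by (intro mult_right_mono) (auto simp: \<beta>'_def)
            ultimately show ?thesis by (simp add: distrib_left)
          qed
          finally have 2: "\<bar>k\<bar> * \<bar>\<nu> Q \<bullet> n\<bar> \<le> 2 * (\<beta> * norm y * \<bar>w\<bar>) + 1/4 * \<bar>k\<bar>" by (simp add: mult_ac)
          have "\<bar>k\<bar> * (3/4) \<le> \<bar>k\<bar> * \<bar>\<nu> Q \<bullet> n\<bar>" using \<nu>n by (intro mult_left_mono) auto
          with 2 have "\<bar>k\<bar> \<le> 4 * (\<beta> * norm y * \<bar>w\<bar>)" by linarith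
          then show "norm (q z - q x) \<le> 4 * \<beta> * norm y * \<bar>z - x\<bar>" by (simp add: k_def w_def mult_ac)
        qed (rule \<delta>)
      qed simp
      moreover have "q 0 = 0" "q 1 = n \<bullet> (Q0 - N)" by (simp_all add: q_def F0 F1)
      ultimately have "\<bar>n \<bullet> (Q0 - N)\<bar> \<le> 4 * \<beta> * norm y" by simp
      also have "\<dots> = 4 * A * 2 powr \<mu> * norm y powr (1 + \<mu>)"
        using False by (simp add: \<beta>_def powr_mult powr_add)
      also have "\<dots> \<le> 4 * A * 2 powr \<mu> * dist N Q0 powr (1 + \<mu>)"
        using A norm_pr[of Q0] by (intro mult_left_mono powr_mono2) (auto simp: y_def)
      finally show ?thesis by (simp add: n_def)
    qed
  qed
qed

end

section \<open>An area formula for plane maps\<close>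

text \<open>The change of variables below is applied to maps of \<open>real^2\<close> into itself,
  while the parameter plane consists of pairs. This isometry carries measures, null sets and
  derivatives across.\<close>

definition pair_of_vec :: "real^2 \<Rightarrow> real \<times> real" where
  "pair_of_vec v = (v $ 1, v $ 2)"

definition vec_of_pair :: "real \<times> real \<Rightarrow> real^2" where
  "vec_of_pair p = vector [fst p, snd p]"

lemma pair_vec_inverse [simp]: "pair_of_vec (vec_of_pair p) = p" "vec_of_pair (pair_of_vec v) = v"
  by (simp_all add: pair_of_vec_def vec_of_pair_def vec_eq_iff forall_2)

lemma bounded_linear_pair_of_vec: "bounded_linear pair_of_vec"
  unfolding pair_of_vec_def[abs_def] by (intro bounded_linear_Pair bounded_linear_vec_nth)

lemma Basis_vec2: "(Basis :: (real^2) set) = {axis 1 1, axis 2 1}"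
  by (auto simp: Basis_vec_def UNIV_2)

lemma dist_vec_of_pair: "norm (vec_of_pair p - vec_of_pair q) = norm (p - q)"
proof -
  have "(norm (vec_of_pair p - vec_of_pair q))\<^sup>2 = (norm (p - q))\<^sup>2"
    unfolding power2_norm_eq_inner
    by (cases p; cases q) (simp add: inner_vec_def sum_2 vec_of_pair_def)
  then show ?thesis by (rule power2_eq_imp_eq) auto
qed

text \<open>Preimages of boxes are boxes with the same side lengths, and the values on boxes
  characterize Lebesgue measure.\<close>

lemma lborel_pair_of_vec: "distr lborel lborel pair_of_vec = (lborel :: (real \<times> real) measure)"
proof (rule lborel_eqI[symmetric])
  have [measurable]: "pair_of_vec \<in> borel \<rightarrow>\<^sub>M borel"
    using bounded_linear_pair_of_vec by (intro borel_measurable_continuous_onI linear_continuous_on)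
  fix l u :: "real \<times> real" assume le: "\<And>b. b \<in> Basis \<Longrightarrow> l \<bullet> b \<le> u \<bullet> b"
  obtain l1 l2 u1 u2 where lu: "l = (l1, l2)" "u = (u1, u2)" by fastforce
  have "(1, 0) \<in> (Basis :: (real \<times> real) set)" "(0, 1) \<in> (Basis :: (real \<times> real) set)" by (auto simp: Basis_prod_def)
  with le lu have le': "l1 \<le> u1" "l2 \<le> u2" by fastforce+
  have "pair_of_vec -` box l u = box (vec_of_pair l) (vec_of_pair u)"
    by (auto simp: lu box_def pair_of_vec_def vec_of_pair_def Basis_vec_def Basis_prod_def inner_axis forall_2)
  then have "emeasure (distr lborel lborel pair_of_vec) (box l u) = emeasure lborel (box (vec_of_pair l) (vec_of_pair u))"
    by (simp add: emeasure_distr)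
  also have "\<dots> = ennreal (\<Prod>b\<in>Basis. (vec_of_pair u - vec_of_pair l) \<bullet> b)"
    using le' by (intro emeasure_lborel_box) (auto simp: lu vec_of_pair_def Basis_vec2 inner_axis)
  also have "(\<Prod>b\<in>Basis. (vec_of_pair u - vec_of_pair l) \<bullet> b) = (u1 - l1) * (u2 - l2)"
  proof -
    have "axis 1 (1::real) \<noteq> (axis 2 1 :: real^2)" by (simp add: axis_eq_axis)
    then show ?thesis unfolding Basis_vec2 by (simp add: inner_axis lu vec_of_pair_def)
  qed
  also have "(u1 - l1) * (u2 - l2) = (\<Prod>b\<in>Basis. (u - l) \<bullet> b)"
  proof -
    have *: "(Basis :: (real \<times> real) set) = {(1, 0), (0, 1)}" by (auto simp: Basis_prod_def)
    show ?thesis unfolding * by (simp add: lu)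
  qed
  finally show "emeasure (distr lborel lborel pair_of_vec) (box l u) = (\<Prod>b\<in>Basis. (u - l) \<bullet> b)" .
qed simp

text \<open>The set A splits into three pieces. Where J is nonzero and off E the map is injective
  and the change of variables applies; where J = 0 the image is null by Sard's theorem; the image of
  the part in E is null because the map is Lipschitz. In the application E consists of the multiply
  covered parameters.\<close>

lemma area_formula_plane:
  fixes \<Psi> :: "real \<times> real \<Rightarrow> real^2" and a b :: "real \<times> real \<Rightarrow> real^2"
  defines "J \<equiv> \<lambda>p. \<bar>a p $ 1 * b p $ 2 - a p $ 2 * b p $ 1\<bar>"
  assumes A: "A \<in> sets borel"
    and deriv: "\<And>p. p \<in> A \<Longrightarrow> (\<Psi> has_derivative (\<lambda>(x, y). x *\<^sub>R a p + y *\<^sub>R b p)) (at p within A)"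
    and int: "set_integrable lborel A J"
    and lips: "\<And>p q. p \<in> A \<Longrightarrow> q \<in> A \<Longrightarrow> norm (\<Psi> p - \<Psi> q) \<le> L * norm (p - q)"
    and E: "negligible E"
    and inj: "inj_on \<Psi> {p \<in> A - E. J p \<noteq> 0}"
  shows "\<Psi> ` A \<in> lmeasurable" "measure lebesgue (\<Psi> ` A) = (LINT p:A|lborel. J p)"
proof -
  let ?T = pair_of_vec
  have T [measurable]: "?T \<in> borel \<rightarrow>\<^sub>M borel"
    using bounded_linear_pair_of_vec by (intro borel_measurable_continuous_onI linear_continuous_on)
  define f where "f = (\<lambda>v. \<Psi> (?T v))"
  define f' where "f' = (\<lambda>v w :: real^2. w $ 1 *\<^sub>R a (?T v) + w $ 2 *\<^sub>R b (?T v))"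
  have det: "\<bar>det (matrix (f' v))\<bar> = J (?T v)" for v
    by (simp add: f'_def J_def matrix_def det_2 axis_def mult.commute)
  define A2 E2 where "A2 = ?T -` A" and "E2 = ?T -` E"
  have TA: "?T ` A2 = A"
  proof
    show "A \<subseteq> ?T ` A2"
    proof
      fix p assume "p \<in> A"
      then show "p \<in> ?T ` A2" by (intro image_eqI[of _ _ "vec_of_pair p"]) (auto simp: A2_def)
    qed
  qed (auto simp: A2_def)
  have df: "(f has_derivative f' v) (at v within A2)" if "v \<in> A2" for v
  proof -
    have "(?T has_derivative ?T) (at v within A2)"
      using bounded_linear_pair_of_vec by (rule bounded_linear_imp_has_derivative)
    moreover have "(\<Psi> has_derivative (\<lambda>(x, y). x *\<^sub>R a (?T v) + y *\<^sub>R b (?T v))) (at (?T v) within ?T ` A2)"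
      unfolding TA using that by (intro deriv) (simp add: A2_def)
    ultimately have "(\<Psi> \<circ> ?T has_derivative (\<lambda>(x, y). x *\<^sub>R a (?T v) + y *\<^sub>R b (?T v)) \<circ> ?T) (at v within A2)"
      by (rule diff_chain_within)
    then show ?thesis by (simp add: f_def f'_def comp_def pair_of_vec_def)
  qed
  have fl: "norm (f v - f w) \<le> L * norm (v - w)" if "v \<in> A2" "w \<in> A2" for v w
  proof -
    have "norm (?T v - ?T w) = norm (v - w)" using dist_vec_of_pair[of "?T v" "?T w"] by simp
    then show ?thesis using lips[of "?T v" "?T w"] that by (simp add: f_def A2_def)
  qed
  have E2: "negligible E2"
  proof -
    have "E2 = vec_of_pair ` E"
      unfolding E2_def by (auto simp: image_iff) (metis pair_vec_inverse(2))
    moreover have "negligible (vec_of_pair ` E)"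
      using E by (intro negligible_locally_Lipschitz_image)
        (auto intro!: exI[of _ UNIV] exI[of _ 1] simp: dist_vec_of_pair)
    ultimately show ?thesis by simp
  qed
  have [measurable]: "(\<lambda>p. indicator A p * J p) \<in> borel_measurable borel"
    using int by (auto simp: set_integrable_def integrable_iff_bounded)
  \<comment> \<open>Lebesgue measurability is what is shown for this set, since \<open>E\<close> is
    negligible but need not be Borel.\<close>
  define G where "G = {v \<in> A2 - E2. J (?T v) \<noteq> 0}"
  have G: "G \<in> sets lebesgue"
  proof -
    have "{v. indicator A (?T v) * J (?T v) \<noteq> 0} \<in> sets borel" by measurable
    then have "{v. indicator A (?T v) * J (?T v) \<noteq> 0} \<in> sets lebesgue" by simp
    moreover have "G = {v. indicator A (?T v) * J (?T v) \<noteq> 0} - E2" by (auto simp: G_def A2_def indicator_def)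
    ultimately show ?thesis using E2 by (auto dest: negligible_imp_sets)
  qed
  define g where "g = (\<lambda>v. indicator A (?T v) * J (?T v))"
  define I where "I = (LINT p:A|lborel. J p)"
  have gi: "integrable lborel g" "(\<integral>v. g v \<partial>lborel) = I"
  proof -
    have "integrable (distr lborel lborel ?T) (\<lambda>p. indicator A p * J p)"
      using int by (simp add: lborel_pair_of_vec set_integrable_def)
    then show "integrable lborel g" unfolding g_def by (subst (asm) integrable_distr_eq) simp_all
    have "I = (\<integral>p. indicator A p * J p \<partial>(distr lborel lborel ?T))"
      by (simp add: lborel_pair_of_vec I_def set_lebesgue_integral_def)
    also have "\<dots> = (\<integral>v. g v \<partial>lborel)" unfolding g_def by (subst integral_distr) simp_all
    finally show "(\<integral>v. g v \<partial>lborel) = I" by simp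
  qed
  have "(g has_integral I) UNIV" using has_integral_integral_lborel[OF gi(1)] gi(2) by simp
  then have "((\<lambda>v. if v \<in> G then \<bar>det (matrix (f' v))\<bar> else 0) has_integral I) UNIV"
    by (rule has_integral_spike[OF E2, rotated]) (auto simp: g_def G_def A2_def det indicator_def)
  then have hi: "((\<lambda>v. \<bar>det (matrix (f' v))\<bar>) has_integral I) G"
    by (simp only: has_integral_restrict_UNIV)
  have GA: "G \<subseteq> A2" by (auto simp: G_def)
  have dG: "\<And>v. v \<in> G \<Longrightarrow> (f has_derivative f' v) (at v within G)"
    using df GA by (blast intro: has_derivative_subset)
  have injG: "inj_on f G"
  proof (rule inj_onI)
    fix v w assume "v \<in> G" "w \<in> G" "f v = f w"
    then have "?T v = ?T w"
      by (intro inj_onD[OF inj]) (simp_all add: f_def G_def A2_def E2_def)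
    then show "v = w" by (metis pair_vec_inverse(2))
  qed
  have mG: "f ` G \<in> lmeasurable" "measure lebesgue (f ` G) = I"
    using measurable_differentiable_image_eq[OF G dG injG] measure_differentiable_image_eq[OF G dG injG]
      hi has_integral_integrable integral_unique by blast+
  define Z where "Z = {v \<in> A2. J (?T v) = 0}"
  have Z: "negligible (f ` Z)"
  proof (rule baby_Sard)
    show "(f has_derivative f' v) (at v within Z)" if "v \<in> Z" for v
      using that df[of v] by (auto simp: Z_def intro: has_derivative_subset)
    show "rank (matrix (f' v)) < CARD(2)" if "v \<in> Z" for v
      using that det[of v] by (simp add: Z_def det_eq_0_rank)
  qed simp
  have EI: "negligible (f ` (A2 \<inter> E2))"
  proof (rule negligible_locally_Lipschitz_image)
    show "negligible (A2 \<inter> E2)" using E2 by (rule negligible_subset) auto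
    show "\<exists>T B. open T \<and> x \<in> T \<and> (\<forall>y\<in>A2 \<inter> E2 \<inter> T. norm (f y - f x) \<le> B * norm (y - x))" if "x \<in> A2 \<inter> E2" for x
      using fl that by (intro exI[of _ UNIV] exI[of _ L]) auto
  qed simp
  have im: "\<Psi> ` A = f ` A2" unfolding f_def TA[symmetric] by (simp add: image_image)
  have "A2 = G \<union> (Z \<union> (A2 \<inter> E2))" by (auto simp: G_def Z_def)
  then have "f ` A2 = f ` G \<union> (f ` Z \<union> f ` (A2 \<inter> E2))" by (metis image_Un)
  then have "f ` G - f ` A2 \<union> (f ` A2 - f ` G) \<subseteq> f ` Z \<union> f ` (A2 \<inter> E2)" by blast
  with negligible_Un[OF Z EI] have neg: "negligible (f ` G - f ` A2 \<union> (f ` A2 - f ` G))"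
    by (rule negligible_subset)
  show "\<Psi> ` A \<in> lmeasurable" "measure lebesgue (\<Psi> ` A) = (LINT p:A|lborel. J p)"
    using lmeasurable_negligible_symdiff[OF mG(1) neg] measure_negligible_symdiff[OF mG(1) neg] mG(2)
    by (simp_all add: im I_def)
qed

section \<open>The surface measure\<close>

text \<open>Taking e2 as the cross product of n and e1 makes the frame positively oriented, so that
  e1 and e2 have cross product n without a sign.\<close>

lemma orthonormal_frame:
  fixes n :: "real^3"
  assumes "norm n = 1"
  obtains e1 e2 where "norm e1 = 1" "norm e2 = 1" "e1 \<bullet> e2 = 0" "e1 \<bullet> n = 0" "e2 \<bullet> n = 0" "cross3 e1 e2 = n"
proof -
  obtain y where y: "y \<noteq> 0" "orthogonal n y"
    using orthogonal_to_vector_exists[of n] by auto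
  define e1 where "e1 = y /\<^sub>R norm y"
  define e2 where "e2 = cross3 n e1"
  have e1: "norm e1 = 1" "e1 \<bullet> n = 0" using y by (auto simp: e1_def orthogonal_def inner_commute)
  have "cross3 e1 e2 = (e1 \<bullet> e1) *\<^sub>R n - (e1 \<bullet> n) *\<^sub>R e1" unfolding e2_def by (rule Lagrange)
  then have "cross3 e1 e2 = n" using e1 by (simp add: dot_square_norm)
  moreover have "e1 \<bullet> e2 = 0" "e2 \<bullet> n = 0" unfolding e2_def by (simp_all add: dot_cross_self)
  moreover have "norm e2 = 1"
  proof -
    have "(norm e2)\<^sup>2 + (n \<bullet> e1)\<^sup>2 = (norm n * norm e1)\<^sup>2" unfolding e2_def by (rule norm_cross_dot)
    then have "(norm e2)\<^sup>2 = 1\<^sup>2" using e1 assms by (simp add: inner_commute)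
    then show ?thesis by (rule power2_eq_imp_eq) auto
  qed
  ultimately show ?thesis using e1 by (intro that)
qed

text \<open>The Binet-Cauchy identity. It expresses the Jacobian determinant of the projected
  parametrization through the area vector \<open>cross3 (rs p) (rt p)\<close>.\<close>

lemma inner_cross3_cross3:
  "cross3 w x \<bullet> cross3 y z = (w \<bullet> y) * (x \<bullet> z) - (w \<bullet> z) * (x \<bullet> y)"
  by (simp add: cross3_simps)

text \<open>If a unit vector is orthogonal to two vectors, then it is parallel to their cross product.\<close>

lemma abs_inner_cross3:
  fixes u v \<nu> n :: "real^3"
  assumes "norm \<nu> = 1" "\<nu> \<bullet> u = 0" "\<nu> \<bullet> v = 0"
  shows "\<bar>n \<bullet> cross3 u v\<bar> = norm (cross3 u v) * \<bar>n \<bullet> \<nu>\<bar>"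
proof -
  define w where "w = cross3 u v"
  have "cross3 \<nu> w = (\<nu> \<bullet> v) *\<^sub>R u - (\<nu> \<bullet> u) *\<^sub>R v" unfolding w_def by (rule Lagrange)
  then have "cross3 \<nu> w = 0" using assms by simp
  then have "cross3 w (cross3 \<nu> w) = 0" by simp
  then have "cross3 \<nu> (cross3 \<nu> w) = 0" using \<open>cross3 \<nu> w = 0\<close> by simp
  then have "(\<nu> \<bullet> w) *\<^sub>R \<nu> - (\<nu> \<bullet> \<nu>) *\<^sub>R w = 0" by (simp only: Lagrange)
  then have w: "w = (\<nu> \<bullet> w) *\<^sub>R \<nu>" using assms(1) by (simp add: dot_square_norm)
  have "norm w = \<bar>\<nu> \<bullet> w\<bar>" by (subst w) (simp add: assms(1))
  moreover have "n \<bullet> w = (\<nu> \<bullet> w) * (n \<bullet> \<nu>)" by (subst w) simp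
  ultimately show ?thesis unfolding w_def[symmetric] by (simp add: abs_mult)
qed

section \<open>Regularity of the parametrization\<close>

context lyapunov_domain
begin

abbreviation "\<Phi> \<equiv> box (s1, t1) (s2, t2)"
abbreviation "\<Phi>c \<equiv> cbox (s1, t1) (s2, t2)"
abbreviation "dens \<equiv> area_density rs rt"

lemma \<Phi>c_eq: "\<Phi>c = {s1..s2} \<times> {t1..t2}" by (simp add: cbox_Pair_eq)

lemma \<Phi>_subset: "\<Phi> \<subseteq> \<Phi>c" by (rule box_subset_cbox)

text \<open>The partial derivatives are bounded on the compact rectangle; two coordinate segments
  join q to p, and each contributes at most B |p - q|.\<close>

lemma r_lipschitz:
  obtains L where "L \<ge> 0" "\<And>p q. p \<in> \<Phi>c \<Longrightarrow> q \<in> \<Phi>c \<Longrightarrow> norm (r p - r q) \<le> L * norm (p - q)"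
proof -
  have "bounded (rs ` \<Phi>c)" "bounded (rt ` \<Phi>c)"
    using cont_rs cont_rt by (auto intro!: compact_imp_bounded compact_continuous_image compact_cbox)
  then obtain B1 B2 where "\<And>p. p \<in> \<Phi>c \<Longrightarrow> norm (rs p) \<le> B1" "\<And>p. p \<in> \<Phi>c \<Longrightarrow> norm (rt p) \<le> B2"
    unfolding bounded_iff by blast
  then obtain B where B: "B \<ge> 0" "\<And>p. p \<in> \<Phi>c \<Longrightarrow> norm (rs p) \<le> B" "\<And>p. p \<in> \<Phi>c \<Longrightarrow> norm (rt p) \<le> B"
    by (metis linorder_le_cases max.coboundedI1 max.coboundedI2 max.cobounded2 le_max_iff_disj)
  have S: "norm (r (s, t) - r (s', t)) \<le> B * \<bar>s - s'\<bar>" if "s \<in> {s1..s2}" "s' \<in> {s1..s2}" "t \<in> {t1..t2}" for s s' t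
  proof -
    have "norm (r (s, t) - r (s', t)) \<le> B * norm (s - s')"
    proof (rule differentiable_bound[of "{s1..s2}" "\<lambda>s. r (s, t)" "\<lambda>s h. h *\<^sub>R rs (s, t)"])
      fix x assume x: "x \<in> {s1..s2}"
      show "((\<lambda>s. r (s, t)) has_derivative (\<lambda>h. h *\<^sub>R rs (x, t))) (at x within {s1..s2})"
        using deriv_s[OF x that(3)] by (simp add: has_vector_derivative_def)
      show "onorm (\<lambda>h. h *\<^sub>R rs (x, t)) \<le> B"
        using B(1) B(2)[of "(x, t)"] x that by (intro onorm_bound) (auto simp: \<Phi>c_eq mult.commute[of B] mult_left_mono)
    qed (use that in auto)
    then show ?thesis by simp
  qed
  have T: "norm (r (s, t) - r (s, t')) \<le> B * \<bar>t - t'\<bar>" if "s \<in> {s1..s2}" "t \<in> {t1..t2}" "t' \<in> {t1..t2}" for s t t'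
  proof -
    have "norm (r (s, t) - r (s, t')) \<le> B * norm (t - t')"
    proof (rule differentiable_bound[of "{t1..t2}" "\<lambda>t. r (s, t)" "\<lambda>t h. h *\<^sub>R rt (s, t)"])
      fix x assume x: "x \<in> {t1..t2}"
      show "((\<lambda>t. r (s, t)) has_derivative (\<lambda>h. h *\<^sub>R rt (s, x))) (at x within {t1..t2})"
        using deriv_t[OF that(1) x] by (simp add: has_vector_derivative_def)
      show "onorm (\<lambda>h. h *\<^sub>R rt (s, x)) \<le> B"
        using B(1) B(3)[of "(s, x)"] x that by (intro onorm_bound) (auto simp: \<Phi>c_eq mult.commute[of B] mult_left_mono)
    qed (use that in auto)
    then show ?thesis by simp
  qed
  show ?thesis
  proof (rule that[of "2 * B"])
    show "0 \<le> 2 * B" using B by simp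
    fix p q assume pq: "p \<in> \<Phi>c" "q \<in> \<Phi>c"
    obtain s t s' t' where st: "p = (s, t)" "q = (s', t')" by fastforce
    have n: "\<bar>s - s'\<bar> \<le> norm (p - q)" "\<bar>t - t'\<bar> \<le> norm (p - q)"
      unfolding st by (auto simp: norm_Pair intro!: real_le_rsqrt)
    have "norm (r p - r q) \<le> norm (r (s, t) - r (s', t)) + norm (r (s', t) - r (s', t'))"
      unfolding st using norm_triangle_ineq[of "r (s, t) - r (s', t)" "r (s', t) - r (s', t')"] by simp
    also have "\<dots> \<le> B * \<bar>s - s'\<bar> + B * \<bar>t - t'\<bar>"
      using pq by (intro add_mono S T) (auto simp: st \<Phi>c_eq)
    also have "\<dots> \<le> B * norm (p - q) + B * norm (p - q)"
      using n B by (intro add_mono mult_left_mono) auto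
    finally show "norm (r p - r q) \<le> 2 * B * norm (p - q)" by simp
  qed
qed

lemma r_continuous: "continuous_on \<Phi>c r"
proof -
  obtain L where "L \<ge> 0" "\<And>p q. p \<in> \<Phi>c \<Longrightarrow> q \<in> \<Phi>c \<Longrightarrow> norm (r p - r q) \<le> L * norm (p - q)"
    using r_lipschitz by metis
  then have "L-lipschitz_on \<Phi>c r" by (intro lipschitz_onI) (auto simp: dist_norm)
  then show ?thesis by (rule lipschitz_on_continuous_on)
qed

lemma compact_closure_\<Gamma>: "compact (closure \<Gamma>)"
  unfolding surface by (intro compact_continuous_image r_continuous compact_cbox)

lemma r_closure: "p \<in> \<Phi>c \<Longrightarrow> r p \<in> closure \<Gamma>" by (simp add: surface)

lemma dens_continuous: "continuous_on \<Phi>c dens"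
  unfolding area_density_def[abs_def] by (intro continuous_on_norm continuous_on_cross cont_rs cont_rt)

lemma dens_nonneg: "dens p \<ge> 0" by (simp add: area_density_def)

text \<open>Existence of both partial derivatives together with continuity of \<open>rt\<close>
  gives the total derivative within the closed rectangle, edges included.\<close>

lemma r_deriv:
  assumes "p \<in> \<Phi>c"
  shows "(r has_derivative (\<lambda>(x, y). x *\<^sub>R rs p + y *\<^sub>R rt p)) (at p within \<Phi>c)"
proof -
  obtain s t where p: "p = (s, t)" by fastforce
  have st: "s \<in> {s1..s2}" "t \<in> {t1..t2}" using assms by (auto simp: p \<Phi>c_eq)
  have "((\<lambda>(x, y). r (x, y)) has_derivative (\<lambda>(tx, ty). tx *\<^sub>R rs (s, t) + blinfun_scaleR_left (rt (s, t)) ty))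
      (at (s, t) within {s1..s2} \<times> {t1..t2})"
  proof (rule has_derivative_partialsI)
    show "((\<lambda>x. r (x, t)) has_derivative (\<lambda>tx. tx *\<^sub>R rs (s, t))) (at s within {s1..s2})"
      using deriv_s[OF st] by (simp add: has_vector_derivative_def)
    show "((\<lambda>y. r (x, y)) has_derivative blinfun_apply (blinfun_scaleR_left (rt (x, y)))) (at y within {t1..t2})"
      if "x \<in> {s1..s2}" "y \<in> {t1..t2}" for x y
      using deriv_t[OF that] by (simp add: has_vector_derivative_def)
    have "continuous_on ({s1..s2} \<times> {t1..t2}) (\<lambda>p. blinfun_scaleR_left (rt p))"
      using cont_rt unfolding \<Phi>c_eq
      by (rule bounded_linear.continuous_on[OF bounded_linear_blinfun_scaleR_left])
    then show "continuous (at (s, t) within {s1..s2} \<times> {t1..t2}) (\<lambda>(x, y). blinfun_scaleR_left (rt (x, y)))"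
      using st by (auto simp: continuous_on_eq_continuous_within case_prod_unfold)
  qed (use st in auto)
  then show ?thesis by (simp add: p \<Phi>c_eq)
qed

text \<open>Normality is a condition on secants of the surface. For a curve on it the Lipschitz
  bound converts secant lengths into parameter differences, so the difference quotients of n . g
  tend both to n . v and to 0.\<close>

lemma normal_tangent_curve:
  assumes N: "g x \<in> \<Gamma>" and g: "(g has_vector_derivative v) (at x)"
    and ev: "\<forall>\<^sub>F y in at x. g y \<in> \<Gamma> \<and> norm (g y - g x) \<le> L * \<bar>y - x\<bar>"
  shows "\<nu> (g x) \<bullet> v = 0"
proof -
  define n where "n = \<nu> (g x)"
  have "((\<lambda>y. n \<bullet> g y) has_vector_derivative n \<bullet> v) (at x)"
    using g by (rule bounded_linear.has_vector_derivative[OF bounded_linear_inner_right])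
  then have lim: "((\<lambda>y. (n \<bullet> g y - n \<bullet> g x) / (y - x)) \<longlongrightarrow> n \<bullet> v) (at x)"
    by (simp add: has_real_derivative_iff_has_vector_derivative[symmetric] has_field_derivative_iff)
  define L' where "L' = \<bar>L\<bar> + 1"
  have L': "L' > 0" "L \<le> L'" by (auto simp: L'_def)
  have gc: "(g \<longlongrightarrow> g x) (at x)"
    using has_vector_derivative_continuous[OF g] by (simp add: continuous_within)
  have "\<bar>n \<bullet> v\<bar> \<le> e" if "e > 0" for e
  proof -
    have "e / L' > 0" using that L' by simp
    obtain \<epsilon> where \<epsilon>: "\<epsilon> > 0" "\<And>Q. Q \<in> \<Gamma> \<Longrightarrow> dist (g x) Q < \<epsilon> \<Longrightarrow> \<bar>n \<bullet> (Q - g x)\<bar> \<le> e / L' * dist (g x) Q"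
      using secant_bound[OF N \<open>e / L' > 0\<close>] unfolding n_def by metis
    have "\<forall>\<^sub>F y in at x. dist (g y) (g x) < \<epsilon>" using gc \<epsilon>(1) by (rule tendstoD)
    moreover have "\<forall>\<^sub>F y in at x. y \<noteq> x" by (simp add: eventually_at_filter)
    ultimately have "\<forall>\<^sub>F y in at x. \<bar>(n \<bullet> g y - n \<bullet> g x) / (y - x)\<bar> \<le> e"
      using ev
    proof eventually_elim
      case (elim y)
      have "\<bar>n \<bullet> (g y - g x)\<bar> \<le> e / L' * dist (g x) (g y)" using elim by (intro \<epsilon>(2)) (auto simp: dist_commute)
      also have "\<dots> \<le> e / L' * (L' * \<bar>y - x\<bar>)"
        using elim that L' order_trans[OF _ mult_right_mono[OF L'(2), of "\<bar>y - x\<bar>"]]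
        by (intro mult_left_mono) (auto simp: dist_norm norm_minus_commute)
      also have "\<dots> = e * \<bar>y - x\<bar>" using L' by simp
      finally show ?case using elim by (simp add: abs_divide inner_diff_right pos_divide_le_eq)
    qed
    then show ?thesis using tendsto_upperbound[OF tendsto_rabs[OF lim]] trivial_limit_at by auto
  qed
  then have "\<bar>n \<bullet> v\<bar> \<le> 0" by (meson dense_ge)
  then show ?thesis by (simp add: n_def)
qed

text \<open>The curves are the coordinate lines through p. Since p is interior, the one-sided
  derivatives are two-sided, and the positive first coordinate keeps nearby points on \<Gamma>
  itself rather than on its edge.\<close>

lemma normal_tangent:
  assumes p: "p \<in> \<Phi>" "r p \<in> \<Gamma>"
  shows "\<nu> (r p) \<bullet> rs p = 0" "\<nu> (r p) \<bullet> rt p = 0"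
proof -
  obtain s t where st: "p = (s, t)" by fastforce
  have s: "s1 < s" "s < s2" and t: "t1 < t" "t < t2"
    using p by (auto simp: st box_def Basis_prod_def)
  obtain L where L: "\<And>p q. p \<in> \<Phi>c \<Longrightarrow> q \<in> \<Phi>c \<Longrightarrow> norm (r p - r q) \<le> L * norm (p - q)"
    using r_lipschitz by metis
  have pos: "r p $ 1 > 0" using \<Gamma>_pos p by auto
  have *: "\<nu> (r p) \<bullet> v = 0"
    if c: "isCont c x" "c x = p" "\<And>y. norm (c y - c x) = \<bar>y - x\<bar>"
      and d: "((\<lambda>y. r (c y)) has_vector_derivative v) (at x)" for c x v
  proof -
    have "(c \<longlongrightarrow> p) (at x)" using c(1,2) by (simp add: isCont_def)
    then have "\<forall>\<^sub>F y in at x. c y \<in> \<Phi>" using p(1) by (rule topological_tendstoD[OF _ open_box])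
    moreover have "((\<lambda>y. r (c y)) \<longlongrightarrow> r p) (at x)"
      using has_vector_derivative_continuous[OF d] c(2) by (simp add: continuous_within)
    then have "\<forall>\<^sub>F y in at x. dist (r (c y)) (r p) < r p $ 1" using pos by (rule tendstoD)
    ultimately have "\<forall>\<^sub>F y in at x. r (c y) \<in> \<Gamma> \<and> norm (r (c y) - r (c x)) \<le> L * \<bar>y - x\<bar>"
    proof eventually_elim
      case (elim y)
      then have "c y \<in> \<Phi>c" "c x \<in> \<Phi>c" using p(1) c(2) \<Phi>_subset by auto
      then show ?case
        using L[of "c y" "c x"] elim c ball_pos[of "r p" "r (c y)"] mem_\<Gamma>[OF r_closure] by (simp add: dist_commute)
    qed
    from normal_tangent_curve[OF _ d this] p c(2) show ?thesis by simp
  qed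
  show "\<nu> (r p) \<bullet> rs p = 0"
    using deriv_s[of s t] s t at_within_Icc_at[of s1 s s2]
    by (intro *[where c = "\<lambda>y. (y, t)" and x = s]) (auto simp: st norm_Pair)
  show "\<nu> (r p) \<bullet> rt p = 0"
    using deriv_t[of s t] s t at_within_Icc_at[of t1 t t2]
    by (intro *[where c = "\<lambda>y. (s, y)" and x = t]) (auto simp: st norm_Pair)
qed

section \<open>The surface measure as an image measure\<close>

text \<open>The parametrization is controlled only on the closed rectangle. Setting it to 0 off the
  open one gives a Borel map on the whole plane; \<open>surface_weight\<close> vanishes there, so
  these values do not contribute.\<close>

definition surface_point :: "real \<times> real \<Rightarrow> real^3" where
  "surface_point p = indicator \<Phi> p *\<^sub>R r p"

definition surface_weight :: "real \<times> real \<Rightarrow> real" where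
  "surface_weight p = indicator \<Phi> p * dens p"

text \<open>Moving the area measure into space makes balls around a point measurable quantities and
  brings the surface into the setting of \<open>density_point\<close>.\<close>

definition surface_measure :: "(real^3) measure" where
  "surface_measure = distr (density lborel surface_weight) borel surface_point"

lemma surface_point_measurable [measurable]: "surface_point \<in> borel_measurable borel"
  unfolding surface_point_def[abs_def]
  by (intro borel_measurable_continuous_on_indicator continuous_on_subset[OF r_continuous \<Phi>_subset]) auto

lemma surface_weight_measurable [measurable]: "surface_weight \<in> borel_measurable borel"
proof -
  have "(\<lambda>p. indicator \<Phi> p *\<^sub>R dens p) \<in> borel_measurable borel"
    by (intro borel_measurable_continuous_on_indicator continuous_on_subset[OF dens_continuous \<Phi>_subset]) auto
  then show ?thesis by (simp add: surface_weight_def[abs_def])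
qed

lemma surface_weight_nonneg [simp]: "surface_weight p \<ge> 0" by (simp add: surface_weight_def dens_nonneg)

lemma surface_weight_integrable: "integrable lborel surface_weight"
proof (rule Bochner_Integration.integrable_bound)
  show "integrable lborel (\<lambda>p. indicator \<Phi>c p *\<^sub>R dens p)"
    by (intro borel_integrable_compact compact_cbox dens_continuous)
  show "AE p in lborel. norm (surface_weight p) \<le> norm (indicator \<Phi>c p *\<^sub>R dens p)"
    using \<Phi>_subset by (intro AE_I2) (auto simp: surface_weight_def indicator_def)
qed simp

lemma sets_surface_measure [simp, measurable_cong]: "sets surface_measure = sets borel" by (simp add: surface_measure_def)

lemma emeasure_surface_measure:
  assumes "B \<in> sets borel"
  shows "emeasure surface_measure B = (\<integral>\<^sup>+p. ennreal (surface_weight p * indicator B (surface_point p)) \<partial>lborel)"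
proof -
  have [measurable]: "surface_point -` B \<in> sets borel" using measurable_sets[OF surface_point_measurable assms] by simp
  have "emeasure surface_measure B = emeasure (density lborel surface_weight) (surface_point -` B)"
    unfolding surface_measure_def using assms by (subst emeasure_distr) auto
  also have "\<dots> = (\<integral>\<^sup>+p. ennreal (surface_weight p) * indicator (surface_point -` B) p \<partial>lborel)"
    by (subst emeasure_density) auto
  also have "\<dots> = (\<integral>\<^sup>+p. ennreal (surface_weight p * indicator B (surface_point p)) \<partial>lborel)"
    by (intro nn_integral_cong) (auto simp: indicator_def)
  finally show ?thesis .
qed

lemma surface_weight_indicator_integrable:
  assumes [measurable]: "B \<in> sets borel"
  shows "integrable lborel (\<lambda>p. surface_weight p * indicator B (surface_point p))"
  by (rule Bochner_Integration.integrable_bound[OF surface_weight_integrable]) (auto simp: indicator_def)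

lemma finite_surface_measure: "finite_measure surface_measure"
proof (rule finite_measureI)
  have "emeasure surface_measure (space surface_measure) = (\<integral>\<^sup>+p. ennreal (surface_weight p) \<partial>lborel)"
    using emeasure_surface_measure[of UNIV] by (simp add: surface_measure_def)
  also have "\<dots> = ennreal (integral\<^sup>L lborel surface_weight)"
    by (intro nn_integral_eq_integral surface_weight_integrable) auto
  finally show "emeasure surface_measure (space surface_measure) \<noteq> \<infinity>" by simp
qed

lemma measure_surface_measure:
  assumes [measurable]: "B \<in> sets borel"
  shows "measure surface_measure B = (\<integral>p. surface_weight p * indicator B (surface_point p) \<partial>lborel)"
proof -
  have "emeasure surface_measure B = ennreal (\<integral>p. surface_weight p * indicator B (surface_point p) \<partial>lborel)"
    unfolding emeasure_surface_measure[OF assms] by (intro nn_integral_eq_integral surface_weight_indicator_integrable) auto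
  then show ?thesis unfolding measure_def by (simp add: integral_nonneg_AE)
qed

lemma AE_surface_measure: "AE P in surface_measure. P \<in> closure \<Gamma>"
proof -
  have "emeasure surface_measure (- closure \<Gamma>) = (\<integral>\<^sup>+p. 0 \<partial>(lborel :: (real \<times> real) measure))"
    unfolding emeasure_surface_measure[OF borel_comp[OF borel_closed[OF closed_closure]]]
    using r_closure \<Phi>_subset
    by (intro nn_integral_cong) (auto simp: surface_weight_def surface_point_def indicator_def)
  then have "- closure \<Gamma> \<in> null_sets surface_measure" by (auto simp: null_sets_def)
  from AE_not_in[OF this] show ?thesis by simp
qed

text \<open>The kernel has no meaningful value at its singularity, so g and f are compared only
  where r p differs from N. The parameters mapped to N have weight 0 almost everywhere, because N
  carries no mass.\<close>

lemma surface_measure_transfer: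
  fixes f :: "real^3 \<Rightarrow> real"
  assumes [measurable]: "f \<in> borel_measurable borel"
    and g: "\<And>p. p \<in> \<Phi> \<Longrightarrow> r p \<noteq> N \<Longrightarrow> g p = f (r p)"
    and null: "emeasure surface_measure {N} = 0"
  shows "surface_integrable \<Phi> rs rt g \<longleftrightarrow> integrable surface_measure f"
    and "surface_integral \<Phi> rs rt g = (\<integral>P. f P \<partial>surface_measure)"
proof -
  have "AE p in lborel. surface_weight p * indicator {N} (surface_point p) = 0"
  proof -
    have "(\<integral>\<^sup>+p. ennreal (surface_weight p * indicator {N} (surface_point p)) \<partial>lborel) = 0"
      using null emeasure_surface_measure[of "{N}"] by simp
    then show ?thesis by (subst (asm) nn_integral_0_iff_AE) (auto simp: indicator_def)
  qed
  then have "AE p in lborel. indicator \<Phi> p *\<^sub>R (g p * dens p) = surface_weight p *\<^sub>R f (surface_point p)"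
    by eventually_elim (use g in \<open>auto simp: surface_weight_def surface_point_def indicator_def split: if_splits\<close>)
  then have ae: "AE p in lebesgue. indicator \<Phi> p *\<^sub>R (g p * dens p) = surface_weight p *\<^sub>R f (surface_point p)"
    by (rule AE_completion)
  have m: "(\<lambda>p. surface_weight p *\<^sub>R f (surface_point p)) \<in> borel_measurable lborel" by measurable
  then have m': "(\<lambda>p. surface_weight p *\<^sub>R f (surface_point p)) \<in> borel_measurable lebesgue" by (rule measurable_completion)
  have mg: "(\<lambda>p. indicator \<Phi> p *\<^sub>R (g p * dens p)) \<in> borel_measurable lebesgue"
    using ae by (intro borel_measurable_AE[OF m']) auto
  have "surface_integrable \<Phi> rs rt g \<longleftrightarrow> integrable lebesgue (\<lambda>p. surface_weight p *\<^sub>R f (surface_point p))"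
    unfolding surface_integrable_def set_integrable_def using ae mg m' by (intro integrable_cong_AE) auto
  also have "\<dots> \<longleftrightarrow> integrable lborel (\<lambda>p. surface_weight p *\<^sub>R f (surface_point p))" using m by (rule integrable_completion)
  also have "\<dots> \<longleftrightarrow> integrable (density lborel surface_weight) (\<lambda>p. f (surface_point p))"
    by (intro integrable_density[symmetric]) auto
  also have "\<dots> \<longleftrightarrow> integrable surface_measure f" unfolding surface_measure_def by (intro integrable_distr_eq[symmetric]) auto
  finally show "surface_integrable \<Phi> rs rt g \<longleftrightarrow> integrable surface_measure f" .
  have "surface_integral \<Phi> rs rt g = (\<integral>p. surface_weight p *\<^sub>R f (surface_point p) \<partial>lebesgue)"
    unfolding surface_integral_def set_lebesgue_integral_def using ae mg m' by (intro integral_cong_AE) auto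
  also have "\<dots> = (\<integral>p. surface_weight p *\<^sub>R f (surface_point p) \<partial>lborel)" using m by (rule integral_completion)
  also have "\<dots> = (\<integral>p. f (surface_point p) \<partial>(density lborel surface_weight))"
    by (intro integral_density[symmetric]) auto
  also have "\<dots> = (\<integral>P. f P \<partial>surface_measure)" unfolding surface_measure_def by (intro integral_distr[symmetric]) auto
  finally show "surface_integral \<Phi> rs rt g = (\<integral>P. f P \<partial>surface_measure)" .
qed

section \<open>Density of the surface measure at a point of the surface\<close>

text \<open>The projection to the tangent plane changes area by the factor |n . \<nu>|, which lies
  between 1 - \<delta> and 1 near N. The projected ball lies in the disc of radius u and covers the
  disc of radius u / sqrt (1 + 4 \<delta>^2) up to a null set.\<close>

lemma surface_measure_cball_bounds:
  assumes N: "N \<in> \<Gamma>" and \<delta>: "0 < \<delta>" "\<delta> \<le> 1/2"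
  shows "\<forall>\<^sub>F u in at_right 0. pi / (1 + 4 * \<delta>\<^sup>2) \<le> measure surface_measure (cball N u) / u\<^sup>2 \<and> measure surface_measure (cball N u) / u\<^sup>2 \<le> pi / (1 - \<delta>)"
proof -
  define n where "n = \<nu> N"
  have n: "norm n = 1" "n \<bullet> n = 1" using normal_norm[OF N] by (auto simp: n_def dot_square_norm)
  obtain e1 e2 where e: "norm e1 = 1" "norm e2 = 1" "e1 \<bullet> e2 = 0" "e1 \<bullet> n = 0" "e2 \<bullet> n = 0" "cross3 e1 e2 = n"
    using orthonormal_frame[OF n(1)] by metis
  have ee: "e1 \<bullet> e1 = 1" "e2 \<bullet> e2 = 1" using e by (auto simp: dot_square_norm)
  obtain A \<mu> where A: "A > 0" "0 < \<mu>" "\<mu> \<le> 1"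
    and close: "\<And>Q. Q \<in> \<Gamma> \<Longrightarrow> norm (\<nu> Q - n) \<le> A * dist N Q powr \<mu>"
    using normals_holder N unfolding n_def by metis
  obtain d where d: "d > 0" "\<And>P Q c. P \<in> \<Gamma> \<Longrightarrow> Q \<in> \<Gamma> \<Longrightarrow> dist N P < d \<Longrightarrow> dist N Q < d \<Longrightarrow> Q - P = c *\<^sub>R n \<Longrightarrow> P = Q"
    using normal_lines N unfolding n_def by metis
  obtain \<epsilon>1 where \<epsilon>1: "\<epsilon>1 > 0"
    "\<And>y. n \<bullet> y = 0 \<Longrightarrow> norm y < \<epsilon>1 \<Longrightarrow> \<exists>\<tau>. \<bar>\<tau>\<bar> \<le> 2 * \<delta> * norm y \<and> N + y + \<tau> *\<^sub>R n \<in> \<Gamma>"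
    using normal_segment_meets[OF N \<delta>] unfolding n_def by metis
  obtain L where L: "L \<ge> 0" "\<And>p q. p \<in> \<Phi>c \<Longrightarrow> q \<in> \<Phi>c \<Longrightarrow> norm (r p - r q) \<le> L * norm (p - q)"
    using r_lipschitz by metis
  \<comment> \<open>The last entry bounds the deviation of the normals from n by \<delta>, hence n .
    \<nu> by 1 - \<delta> from below.\<close>
  define \<epsilon> where "\<epsilon> = min (min (min (N $ 1) d) \<epsilon>1) ((\<delta> / A) powr (1 / \<mu>))"
  have \<epsilon>: "\<epsilon> > 0" "\<epsilon> \<le> N $ 1" "\<epsilon> \<le> d" "\<epsilon> \<le> \<epsilon>1" using \<Gamma>_pos[OF N] d \<epsilon>1 A \<delta> by (auto simp: \<epsilon>_def)
  have near: "1 - \<delta> \<le> n \<bullet> \<nu> Q" "n \<bullet> \<nu> Q \<le> 1" if "Q \<in> \<Gamma>" "dist N Q < \<epsilon>" for Q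
  proof -
    have "dist N Q powr \<mu> \<le> ((\<delta> / A) powr (1 / \<mu>)) powr \<mu>"
      using that A by (intro powr_mono2) (auto simp: \<epsilon>_def)
    also have "\<dots> = \<delta> / A" using A \<delta> by (simp add: powr_powr)
    finally have "A * dist N Q powr \<mu> \<le> A * (\<delta> / A)" using A by (intro mult_left_mono) auto
    then have c: "norm (\<nu> Q - n) \<le> \<delta>" using close[OF that(1)] A by simp
    have "n \<bullet> \<nu> Q = 1 + n \<bullet> (\<nu> Q - n)" using n by (simp add: inner_diff_right)
    moreover have "\<bar>n \<bullet> (\<nu> Q - n)\<bar> \<le> \<delta>"
      using Cauchy_Schwarz_ineq2[of n "\<nu> Q - n"] c n by simp
    ultimately show "1 - \<delta> \<le> n \<bullet> \<nu> Q" by linarith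
    show "n \<bullet> \<nu> Q \<le> 1" using Cauchy_Schwarz_ineq2[of n "\<nu> Q"] normal_norm[OF that(1)] n by simp
  qed
  define \<pi>N where "\<pi>N = (\<lambda>w. vector [e1 \<bullet> w, e2 \<bullet> w] :: real^2)"
  have \<pi>nth: "\<pi>N w $ 1 = e1 \<bullet> w" "\<pi>N w $ 2 = e2 \<bullet> w" for w by (simp_all add: \<pi>N_def)
  have lin: "bounded_linear \<pi>N"
    by (intro linear_linear[THEN iffD2] linearI) (auto simp: vec_eq_iff forall_2 \<pi>nth inner_add_right)
  note linl = bounded_linear.linear[OF lin]
  have normsq: "(norm (z :: real^2))\<^sup>2 = (z $ 1)\<^sup>2 + (z $ 2)\<^sup>2" for z
    unfolding power2_norm_eq_inner by (simp add: inner_vec_def sum_2 power2_eq_square)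
  have \<pi>norm: "norm (\<pi>N w) \<le> norm w" for w
  proof (rule power2_le_imp_le)
    have "0 \<le> (norm (w - (e1 \<bullet> w) *\<^sub>R e1 - (e2 \<bullet> w) *\<^sub>R e2))\<^sup>2" by simp
    also have "\<dots> = (norm w)\<^sup>2 - (e1 \<bullet> w)\<^sup>2 - (e2 \<bullet> w)\<^sup>2"
      unfolding power2_norm_eq_inner using e ee
      by (simp add: inner_diff_left inner_diff_right inner_commute power2_eq_square)
    finally show "(norm (\<pi>N w))\<^sup>2 \<le> (norm w)\<^sup>2" by (simp add: normsq \<pi>nth)
  qed simp
  have \<pi>ker: "w = (n \<bullet> w) *\<^sub>R n" if "\<pi>N w = 0" for w
  proof -
    have "e1 \<bullet> w = 0" "e2 \<bullet> w = 0" using \<pi>nth[of w] that by auto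
    then have "cross3 w n = 0" unfolding e(6)[symmetric] Lagrange by (simp add: inner_commute)
    then have "cross3 n (cross3 w n) = 0" by simp
    then show ?thesis using n by (simp add: Lagrange)
  qed
  define \<Psi> where "\<Psi> = (\<lambda>p. \<pi>N (r p - N))"
  define a b where "a = (\<lambda>p. \<pi>N (rs p))" and "b = (\<lambda>p. \<pi>N (rt p))"
  define J where "J = (\<lambda>p. \<bar>a p $ 1 * b p $ 2 - a p $ 2 * b p $ 1\<bar>)"
  have J: "J p = dens p * \<bar>n \<bullet> \<nu> (r p)\<bar>" if "p \<in> \<Phi>" "r p \<in> \<Gamma>" for p
  proof -
    have "a p $ 1 * b p $ 2 - a p $ 2 * b p $ 1 = cross3 e1 e2 \<bullet> cross3 (rs p) (rt p)"
      unfolding inner_cross3_cross3 by (simp add: a_def b_def \<pi>nth)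
    then have "J p = \<bar>n \<bullet> cross3 (rs p) (rt p)\<bar>" by (simp add: J_def e(6))
    also have "\<dots> = dens p * \<bar>n \<bullet> \<nu> (r p)\<bar>"
      unfolding area_density_def using that by (intro abs_inner_cross3 normal_norm normal_tangent)
    finally show ?thesis .
  qed
  \<comment> \<open>A nonzero Jacobian forces a nonzero area density, so off this null set equal
    projections will imply equal parameters.\<close>
  define E where "E = {p \<in> \<Phi>. dens p \<noteq> 0 \<and> (\<exists>q\<in>\<Phi>. q \<noteq> p \<and> dens q \<noteq> 0 \<and> r q = r p)}"
  have E: "negligible E" using covers_once by (simp add: E_def)
  have \<Psi>lip: "norm (\<Psi> p - \<Psi> q) \<le> L * norm (p - q)" if "p \<in> \<Phi>c" "q \<in> \<Phi>c" for p q
  proof -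
    have "\<Psi> p - \<Psi> q = \<pi>N (r p - r q)"
      unfolding \<Psi>_def using linear_diff[OF linl, of "r p - N" "r q - N"] by simp
    then show ?thesis using \<pi>norm[of "r p - r q"] L(2)[OF that] by simp
  qed
  \<comment> \<open>The closed rectangle covers the surface, while the integral runs over the open
    one; the image of the edges has area zero.\<close>
  have edges: "negligible (\<Psi> ` (\<Phi>c - \<Phi>))"
  proof (rule negligible_locally_Lipschitz_image)
    show "negligible (\<Phi>c - \<Phi>)" using negligible_frontier_interval[of "(s1, t1)" "(s2, t2)"] .
    show "\<exists>T B. open T \<and> x \<in> T \<and> (\<forall>y\<in>(\<Phi>c - \<Phi>) \<inter> T. norm (\<Psi> y - \<Psi> x) \<le> B * norm (y - x))" if "x \<in> \<Phi>c - \<Phi>" for x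
      using \<Psi>lip that by (intro exI[of _ UNIV] exI[of _ L]) auto
  qed simp
  have "\<forall>\<^sub>F u in at_right 0. 0 < u \<and> u < \<epsilon>"
    unfolding eventually_at_right_field using \<epsilon> by (intro exI[of _ \<epsilon>]) auto
  then show ?thesis
  proof eventually_elim
    case (elim u)
    then have u: "0 < u" "u < \<epsilon>" by auto
    define B where "B = {p \<in> \<Phi>. r p \<in> cball N u}"
    have "B = \<Phi> \<inter> surface_point -` cball N u" by (auto simp: B_def surface_point_def)
    moreover have "surface_point -` cball N u \<in> sets borel" using measurable_sets[OF surface_point_measurable, of "cball N u"] by simp
    ultimately have B: "B \<in> sets borel" by auto
    have B\<Phi>: "B \<subseteq> \<Phi>" "B \<subseteq> \<Phi>c" using \<Phi>_subset by (auto simp: B_def)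
    have B\<Gamma>: "r p \<in> \<Gamma>" "dist N (r p) \<le> u" "dist N (r p) < \<epsilon>" if "p \<in> B" for p
    proof -
      show *: "dist N (r p) \<le> u" "dist N (r p) < \<epsilon>" using that u by (auto simp: B_def)
      show "r p \<in> \<Gamma>" using that B\<Phi> * \<epsilon> by (intro mem_\<Gamma> r_closure ball_pos[of N]) auto
    qed
    have JB: "(1 - \<delta>) * dens p \<le> J p" "J p \<le> dens p" if "p \<in> B" for p
    proof -
      have "p \<in> \<Phi>" using that B\<Phi> by auto
      have nb: "1 - \<delta> \<le> \<bar>n \<bullet> \<nu> (r p)\<bar>" "\<bar>n \<bullet> \<nu> (r p)\<bar> \<le> 1"
        using near[of "r p"] B\<Gamma>[OF that] \<delta> by auto
      show "(1 - \<delta>) * dens p \<le> J p" "J p \<le> dens p"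
        unfolding J[OF \<open>p \<in> \<Phi>\<close> B\<Gamma>(1)[OF that]]
        using mult_left_mono[OF nb(1) dens_nonneg[of p]] mult_left_mono[OF nb(2) dens_nonneg[of p]] by (simp_all add: mult.commute)
    qed
    have densB: "set_integrable lborel B dens"
    proof -
      have "set_integrable lborel \<Phi>c dens"
        unfolding set_integrable_def by (intro borel_integrable_compact compact_cbox dens_continuous)
      then show ?thesis by (rule set_integrable_subset) (use B B\<Phi> in simp_all)
    qed
    have mB: "measure surface_measure (cball N u) = (LINT p:B|lborel. dens p)"
      unfolding measure_surface_measure[OF borel_closed[OF closed_cball]] set_lebesgue_integral_def
      by (intro Bochner_Integration.integral_cong) (auto simp: surface_weight_def surface_point_def B_def indicator_def)
    have JBint: "set_integrable lborel B J"
      unfolding set_integrable_def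
    proof (rule Bochner_Integration.integrable_bound[OF densB[unfolded set_integrable_def]])
      have "continuous_on \<Phi>c J"
        unfolding J_def a_def b_def \<pi>nth by (intro continuous_intros cont_rs cont_rt)
      then have "(\<lambda>p. indicator B p *\<^sub>R J p) \<in> borel_measurable borel"
        by (intro borel_measurable_continuous_on_indicator B continuous_on_subset[OF _ B\<Phi>(2)])
      then show "(\<lambda>p. indicator B p *\<^sub>R J p) \<in> borel_measurable lborel" by simp
      show "AE p in lborel. norm (indicator B p *\<^sub>R J p) \<le> norm (indicator B p *\<^sub>R dens p)"
        using JB dens_nonneg by (intro AE_I2) (auto simp: indicator_def J_def)
    qed
    have area: "\<Psi> ` B \<in> lmeasurable" "measure lebesgue (\<Psi> ` B) = (LINT p:B|lborel. J p)"
    proof -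
      have "(\<Psi> has_derivative (\<lambda>(x, y). x *\<^sub>R a p + y *\<^sub>R b p)) (at p within B)" if "p \<in> B" for p
      proof -
        have "(r has_derivative (\<lambda>(x, y). x *\<^sub>R rs p + y *\<^sub>R rt p)) (at p within B)"
          using r_deriv[of p] that B\<Phi> by (blast intro: has_derivative_subset)
        then have "((\<lambda>p. r p - N) has_derivative (\<lambda>(x, y). x *\<^sub>R rs p + y *\<^sub>R rt p)) (at p within B)"
          using has_derivative_diff[OF _ has_derivative_const[of N]] by fastforce
        from bounded_linear.has_derivative[OF lin this]
        show ?thesis
          by (simp add: \<Psi>_def a_def b_def case_prod_unfold linear_add[OF linl] linear_scale[OF linl])
      qed
      moreover have "inj_on \<Psi> {p \<in> B - E. J p \<noteq> 0}"
      proof (rule inj_onI)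
        fix p q assume p: "p \<in> {p \<in> B - E. J p \<noteq> 0}" and q: "q \<in> {p \<in> B - E. J p \<noteq> 0}" and eq: "\<Psi> p = \<Psi> q"
        have "\<pi>N (r q - r p) = \<Psi> q - \<Psi> p"
          unfolding \<Psi>_def using linear_diff[OF linl, of "r q - N" "r p - N"] by simp
        then have "r q - r p = (n \<bullet> (r q - r p)) *\<^sub>R n" using eq by (intro \<pi>ker) simp
        moreover have pq: "p \<in> B" "q \<in> B" "p \<in> \<Phi>" "q \<in> \<Phi>" "p \<notin> E" "J p \<noteq> 0" "J q \<noteq> 0"
          using p q B\<Phi>(1) by blast+
        moreover have "dist N (r p) < d" "dist N (r q) < d" using B\<Gamma>(3)[of p] B\<Gamma>(3)[of q] pq \<epsilon>(3) by linarith+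
        ultimately have "r p = r q" using B\<Gamma>(1) d(2)[of "r p" "r q"] by blast
        moreover have "dens p \<noteq> 0" "dens q \<noteq> 0" using J[OF pq(3) B\<Gamma>(1)] J[OF pq(4) B\<Gamma>(1)] pq by fastforce+
        ultimately show "p = q" using pq unfolding E_def by fastforce
      qed
      ultimately show "\<Psi> ` B \<in> lmeasurable" "measure lebesgue (\<Psi> ` B) = (LINT p:B|lborel. J p)"
        using area_formula_plane[OF B, of \<Psi> a b L E] \<Psi>lip B\<Phi> JBint E unfolding J_def by blast+
    qed
    have upper: "measure lebesgue (\<Psi> ` B) \<le> pi * u\<^sup>2"
    proof -
      have "\<Psi> ` B \<subseteq> cball 0 u"
      proof
        fix z assume "z \<in> \<Psi> ` B"
        then obtain p where p: "p \<in> B" "z = \<pi>N (r p - N)" by (auto simp: \<Psi>_def)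
        have "norm z \<le> norm (r p - N)" unfolding p(2) by (rule \<pi>norm)
        also have "\<dots> \<le> u" using B\<Gamma>(2)[OF p(1)] by (simp add: dist_norm norm_minus_commute)
        finally show "z \<in> cball 0 u" by simp
      qed
      then have "measure lebesgue (\<Psi> ` B) \<le> measure lebesgue (cball (0::real^2) u)"
        using area by (intro measure_mono_fmeasurable) auto
      also have "\<dots> = pi * u\<^sup>2" using u by (simp add: content_cball unit_ball_vol_2)
      finally show ?thesis .
    qed
    \<comment> \<open>A point of height at most 2 \<delta> |y| over a tangent vector y with |y| <
      u/k is at distance less than u from N.\<close>
    define k where "k = sqrt (1 + 4 * \<delta>\<^sup>2)"
    have k: "k > 0" "k\<^sup>2 = 1 + 4 * \<delta>\<^sup>2" "k \<ge> 1" by (auto simp: k_def add_pos_nonneg)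
    have lower: "pi * (u / k)\<^sup>2 \<le> measure lebesgue (\<Psi> ` B)"
    proof -
      have "ball (0::real^2) (u / k) \<subseteq> \<Psi> ` B \<union> \<Psi> ` (\<Phi>c - \<Phi>)"
      proof
        fix z :: "real^2" assume "z \<in> ball 0 (u / k)"
        then have z: "norm z < u / k" by simp
        define y where "y = z $ 1 *\<^sub>R e1 + z $ 2 *\<^sub>R e2"
        have ny: "n \<bullet> y = 0" using e by (simp add: y_def inner_add_right inner_commute)
        have "(norm y)\<^sup>2 = (norm z)\<^sup>2"
          unfolding normsq[of z] unfolding power2_norm_eq_inner y_def using e ee
          by (simp add: inner_add_left inner_add_right inner_commute power2_eq_square)
        then have yz: "norm y = norm z" by (rule power2_eq_imp_eq) auto
        have "u / k \<le> u" using k u by (simp add: divide_le_eq)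
        then have "norm y < \<epsilon>1" using yz z u \<epsilon> by linarith
        then obtain \<tau> where \<tau>: "\<bar>\<tau>\<bar> \<le> 2 * \<delta> * norm y" "N + y + \<tau> *\<^sub>R n \<in> \<Gamma>" using \<epsilon>1(2)[OF ny] by blast
        then have "N + y + \<tau> *\<^sub>R n \<in> r ` \<Phi>c" using closure_subset[of \<Gamma>] surface by auto
        then obtain p where p: "p \<in> \<Phi>c" "r p = N + y + \<tau> *\<^sub>R n" by auto
        have "\<pi>N (y + \<tau> *\<^sub>R n) = z"
          using e ee by (simp add: vec_eq_iff forall_2 \<pi>nth y_def inner_add_right inner_commute)
        then have \<Psi>p: "\<Psi> p = z" by (simp add: \<Psi>_def p)
        have "\<tau>\<^sup>2 \<le> (2 * \<delta> * norm y)\<^sup>2" using \<tau>(1) \<delta> by (simp add: abs_le_square_iff[symmetric])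
        then have "(norm y)\<^sup>2 + \<tau>\<^sup>2 \<le> (norm y)\<^sup>2 * k\<^sup>2" by (simp add: k(2) power_mult_distrib algebra_simps)
        moreover have "(norm (y + \<tau> *\<^sub>R n))\<^sup>2 = (norm y)\<^sup>2 + \<tau>\<^sup>2"
          unfolding power2_norm_eq_inner using ny n
          by (simp add: inner_add_left inner_add_right inner_commute power2_eq_square)
        ultimately have "(norm (y + \<tau> *\<^sub>R n))\<^sup>2 \<le> (norm y * k)\<^sup>2" by (simp add: power_mult_distrib)
        then have "norm (y + \<tau> *\<^sub>R n) \<le> norm y * k" by (rule power2_le_imp_le) (use k in auto)
        also have "\<dots> < u" using z k unfolding yz by (simp add: pos_less_divide_eq)
        finally have "dist N (r p) \<le> u" by (subst dist_commute) (simp add: p dist_norm)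
        then show "z \<in> \<Psi> ` B \<union> \<Psi> ` (\<Phi>c - \<Phi>)" using p(1) \<Psi>p by (auto simp: B_def)
      qed
      then have "measure lebesgue (ball (0::real^2) (u / k)) \<le> measure lebesgue (\<Psi> ` B \<union> \<Psi> ` (\<Phi>c - \<Phi>))"
        using area(1) edges by (intro measure_mono_fmeasurable fmeasurable.Un) (auto simp: negligible_iff_measure)
      also have "\<dots> \<le> measure lebesgue (\<Psi> ` B) + measure lebesgue (\<Psi> ` (\<Phi>c - \<Phi>))"
        using area(1) edges by (intro measure_Un_le) (auto simp: negligible_imp_sets)
      also have "measure lebesgue (\<Psi> ` (\<Phi>c - \<Phi>)) = 0" using edges by (simp add: negligible_iff_measure)
      finally show ?thesis using u k by (simp add: content_ball unit_ball_vol_2)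
    qed
    have c1: "(1 - \<delta>) * measure surface_measure (cball N u) \<le> measure lebesgue (\<Psi> ` B)"
    proof -
      have "(1 - \<delta>) * measure surface_measure (cball N u) = (LINT p:B|lborel. (1 - \<delta>) * dens p)" unfolding mB by simp
      also have "\<dots> \<le> (LINT p:B|lborel. J p)"
        using densB JBint JB by (intro set_integral_mono) auto
      finally show ?thesis using area by simp
    qed
    have c2: "measure lebesgue (\<Psi> ` B) \<le> measure surface_measure (cball N u)"
      unfolding area mB using densB JBint JB by (intro set_integral_mono) auto
    show ?case
    proof
      have "pi / (1 + 4 * \<delta>\<^sup>2) * u\<^sup>2 \<le> measure surface_measure (cball N u)"
        using lower c2 by (simp add: power_divide k)
      then show "pi / (1 + 4 * \<delta>\<^sup>2) \<le> measure surface_measure (cball N u) / u\<^sup>2" using u by (simp add: pos_le_divide_eq)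
      have "measure surface_measure (cball N u) \<le> pi * u\<^sup>2 / (1 - \<delta>)"
        using c1 upper \<delta> by (simp add: pos_le_divide_eq mult.commute)
      then show "measure surface_measure (cball N u) / u\<^sup>2 \<le> pi / (1 - \<delta>)" using u by (simp add: pos_divide_le_eq)
    qed
  qed
qed

lemma surface_measure_density:
  assumes N: "N \<in> \<Gamma>"
  shows "((\<lambda>u. measure surface_measure (cball N u) / u\<^sup>2) \<longlongrightarrow> pi) (at_right 0)"
proof (rule order_tendstoI)
  have small: "\<forall>\<^sub>F \<delta> in at_right 0. 0 < \<delta> \<and> \<delta> \<le> (1/2::real)"
    unfolding eventually_at_right_field by (intro exI[of _ "1/2"]) auto
  fix c :: real
  {
    assume "c < pi"
    have "((\<lambda>\<delta>::real. pi / (1 + 4 * \<delta>\<^sup>2)) \<longlongrightarrow> pi / (1 + 4 * 0\<^sup>2)) (at_right 0)"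
      by (intro tendsto_intros) auto
    then have "\<forall>\<^sub>F \<delta> in at_right 0. c < pi / (1 + 4 * \<delta>\<^sup>2)"
      using \<open>c < pi\<close> by (intro order_tendstoD) auto
    then have "\<forall>\<^sub>F \<delta> in at_right 0. 0 < \<delta> \<and> \<delta> \<le> 1/2 \<and> c < pi / (1 + 4 * \<delta>\<^sup>2)"
      using small by eventually_elim auto
    then obtain \<delta> where \<delta>: "0 < \<delta>" "\<delta> \<le> 1/2" "c < pi / (1 + 4 * \<delta>\<^sup>2)"
      using eventually_happens'[OF trivial_limit_at_right_real] by blast
    show "\<forall>\<^sub>F u in at_right 0. c < measure surface_measure (cball N u) / u\<^sup>2"
      using surface_measure_cball_bounds[OF N \<delta>(1,2)] by eventually_elim (use \<delta>(3) in auto)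
  next
    assume "pi < c"
    have "((\<lambda>\<delta>::real. pi / (1 - \<delta>)) \<longlongrightarrow> pi / (1 - 0)) (at_right 0)"
      by (intro tendsto_intros) auto
    then have "\<forall>\<^sub>F \<delta> in at_right 0. pi / (1 - \<delta>) < c"
      using \<open>pi < c\<close> by (intro order_tendstoD) auto
    then have "\<forall>\<^sub>F \<delta> in at_right 0. 0 < \<delta> \<and> \<delta> \<le> 1/2 \<and> pi / (1 - \<delta>) < c"
      using small by eventually_elim auto
    then obtain \<delta> where \<delta>: "0 < \<delta>" "\<delta> \<le> 1/2" "pi / (1 - \<delta>) < c"
      using eventually_happens'[OF trivial_limit_at_right_real] by blast
    show "\<forall>\<^sub>F u in at_right 0. measure surface_measure (cball N u) / u\<^sup>2 < c"
      using surface_measure_cball_bounds[OF N \<delta>(1,2)] by eventually_elim (use \<delta>(3) in auto)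
  }
qed

end

section \<open>The conormal derivative of the potential\<close>

text \<open>The gradient of \<open>q1_closed\<close> in M. The summand along P - M has the
  singularity of a double layer; the one along reflect P - M is singular at P = M only like 1/|P -
  M|, as long as the mirror distance stays positive.\<close>

definition q1_grad :: "real \<Rightarrow> real^3 \<Rightarrow> real^3 \<Rightarrow> real^3" where
  "q1_grad \<alpha> P M = (q1_factor \<alpha> * (dist P M + dist (reflect P) M) powr (- 2 * \<alpha>)) *\<^sub>R
     (((dist (reflect P) M + 2 * \<alpha> * dist P M) / (dist P M ^ 3 * dist (reflect P) M)) *\<^sub>R (P - M) +
      ((dist P M + 2 * \<alpha> * dist (reflect P) M) / (dist P M * dist (reflect P) M ^ 3)) *\<^sub>R (reflect P - M))"

lemma reflect_linear: "linear reflect"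
  by (rule linearI) (auto simp: vec_eq_iff forall_3)

lemma reflect_continuous: "continuous_on A reflect"
  using reflect_linear by (rule linear_continuous_on[OF linear_linear[THEN iffD2]])

lemma reflect_measurable [measurable]: "reflect \<in> borel_measurable borel"
  using reflect_continuous by (rule borel_measurable_continuous_onI)

lemma reflect_neq:
  assumes "P $ 1 \<ge> 0" "M $ 1 > 0" shows "reflect P \<noteq> M"
proof
  assume "reflect P = M"
  then have "- (P $ 1) = M $ 1" by (metis reflect_nth(1))
  with assms show False by simp
qed

lemma dist_line_deriv:
  assumes "P \<noteq> M + t *\<^sub>R v"
  shows "((\<lambda>t. dist P (M + t *\<^sub>R v)) has_real_derivative - (v \<bullet> (P - (M + t *\<^sub>R v))) / dist P (M + t *\<^sub>R v)) (at t)"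
proof -
  let ?x = "P - (M + t *\<^sub>R v)"
  have "((\<lambda>t. norm (P - (M + t *\<^sub>R v))) has_derivative (\<lambda>h. (- h *\<^sub>R v) \<bullet> sgn ?x)) (at t)"
  proof -
    have "((\<lambda>t. P - (M + t *\<^sub>R v)) has_derivative (\<lambda>h. - h *\<^sub>R v)) (at t)"
      by (auto intro!: derivative_eq_intros)
    moreover have "?x \<noteq> 0" using assms by simp
    ultimately show ?thesis by (rule has_derivative_compose[OF _ has_derivative_norm])
  qed
  then show ?thesis
    unfolding has_field_derivative_def dist_norm
    by (rule has_derivative_eq_rhs) (auto simp: sgn_div_norm fun_eq_iff divide_inverse)
qed

text \<open>In the two distances R and S this is the quotient rule; after the power W = (R +
  S)^(-2\<alpha>) is factored out, a rational identity remains.\<close>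

lemma q1_closed_deriv:
  assumes "P \<noteq> M + t *\<^sub>R v" "reflect P \<noteq> M + t *\<^sub>R v"
  shows "((\<lambda>t. q1_closed \<alpha> P (M + t *\<^sub>R v)) has_real_derivative v \<bullet> q1_grad \<alpha> P (M + t *\<^sub>R v)) (at t)"
proof -
  define x y where "x = v \<bullet> (P - (M + t *\<^sub>R v))" and "y = v \<bullet> (reflect P - (M + t *\<^sub>R v))"
  define R S where "R = dist P (M + t *\<^sub>R v)" and "S = dist (reflect P) (M + t *\<^sub>R v)"
  have pos: "R > 0" "S > 0" using assms by (auto simp: R_def S_def)
  note dR = dist_line_deriv[OF assms(1), folded x_def R_def]
  note dS = dist_line_deriv[OF assms(2), folded y_def S_def]
  define W where "W = (R + S) powr (- 2 * \<alpha>)"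
  have W: "(R + S) powr (1 - 2 * \<alpha>) = (R + S) * W"
    using pos powr_add[of "R + S" 1 "- 2 * \<alpha>"] by (simp add: W_def)
  have "((\<lambda>t. (dist P (M + t *\<^sub>R v) + dist (reflect P) (M + t *\<^sub>R v)) powr (1 - 2 * \<alpha>))
     has_real_derivative (1 - 2 * \<alpha>) * (- x / R + - y / S) * W) (at t)"
    using DERIV_powr[OF DERIV_add[OF dR dS] _ DERIV_const[of "1 - 2 * \<alpha>"]] pos W
    by (simp add: R_def[symmetric] S_def[symmetric] mult_ac)
  from DERIV_divide[OF this DERIV_mult[OF dR dS]]
  have "((\<lambda>t. (dist P (M + t *\<^sub>R v) + dist (reflect P) (M + t *\<^sub>R v)) powr (1 - 2 * \<alpha>) / (dist P (M + t *\<^sub>R v) * dist (reflect P) (M + t *\<^sub>R v)))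
     has_real_derivative ((1 - 2 * \<alpha>) * (- x / R + - y / S) * W * (R * S) - (R + S) * W * (- x / R * S + - y / S * R)) / (R * S * (R * S))) (at t)"
    using pos by (simp add: R_def[symmetric] S_def[symmetric] W)
  moreover have "((1 - 2 * \<alpha>) * (- x / R + - y / S) * W * (R * S) - (R + S) * W * (- x / R * S + - y / S * R)) / (R * S * (R * S))
    = W * ((S + 2 * \<alpha> * R) / (R ^ 3 * S) * x + (R + 2 * \<alpha> * S) / (R * S ^ 3) * y)"
    using pos by (simp add: field_simps power3_eq_cube)
  ultimately have "((\<lambda>t. (dist P (M + t *\<^sub>R v) + dist (reflect P) (M + t *\<^sub>R v)) powr (1 - 2 * \<alpha>) / (dist P (M + t *\<^sub>R v) * dist (reflect P) (M + t *\<^sub>R v)))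
     has_real_derivative W * ((S + 2 * \<alpha> * R) / (R ^ 3 * S) * x + (R + 2 * \<alpha> * S) / (R * S ^ 3) * y)) (at t)" by simp
  from DERIV_cmult[OF this, of "q1_factor \<alpha>"]
  show ?thesis
    unfolding q1_closed_def q1_grad_def
    by (simp add: R_def S_def W_def x_def y_def inner_add_right mult.assoc)
qed

lemma continuous_on_q1_closed:
  assumes "continuous_on T f" "continuous_on T g"
    and ne: "\<And>x. x \<in> T \<Longrightarrow> f x \<noteq> g x" "\<And>x. x \<in> T \<Longrightarrow> reflect (f x) \<noteq> g x"
  shows "continuous_on T (\<lambda>x. q1_closed \<alpha> (f x) (g x))"
    and "continuous_on T (\<lambda>x. q1_grad \<alpha> (f x) (g x))"
proof -
  define R S where "R = (\<lambda>x. dist (f x) (g x))" and "S = (\<lambda>x. dist (reflect (f x)) (g x))"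
  have rf: "continuous_on T (\<lambda>x. reflect (f x))"
    by (rule continuous_on_compose2[OF reflect_continuous[of UNIV] assms(1)]) auto
  have RS: "continuous_on T R" "continuous_on T S"
    unfolding R_def S_def by (intro continuous_on_dist rf assms)+
  have nz: "R x \<noteq> 0" "S x \<noteq> 0" "R x + S x \<noteq> 0" if "x \<in> T" for x
  proof -
    have "R x > 0" "S x > 0" using ne[OF that] by (auto simp: R_def S_def)
    then show "R x \<noteq> 0" "S x \<noteq> 0" "R x + S x \<noteq> 0" by auto
  qed
  have "continuous_on T (\<lambda>x. q1_factor \<alpha> * (R x + S x) powr (1 - 2 * \<alpha>) / (R x * S x))"
    by (intro continuous_intros RS) (use nz in auto)
  then show "continuous_on T (\<lambda>x. q1_closed \<alpha> (f x) (g x))"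
    by (simp only: q1_closed_def R_def S_def)
  have "continuous_on T (\<lambda>x. (q1_factor \<alpha> * (R x + S x) powr (- 2 * \<alpha>)) *\<^sub>R
     (((S x + 2 * \<alpha> * R x) / (R x ^ 3 * S x)) *\<^sub>R (f x - g x) +
      ((R x + 2 * \<alpha> * S x) / (R x * S x ^ 3)) *\<^sub>R (reflect (f x) - g x)))"
    by (intro continuous_intros RS rf assms) (use nz in auto)
  then show "continuous_on T (\<lambda>x. q1_grad \<alpha> (f x) (g x))"
    by (simp only: q1_grad_def R_def S_def)
qed

text \<open>Local agreement is the right hypothesis: kernel and potential are identified with their
  closed forms only where the first coordinate is positive and away from the singularity.\<close>

lemma partial_deriv_eq:
  assumes "((\<lambda>h. g (M + h *\<^sub>R axis k 1)) has_real_derivative D) (at 0)"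
    and "\<forall>\<^sub>F M' in nhds M. u M' = g M'"
  shows "partial_deriv k u M = D"
proof -
  have "((\<lambda>h. M + h *\<^sub>R axis k 1) \<longlongrightarrow> M + 0 *\<^sub>R axis k 1) (nhds 0)"
    by (intro tendsto_intros filterlim_ident)
  then have "\<forall>\<^sub>F h in nhds 0. u (M + h *\<^sub>R axis k 1) = g (M + h *\<^sub>R axis k 1)"
    using eventually_compose_filterlim[OF assms(2), of "\<lambda>h. M + h *\<^sub>R axis k 1" "nhds 0"] by simp
  then have "((\<lambda>h. u (M + h *\<^sub>R axis k 1)) has_real_derivative D) (at 0)"
    using assms(1) by (subst DERIV_cong_ev[OF refl _ refl])
  then show ?thesis unfolding partial_deriv_def by (rule DERIV_imp_deriv)
qed

lemma inner_vec3: "(x :: real^3) \<bullet> y = x $ 1 * y $ 1 + x $ 2 * y $ 2 + x $ 3 * y $ 3"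
  by (simp add: inner_vec_def sum_3)

lemma eventually_first_coord_pos: "M $ 1 > 0 \<Longrightarrow> \<forall>\<^sub>F M' in nhds M. M' $ 1 > 0" for M :: "real^3"
  by (rule eventually_nhds_in_open[of "{M. M $ 1 > 0}", simplified]) (auto intro!: open_Collect_less continuous_intros)

lemma conormal_q1:
  assumes "0 < \<alpha>" "P $ 1 \<ge> 0" "M $ 1 > 0" "P \<noteq> M"
  shows "conormal \<alpha> n (\<lambda>M. q1 \<alpha> P M) M = (M $ 1) powr (2 * \<alpha>) * (n \<bullet> q1_grad \<alpha> P M)"
proof -
  have pd: "partial_deriv k (q1 \<alpha> P) M = q1_grad \<alpha> P M $ k" for k
  proof (rule partial_deriv_eq)
    show "((\<lambda>h. q1_closed \<alpha> P (M + h *\<^sub>R axis k 1)) has_real_derivative q1_grad \<alpha> P M $ k) (at 0)"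
      using q1_closed_deriv[of P M 0 "axis k 1" \<alpha>] assms reflect_neq[of P M] by (simp add: inner_axis')
    have "\<forall>\<^sub>F M' in nhds M. M' \<noteq> P"
      using assms(4) by (intro t1_space_nhds) auto
    with eventually_first_coord_pos[OF assms(3)] show "\<forall>\<^sub>F M' in nhds M. q1 \<alpha> P M' = q1_closed \<alpha> P M'"
      by eventually_elim (use assms in \<open>auto simp: q1_eq_q1_closed\<close>)
  qed
  show ?thesis unfolding conormal_def pd inner_vec3 by simp
qed

section \<open>Differentiation of the potential off the surface\<close>

context lyapunov_domain
begin

text \<open>Off the compact closure of \<Gamma> the kernel and its gradient are continuous, so the
  partial derivatives pass under the integral. The indicator makes the layer density a Borel
  function on all of space, and the surface measure is carried by the set where it changes
  nothing.\<close>

lemma conormal_v1: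
  assumes \<alpha>: "0 < \<alpha>" and N: "N \<in> \<Gamma>" and \<rho>: "continuous_on (closure \<Gamma>) \<rho>"
    and M: "M $ 1 > 0" "M \<notin> closure \<Gamma>"
  shows "conormal \<alpha> n (v1 \<alpha> \<Phi> r rs rt \<rho>) M
    = (\<integral>P. indicator (closure \<Gamma>) P * \<rho> P * ((M $ 1) powr (2 * \<alpha>) * (n \<bullet> q1_grad \<alpha> P M)) \<partial>surface_measure)"
proof -
  interpret density_point surface_measure N
    by (intro density_point.intro finite_surface_measure density_point_axioms.intro sets_surface_measure surface_measure_density N)
  define \<rho>' where "\<rho>' = (\<lambda>P. indicator (closure \<Gamma>) P * \<rho> P)"
  have \<rho>'c: "continuous_on (closure \<Gamma>) \<rho>'"
    using \<rho> by (rule continuous_on_eq) (auto simp: \<rho>'_def)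
  have [measurable]: "\<rho>' \<in> borel_measurable borel"
    using borel_measurable_continuous_on_indicator[OF borel_closed[OF closed_closure] \<rho>] by (simp add: \<rho>'_def)
  note null = emeasure_center
  have [measurable]: "(\<lambda>P. q1_closed \<alpha> P M') \<in> borel_measurable borel" for M'
    unfolding q1_closed_def by measurable
  have gm [measurable]: "(\<lambda>P. v \<bullet> q1_grad \<alpha> P M') \<in> borel_measurable borel" for v M'
    unfolding q1_grad_def by measurable
  have v1_eq: "v1 \<alpha> \<Phi> r rs rt \<rho> M' = (\<integral>P. \<rho>' P * q1_closed \<alpha> P M' \<partial>surface_measure)" if "M' $ 1 > 0" "M' \<notin> closure \<Gamma>" for M'
    unfolding v1_def
  proof (rule surface_measure_transfer(2)[OF _ _ null])
    fix p assume "p \<in> \<Phi>"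
    then have rp: "r p \<in> closure \<Gamma>" using r_closure \<Phi>_subset by blast
    then have "r p \<noteq> M'" using that by auto
    then show "\<rho> (r p) * q1 \<alpha> (r p) M' = \<rho>' (r p) * q1_closed \<alpha> (r p) M'"
      using rp \<alpha> that closure_\<Gamma>_nonneg[OF rp] by (simp add: q1_eq_q1_closed \<rho>'_def)
  qed measurable
  \<comment> \<open>A closed ball in the half-space x > 0 that misses the surface: the segments
    along which derivatives are taken meet neither a point of the surface nor its mirror
    image.\<close>
  obtain d where d: "d > 0" "d < M $ 1" "cball M d \<inter> closure \<Gamma> = {}"
  proof -
    have "open (- closure \<Gamma>)" by auto
    then obtain e where "e > 0" "cball M e \<subseteq> - closure \<Gamma>" using M(2) open_contains_cball by (metis ComplI)
    then show thesis using M(1) by (intro that[of "min e (M $ 1 / 2)"]) auto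
  qed
  have dM: "M' $ 1 > 0" "M' \<notin> closure \<Gamma>" if "dist M M' \<le> d" for M'
    using that d ball_pos[of M M'] by auto
  have cont_grad: "continuous_on ({-d..d} \<times> closure \<Gamma>) (\<lambda>(t, P). \<rho>' P * (v \<bullet> q1_grad \<alpha> P (M + t *\<^sub>R v)))"
    and cont_q: "\<And>t. \<bar>t\<bar> \<le> d \<Longrightarrow> continuous_on (closure \<Gamma>) (\<lambda>P. \<rho>' P * q1_closed \<alpha> P (M + t *\<^sub>R v))" if v: "norm v = 1" for v
  proof -
    have nz: "P \<noteq> M + t *\<^sub>R v" "reflect P \<noteq> M + t *\<^sub>R v" if "\<bar>t\<bar> \<le> d" "P \<in> closure \<Gamma>" for t P
    proof -
      have "dist M (M + t *\<^sub>R v) \<le> d" using that v by (simp add: dist_norm)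
      from dM[OF this] that reflect_neq[OF closure_\<Gamma>_nonneg[OF that(2)]]
      show "P \<noteq> M + t *\<^sub>R v" "reflect P \<noteq> M + t *\<^sub>R v" by auto
    qed
    show "continuous_on ({-d..d} \<times> closure \<Gamma>) (\<lambda>(t, P). \<rho>' P * (v \<bullet> q1_grad \<alpha> P (M + t *\<^sub>R v)))"
    proof -
      have "snd x \<noteq> M + fst x *\<^sub>R v" "reflect (snd x) \<noteq> M + fst x *\<^sub>R v" if "x \<in> {-d..d} \<times> closure \<Gamma>" for x
        by (rule nz; use that in \<open>auto simp: abs_le_iff\<close>)+
      then show ?thesis
        unfolding case_prod_unfold
        by (intro continuous_intros continuous_on_q1_closed(2) continuous_on_compose2[OF \<rho>'c]) auto
    qed
    show "continuous_on (closure \<Gamma>) (\<lambda>P. \<rho>' P * q1_closed \<alpha> P (M + t *\<^sub>R v))" if "\<bar>t\<bar> \<le> d" for t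
      by (intro continuous_on_mult \<rho>'c continuous_on_q1_closed(1) continuous_on_id continuous_on_const nz that)
  qed
  have pd: "partial_deriv k (v1 \<alpha> \<Phi> r rs rt \<rho>) M = (\<integral>P. \<rho>' P * q1_grad \<alpha> P M $ k \<partial>surface_measure)"
    and int: "integrable surface_measure (\<lambda>P. \<rho>' P * q1_grad \<alpha> P M $ k)" for k
  proof -
    let ?v = "axis k 1 :: real^3"
    have v: "norm ?v = 1" by simp
    have "((\<lambda>t. \<integral>P. \<rho>' P * q1_closed \<alpha> P (M + t *\<^sub>R ?v) \<partial>surface_measure) has_real_derivative
       (\<integral>P. \<rho>' P * (?v \<bullet> q1_grad \<alpha> P (M + 0 *\<^sub>R ?v)) \<partial>surface_measure)) (at 0)"
    proof (rule has_derivative_integral_compact[OF finite_surface_measure sets_surface_measure compact_closure_\<Gamma> AE_surface_measure d(1)])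
      fix t P assume t: "\<bar>t\<bar> \<le> d" "P \<in> closure \<Gamma>"
      have "dist M (M + t *\<^sub>R ?v) \<le> d" using t v by (simp add: dist_norm)
      from dM[OF this] t reflect_neq[OF closure_\<Gamma>_nonneg[OF t(2)]]
      show "((\<lambda>t. \<rho>' P * q1_closed \<alpha> P (M + t *\<^sub>R ?v)) has_real_derivative \<rho>' P * (?v \<bullet> q1_grad \<alpha> P (M + t *\<^sub>R ?v))) (at t)"
        by (intro DERIV_cmult q1_closed_deriv) auto
    qed (use cont_grad[OF v] cont_q[OF v] in \<open>auto\<close>)
    then have "((\<lambda>t. \<integral>P. \<rho>' P * q1_closed \<alpha> P (M + t *\<^sub>R ?v) \<partial>surface_measure) has_real_derivative
       (\<integral>P. \<rho>' P * q1_grad \<alpha> P M $ k \<partial>surface_measure)) (at 0)" by (simp add: inner_axis')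
    moreover have "\<forall>\<^sub>F M' in nhds M. v1 \<alpha> \<Phi> r rs rt \<rho> M' = (\<integral>P. \<rho>' P * q1_closed \<alpha> P M' \<partial>surface_measure)"
    proof -
      have "\<forall>\<^sub>F M' in nhds M. M' \<in> - closure \<Gamma>"
        using M(2) by (intro eventually_nhds_in_open) auto
      with eventually_first_coord_pos[OF M(1)] show ?thesis by eventually_elim (auto intro: v1_eq)
    qed
    ultimately show "partial_deriv k (v1 \<alpha> \<Phi> r rs rt \<rho>) M = (\<integral>P. \<rho>' P * q1_grad \<alpha> P M $ k \<partial>surface_measure)"
      by (rule partial_deriv_eq)
    have "continuous_on (closure \<Gamma>) (\<lambda>P. (\<lambda>(t, P). \<rho>' P * (?v \<bullet> q1_grad \<alpha> P (M + t *\<^sub>R ?v))) (0, P))"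
      using d(1) by (intro continuous_on_compose2[OF cont_grad[OF v]] continuous_intros) auto
    moreover have "(\<lambda>P. \<rho>' P * (?v \<bullet> q1_grad \<alpha> P M)) \<in> borel_measurable borel" by measurable
    ultimately show "integrable surface_measure (\<lambda>P. \<rho>' P * q1_grad \<alpha> P M $ k)"
      by (intro integrable_continuous_on_compact[OF finite_surface_measure sets_surface_measure compact_closure_\<Gamma> AE_surface_measure]) (auto simp: inner_axis')
  qed
  have "(\<integral>P. \<rho>' P * ((M $ 1) powr (2 * \<alpha>) * (n \<bullet> q1_grad \<alpha> P M)) \<partial>surface_measure)
      = (\<integral>P. (M $ 1) powr (2 * \<alpha>) * (n $ 1 * (\<rho>' P * q1_grad \<alpha> P M $ 1) + n $ 2 * (\<rho>' P * q1_grad \<alpha> P M $ 2)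
         + n $ 3 * (\<rho>' P * q1_grad \<alpha> P M $ 3)) \<partial>surface_measure)"
    by (intro Bochner_Integration.integral_cong refl) (simp add: inner_vec3 algebra_simps)
  also have "\<dots> = conormal \<alpha> n (v1 \<alpha> \<Phi> r rs rt \<rho>) M"
    unfolding conormal_def pd using int by simp
  finally show ?thesis by (simp add: \<rho>'_def)
qed

end

section \<open>The jump relation for the conormal derivative\<close>

text \<open>At P = M = N the distance is 0 and the mirror distance is 2x, so the weight
  x^(2\<alpha>) of the conormal derivative cancels the remaining powers of x and of 2.\<close>

lemma q1_factor_normalization:
  assumes "x > 0"
  shows "x powr (2 * \<alpha>) * q1_factor \<alpha> * (2 * x) powr (- 2 * \<alpha>) = 1 / (4 * pi)"
  using assms by (simp add: q1_factor_def powr_mult powr_minus divide_simps)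

theorem theorem3:
  fixes \<alpha> s1 s2 t1 t2 t0 s t :: real
    and X \<Gamma> D :: "(real^3) set"
    and r rs rt :: "real \<times> real \<Rightarrow> real^3"
    and \<nu> :: "real^3 \<Rightarrow> real^3"
    and \<rho> :: "real^3 \<Rightarrow> real"
    and \<Phi> :: "(real \<times> real) set"
  assumes "\<Phi> = box (s1, t1) (s2, t2)"
    and "0 < 2 * \<alpha>" and "2 * \<alpha> < 1"
    and "lyapunov_domain X \<Gamma> D s1 s2 t1 t2 t0 r rs rt \<nu>"
    and "continuous_on (closure \<Gamma>) \<rho>"
    and "(s, t) \<in> cbox (s1, t1) (s2, t2)" and "r (s, t) \<in> \<Gamma>"
  shows "surface_integrable \<Phi> rs rt (\<lambda>p. \<rho> (r p) * K1 \<alpha> r \<nu> p (s, t)) \<and>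
    ((\<lambda>h. conormal \<alpha> (\<nu> (r (s, t))) (v1 \<alpha> \<Phi> r rs rt \<rho>) (r (s, t) - h *\<^sub>R \<nu> (r (s, t))))
      \<longlongrightarrow> 1/2 * \<rho> (r (s, t)) + surface_integral \<Phi> rs rt (\<lambda>p. \<rho> (r p) * K1 \<alpha> r \<nu> p (s, t)))
      (at_right 0) \<and>
    ((\<lambda>h. conormal \<alpha> (\<nu> (r (s, t))) (v1 \<alpha> \<Phi> r rs rt \<rho>) (r (s, t) + h *\<^sub>R \<nu> (r (s, t))))
      \<longlongrightarrow> - 1/2 * \<rho> (r (s, t)) + surface_integral \<Phi> rs rt (\<lambda>p. \<rho> (r p) * K1 \<alpha> r \<nu> p (s, t)))
      (at_right 0)"
proof -
  interpret lyapunov_domain X \<Gamma> D s1 s2 t1 t2 t0 r rs rt \<nu> by fact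
  define N n where "N = r (s, t)" and "n = \<nu> N"
  have N: "N \<in> \<Gamma>" "N $ 1 > 0" using assms(7) \<Gamma>_pos by (auto simp: N_def)
  have n: "norm n = 1" "n \<bullet> n = 1" using normal_norm[OF N(1)] by (auto simp: n_def dot_square_norm)
  have \<alpha>: "0 < \<alpha>" using assms(2) by simp
  interpret density_point surface_measure N
    by (intro density_point.intro finite_surface_measure density_point_axioms.intro sets_surface_measure surface_measure_density N)
  note null = emeasure_center
  define \<rho>' where "\<rho>' = (\<lambda>P. indicator (closure \<Gamma>) P * \<rho> P)"
  have \<rho>'c: "continuous_on (closure \<Gamma>) \<rho>'"
    using assms(5) by (rule continuous_on_eq) (auto simp: \<rho>'_def)
  have [measurable]: "\<rho>' \<in> borel_measurable borel"
    using borel_measurable_continuous_on_indicator[OF borel_closed[OF closed_closure] assms(5)] by (simp add: \<rho>'_def)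
  have N\<Gamma>: "N \<in> closure \<Gamma>" using N closure_subset by blast
  \<comment> \<open>\<open>C\<close> is the common factor of layer density, weight and power of the
    distance sum; \<open>a\<close> and \<open>b\<close> collect the coefficients belonging to P - M
    and to reflect P - M.\<close>
  define C where "C = (\<lambda>P M. \<rho>' P * (M $ 1) powr (2 * \<alpha>) * (q1_factor \<alpha> * (dist P M + dist (reflect P) M) powr (- 2 * \<alpha>)))"
  define a where "a = (\<lambda>P M. C P M * (dist (reflect P) M + 2 * \<alpha> * dist P M) / dist (reflect P) M)"
  define b where "b = (\<lambda>P M. C P M * (dist P M + 2 * \<alpha> * dist (reflect P) M) * (n \<bullet> (reflect P - M)) / dist (reflect P) M ^ 3)"
  have K: "\<rho>' P * ((M $ 1) powr (2 * \<alpha>) * (n \<bullet> q1_grad \<alpha> P M)) = a P M * (n \<bullet> (P - M)) / dist P M ^ 3 + b P M / dist P M" for P M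
    unfolding q1_grad_def a_def b_def C_def by (simp add: inner_add_right divide_inverse algebra_simps)
  obtain \<mu> H \<epsilon>1 where \<mu>: "0 < \<mu>" "\<mu> \<le> 1" and \<epsilon>1: "\<epsilon>1 > 0"
    "\<And>Q. Q \<in> \<Gamma> \<Longrightarrow> dist N Q < \<epsilon>1 \<Longrightarrow> \<bar>n \<bullet> (Q - N)\<bar> \<le> H * dist N Q powr (1 + \<mu>)"
    using normal_secant_holder[OF N(1)] unfolding n_def by metis
  \<comment> \<open>Within this radius M keeps a positive first coordinate, so the mirror distance
    stays positive and \<open>a\<close>, \<open>b\<close> are continuous even across P = M.\<close>
  define \<epsilon> where "\<epsilon> = min \<epsilon>1 (N $ 1 / 2)"
  have \<epsilon>: "\<epsilon> > 0" "\<epsilon> \<le> \<epsilon>1" "\<epsilon> < N $ 1" using \<epsilon>1 N by (auto simp: \<epsilon>_def)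
  have nz: "M $ 1 > 0" "reflect P \<noteq> M" if "P \<in> closure \<Gamma>" "dist N M \<le> \<epsilon>" for P M
  proof -
    show "M $ 1 > 0" using ball_pos[of N M] that \<epsilon> by simp
    then show "reflect P \<noteq> M" by (rule reflect_neq[OF closure_\<Gamma>_nonneg[OF that(1)]])
  qed
  define T where "T = closure \<Gamma> \<times> cball N \<epsilon>"
  have rf: "continuous_on T (\<lambda>x. reflect (fst x))"
    by (rule continuous_on_compose2[OF reflect_continuous[of UNIV]]) (auto intro: continuous_intros)
  have \<rho>T: "continuous_on T (\<lambda>x. \<rho>' (fst x))"
    by (rule continuous_on_compose2[OF \<rho>'c]) (auto intro: continuous_intros simp: T_def)
  have Tpos: "snd x $ 1 > 0" "dist (reflect (fst x)) (snd x) > 0" if "x \<in> T" for x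
    using nz[of "fst x" "snd x"] that by (auto simp: T_def)
  have Tnz: "snd x $ 1 \<noteq> 0" "dist (reflect (fst x)) (snd x) \<noteq> 0"
    "dist (fst x) (snd x) + dist (reflect (fst x)) (snd x) \<noteq> 0" if "x \<in> T" for x
    using Tpos[OF that] zero_le_dist[of "fst x" "snd x"] by linarith+
  have Cc: "continuous_on T (\<lambda>x. C (fst x) (snd x))"
    unfolding C_def by (intro continuous_intros \<rho>T rf) (use Tnz in blast)+
  have ac: "continuous_on T (\<lambda>(P, M). a P M)"
    unfolding a_def case_prod_unfold by (intro continuous_intros Cc rf) (use Tnz in blast)+
  have bc: "continuous_on T (\<lambda>(P, M). b P M)"
    unfolding b_def case_prod_unfold by (intro continuous_intros Cc rf) (use Tnz in force)+
  have am: "(\<lambda>P. a P M) \<in> borel_measurable borel" "(\<lambda>P. b P M) \<in> borel_measurable borel" for M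
    unfolding a_def b_def C_def by measurable
  have hol: "\<bar>n \<bullet> (P - N)\<bar> \<le> H * dist N P powr (1 + \<mu>)" if "P \<in> closure \<Gamma>" "dist N P < \<epsilon>" for P
    using that \<epsilon> by (intro \<epsilon>1(2) mem_\<Gamma> ball_pos[of N]) auto
  note jump = layer_potential_jump[OF compact_closure_\<Gamma> N\<Gamma> AE_surface_measure n(1) am \<epsilon>(1) ac[unfolded T_def] bc[unfolded T_def] \<mu> hol]
  define KK where "KK = (\<lambda>P M. \<rho>' P * ((M $ 1) powr (2 * \<alpha>) * (n \<bullet> q1_grad \<alpha> P M)))"
  have KKi: "integrable surface_measure (\<lambda>P. KK P N)" unfolding KK_def K by (rule jump(1)[of 1]) auto
  \<comment> \<open>With distance 0 the quotient of distances in \<open>a\<close> is 1, and the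
    normalization of the kernel leaves \<rho> / (4 pi).\<close>
  have aNN: "2 * pi * a N N = 1/2 * \<rho> N"
  proof -
    have "dist (reflect N) N = 2 * N $ 1"
    proof -
      have "(dist (reflect N) N)\<^sup>2 = (2 * N $ 1)\<^sup>2"
        unfolding refl_dist_sq_eq[symmetric] refl_dist_sq_def by simp
      then show ?thesis by (rule power2_eq_imp_eq) (use N in auto)
    qed
    then show ?thesis
      using q1_factor_normalization[OF N(2), of \<alpha>] N N\<Gamma> by (simp add: a_def C_def \<rho>'_def field_simps)
  qed
  have tr: "surface_integrable \<Phi> rs rt (\<lambda>p. \<rho> (r p) * K1 \<alpha> r \<nu> p (s, t)) \<longleftrightarrow> integrable surface_measure (\<lambda>P. KK P N)"
    "surface_integral \<Phi> rs rt (\<lambda>p. \<rho> (r p) * K1 \<alpha> r \<nu> p (s, t)) = (\<integral>P. KK P N \<partial>surface_measure)"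
  proof -
    have m: "(\<lambda>P. KK P N) \<in> borel_measurable borel" unfolding KK_def K using am by measurable
    have g: "\<rho> (r p) * K1 \<alpha> r \<nu> p (s, t) = KK (r p) N" if "p \<in> box (s1, t1) (s2, t2)" "r p \<noteq> N" for p
    proof -
      have rp: "r p \<in> closure \<Gamma>" using that(1) r_closure \<Phi>_subset by blast
      show ?thesis
        unfolding K1_def N_def[symmetric] n_def[symmetric] KK_def \<rho>'_def
        using conormal_q1[OF \<alpha> closure_\<Gamma>_nonneg[OF rp] N(2) that(2)] rp by simp
    qed
    show "surface_integrable \<Phi> rs rt (\<lambda>p. \<rho> (r p) * K1 \<alpha> r \<nu> p (s, t)) \<longleftrightarrow> integrable surface_measure (\<lambda>P. KK P N)"
      "surface_integral \<Phi> rs rt (\<lambda>p. \<rho> (r p) * K1 \<alpha> r \<nu> p (s, t)) = (\<integral>P. KK P N \<partial>surface_measure)"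
      unfolding assms(1) using surface_measure_transfer[OF m g null] by auto
  qed
  \<comment> \<open>For small h > 0 the points N - e h n have height h at distance h from N, which
    contradicts the secant bound with slope 1/2. So they lie off the surface and the integral
    formula for the conormal derivative applies to them.\<close>
  obtain \<epsilon>2 where \<epsilon>2: "\<epsilon>2 > 0" "\<And>Q. Q \<in> \<Gamma> \<Longrightarrow> dist N Q < \<epsilon>2 \<Longrightarrow> \<bar>n \<bullet> (Q - N)\<bar> \<le> 1/2 * dist N Q"
    using secant_bound[OF N(1), of "1/2"] unfolding n_def by auto
  \<comment> \<open>The sign e selects the side: e = 1 moves from N against the outer normal into
    \<open>D\<close>, e = -1 moves outwards.\<close>
  have main: "((\<lambda>h. conormal \<alpha> n (v1 \<alpha> \<Phi> r rs rt \<rho>) (N - (e * h) *\<^sub>R n)) \<longlongrightarrow> e * (1/2 * \<rho> N) + (\<integral>P. KK P N \<partial>surface_measure)) (at_right 0)"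
    if e: "e\<^sup>2 = 1" for e
  proof -
    have ae: "\<bar>e\<bar> = 1" using e by (auto simp: power2_eq_1_iff)
    have "((\<lambda>h. \<integral>P. KK P (N - (e * h) *\<^sub>R n) \<partial>surface_measure) \<longlongrightarrow> 2 * pi * (e * a N N) + (\<integral>P. KK P N \<partial>surface_measure)) (at_right 0)"
      unfolding KK_def K by (rule jump(2)) (use e in auto)
    moreover have "2 * pi * (e * a N N) = e * (1/2 * \<rho> N)" unfolding aNN[symmetric] by simp
    moreover have "\<forall>\<^sub>F h in at_right 0. (\<integral>P. KK P (N - (e * h) *\<^sub>R n) \<partial>surface_measure) = conormal \<alpha> n (v1 \<alpha> \<Phi> r rs rt \<rho>) (N - (e * h) *\<^sub>R n)"
    proof -
      have "\<forall>\<^sub>F h in at_right 0. 0 < h \<and> h < min \<epsilon>2 (N $ 1)"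
        unfolding eventually_at_right_field using \<epsilon>2 N by (intro exI[of _ "min \<epsilon>2 (N $ 1)"]) auto
      then show ?thesis
      proof eventually_elim
        case (elim h)
        define M where "M = N - (e * h) *\<^sub>R n"
        have d: "dist N M = h" using elim n ae by (simp add: M_def dist_norm abs_mult)
        have M1: "M $ 1 > 0" using ball_pos[of N M] d elim by simp
        have "M \<notin> closure \<Gamma>"
        proof
          assume "M \<in> closure \<Gamma>"
          then have "M \<in> \<Gamma>" using M1 by (rule mem_\<Gamma>)
          then have "\<bar>n \<bullet> (M - N)\<bar> \<le> 1/2 * h" using \<epsilon>2(2)[of M] d elim by simp
          moreover have "\<bar>n \<bullet> (M - N)\<bar> = h" using n ae elim by (simp add: M_def abs_mult)
          ultimately show False using elim by simp
        qed
        from conormal_v1[OF \<alpha> N(1) assms(5) M1 this, of n]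
        show ?case unfolding assms(1) M_def[symmetric] by (simp add: KK_def \<rho>'_def)
      qed
    qed
    ultimately show ?thesis by (simp only:) (rule Lim_transform_eventually)
  qed
  have "surface_integrable \<Phi> rs rt (\<lambda>p. \<rho> (r p) * K1 \<alpha> r \<nu> p (s, t))"
    unfolding tr(1) by (rule KKi)
  moreover have "((\<lambda>h. conormal \<alpha> n (v1 \<alpha> \<Phi> r rs rt \<rho>) (N - h *\<^sub>R n))
      \<longlongrightarrow> 1/2 * \<rho> N + (\<integral>P. KK P N \<partial>surface_measure)) (at_right 0)"
    using main[of 1] by simp
  moreover have "((\<lambda>h. conormal \<alpha> n (v1 \<alpha> \<Phi> r rs rt \<rho>) (N + h *\<^sub>R n))
      \<longlongrightarrow> - 1/2 * \<rho> N + (\<integral>P. KK P N \<partial>surface_measure)) (at_right 0)"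
    using main[of "-1"] by simp
  ultimately show ?thesis
    unfolding tr(2) N_def[symmetric] n_def[symmetric] by (intro conjI)
qed

end
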